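(* Let $R$ be a ring and let $M$ be a left $R$-module which is a progenerator in $\sigma[M]$ and semiprime. Suppose that $M$ is a Goldie module and that $P_1,\dots,P_n$ are the minimal prime in $M$ submodules. Then there is a ring isomorphism $$\mathrm{End}_R(\widehat{M})\cong \mathrm{End}_R(E^{[M]}(M/P_1))\times\cdots\times \mathrm{End}_R(E^{[M]}(M/P_n)),$$ where each $\mathrm{End}_R(E^{[M]}(M/P_i))$ is a simple right artinian ring and is the classical right ring of quotients of $\mathrm{End}_R(M/P_i)$.
   Context: Rings are associative with unit and modules are left unital modules; endomorphism rings have composition $fg=f\circ g$ as multiplication. $\sigma[M]$ is the full subcategory of $R$-Mod of $M$-subgenerated modules (submodules of quotients of direct sums of copies of $M$). "Projective in $\sigma[M]$" means that $\mathrm{Hom}_R(M,-)$ is exact on short exact sequences in $\sigma[M]$; "generator in $\sigma[M]$" means every module in $\sigma[M]$ is a quotient of a direct sum of copies of $M$; a progenerator in $\sigma[M]$ is a finitely generated module that is projective in $\sigma[M]$ and a generator in $\sigma[M]$. For $K\in\sigma[X]$, $E^{[X]}(K)$ denotes the $X$-injective hull of $K$ (its injective hull in the category $\sigma[X]$), and $\widehat{X}=E^{[X]}(X)$. A submodule $N\le M$ is fully invariant, $N\leq_{FI}M$, if $f(N)\le N$ for all $f\in \mathrm{End}_R(M)$. For $N,K\le M$, the product is $N_MK=\sum\{f(N)\mid f\in \mathrm{Hom}_R(M,K)\}$. A proper submodule $P\leq_{FI}M$ is prime in $M$ if whenever $N,K\leq_{FI}M$ and $N_MK\le P$, then $N\le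 P$ or $K\le P$; the minimal prime in $M$ submodules are the minimal elements (under inclusion) of the set of prime in $M$ submodules. $M$ is semiprime if whenever $K\leq_{FI}M$ and $K_MK=0$, then $K=0$. A left annihilator in $M$ is a submodule of the form $\bigcap_{f\in X}\mathrm{Ker}(f)$ for some $X\subseteq \mathrm{End}_R(M)$. $M$ is a Goldie module if it satisfies ACC on left annihilators and has finite uniform dimension. *)

theory Defs
  imports "HOL-Algebra.Module" "HOL-Algebra.Chinese_Remainder" "HOL-Algebra.Product_Groups"
begin

section \<open>Left modules over a (not necessarily commutative) ring\<close>

text \<open>The library locale \<^locale>\<open>module\<close> requires a commutative ring of scalars.  The record type of
  modules, the locale \<^locale>\<open>submodule\<close> and the cosets of \<^theory>\<open>HOL-Algebra.AbelCoset\<close> do not, and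
  are reused.  The fields \<^const>\<open>mult\<close> and \<^const>\<open>one\<close> of a module record carry no meaning.\<close>

locale left_module = R?: ring R + M?: abelian_group M
  for R :: "('a, 'r) ring_scheme" (structure) and M :: "('a, 'm) module" (structure) +
  assumes smult_closed [simp, intro]:
      "\<lbrakk>a \<in> carrier R; x \<in> carrier M\<rbrakk> \<Longrightarrow> a \<odot>\<^bsub>M\<^esub> x \<in> carrier M"
    and smult_l_distr:
      "\<lbrakk>a \<in> carrier R; b \<in> carrier R; x \<in> carrier M\<rbrakk> \<Longrightarrow>
        (a \<oplus>\<^bsub>R\<^esub> b) \<odot>\<^bsub>M\<^esub> x = a \<odot>\<^bsub>M\<^esub> x \<oplus>\<^bsub>M\<^esub> b \<odot>\<^bsub>M\<^esub> x"
    and smult_r_distr: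
      "\<lbrakk>a \<in> carrier R; x \<in> carrier M; y \<in> carrier M\<rbrakk> \<Longrightarrow>
        a \<odot>\<^bsub>M\<^esub> (x \<oplus>\<^bsub>M\<^esub> y) = a \<odot>\<^bsub>M\<^esub> x \<oplus>\<^bsub>M\<^esub> a \<odot>\<^bsub>M\<^esub> y"
    and smult_assoc1:
      "\<lbrakk>a \<in> carrier R; b \<in> carrier R; x \<in> carrier M\<rbrakk> \<Longrightarrow>
        (a \<otimes>\<^bsub>R\<^esub> b) \<odot>\<^bsub>M\<^esub> x = a \<odot>\<^bsub>M\<^esub> (b \<odot>\<^bsub>M\<^esub> x)"
    and smult_one [simp]:
      "x \<in> carrier M \<Longrightarrow> \<one>\<^bsub>R\<^esub> \<odot>\<^bsub>M\<^esub> x = x"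

text \<open>Homomorphisms are extensional functions, so that equality of functions is equality of maps.\<close>

definition Hom :: "('a, 'r) ring_scheme \<Rightarrow> ('a, 'm) module \<Rightarrow> ('a, 'n) module \<Rightarrow> ('m \<Rightarrow> 'n) set" where
  "Hom R M N = {f \<in> carrier M \<rightarrow>\<^sub>E carrier N.
     (\<forall>x\<in>carrier M. \<forall>y\<in>carrier M. f (x \<oplus>\<^bsub>M\<^esub> y) = f x \<oplus>\<^bsub>N\<^esub> f y) \<and>
     (\<forall>r\<in>carrier R. \<forall>x\<in>carrier M. f (r \<odot>\<^bsub>M\<^esub> x) = r \<odot>\<^bsub>N\<^esub> f x)}"

definition End_ring :: "('a, 'r) ring_scheme \<Rightarrow> ('a, 'm) module \<Rightarrow> ('m \<Rightarrow> 'm) ring" where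
  "End_ring R M =
    \<lparr>carrier = Hom R M M,
     mult = (\<lambda>f g. compose (carrier M) f g),
     one = (\<lambda>x\<in>carrier M. x),
     zero = (\<lambda>x\<in>carrier M. \<zero>\<^bsub>M\<^esub>),
     add = (\<lambda>f g. \<lambda>x\<in>carrier M. f x \<oplus>\<^bsub>M\<^esub> g x)\<rparr>"

definition submodule_as_module :: "('a, 'm) module \<Rightarrow> 'm set \<Rightarrow> ('a, 'm) module" where
  "submodule_as_module M K = M\<lparr>carrier := K\<rparr>"

definition quotient_module :: "('a, 'm) module \<Rightarrow> 'm set \<Rightarrow> ('a, 'm set) module" where
  "quotient_module M N =
    \<lparr>carrier = a_rcosets\<^bsub>M\<^esub> N,
     mult = undefined,
     one = undefined,
     zero = N,
     add = (<+>\<^bsub>M\<^esub>),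
     smult = (\<lambda>r X. \<Union>x\<in>X. N +>\<^bsub>M\<^esub> (r \<odot>\<^bsub>M\<^esub> x))\<rparr>"

text \<open>The direct sum of copies of \<open>M\<close> indexed by \<open>I\<close>.\<close>

definition copower :: "'i set \<Rightarrow> ('a, 'm) module \<Rightarrow> ('a, 'i \<Rightarrow> 'm) module" where
  "copower I M =
    \<lparr>carrier = carrier (sum_group I (\<lambda>_. add_monoid M)),
     mult = undefined,
     one = undefined,
     zero = \<one>\<^bsub>sum_group I (\<lambda>_. add_monoid M)\<^esub>,
     add = (\<otimes>\<^bsub>sum_group I (\<lambda>_. add_monoid M)\<^esub>),
     smult = (\<lambda>r x. \<lambda>i\<in>I. r \<odot>\<^bsub>M\<^esub> x i)\<rparr>"

definition submodule_generated ::
  "('a, 'r) ring_scheme \<Rightarrow> ('a, 'm) module \<Rightarrow> 'm set \<Rightarrow> 'm set" where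
  "submodule_generated R M S = \<Inter>{N. submodule N R M \<and> S \<subseteq> N}"

definition finitely_generated_module :: "('a, 'r) ring_scheme \<Rightarrow> ('a, 'm) module \<Rightarrow> bool" where
  "finitely_generated_module R M \<longleftrightarrow>
    (\<exists>S. finite S \<and> S \<subseteq> carrier M \<and> carrier M = submodule_generated R M S)"


section \<open>The category \<open>\<sigma>[M]\<close>\<close>

text \<open>\<open>N\<close> lies in \<open>\<sigma>[M]\<close> iff it embeds into a quotient of a direct sum of copies of \<open>M\<close>.  HOL cannot
  quantify over all index sets, but subsets of \<open>N \<times> \<nat>\<close> always suffice: each element of \<open>N\<close> is
  represented by an element of the direct sum with finite support, so only \<open>N \<times> \<nat>\<close> many summands
  are needed.  The same applies to \<open>generated_by\<close>.\<close>

definition in_sigma :: "('a, 'r) ring_scheme \<Rightarrow> ('a, 'm) module \<Rightarrow> ('a, 'n) module \<Rightarrow> bool" where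
  "in_sigma R M N \<longleftrightarrow> left_module R N \<and>
    (\<exists>(I :: ('n \<times> nat) set) U j.
       submodule U R (copower I M) \<and>
       j \<in> Hom R N (quotient_module (copower I M) U) \<and> inj_on j (carrier N))"

definition generated_by :: "('a, 'r) ring_scheme \<Rightarrow> ('a, 'm) module \<Rightarrow> ('a, 'n) module \<Rightarrow> bool" where
  "generated_by R M N \<longleftrightarrow>
    (\<exists>(I :: ('n \<times> nat) set) p. p \<in> Hom R (copower I M) N \<and> p ` carrier (copower I M) = carrier N)"

text \<open>HOL cannot quantify over the modules of all carrier types either.  In
  \<open>generator_in_sigma\<close>, \<open>projective_in_sigma\<close> and \<open>injective_in_sigma\<close> the objects of \<open>\<sigma>[M]\<close> range over the modules with carrier in the following type.  Every finitely
  generated module in \<open>\<sigma>[M]\<close> embeds into a quotient of \<open>M\<^sup>k\<close>, hence of the direct sum of copies of \<open>M\<close>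
  indexed by \<^typ>\<open>nat\<close>, and so is isomorphic to a module of this type.  Consequently the conditions
  are equivalent to those with objects of arbitrary carrier type:
  a module is generated by \<open>M\<close> iff its cyclic submodules are; injectivity in \<open>\<sigma>[M]\<close> need only be tested
  on monomorphisms into cyclic modules (Baer's argument); and for finitely generated \<open>M\<close>, the only
  case in which projectivity is used, exactness of \<open>Hom(M, -)\<close> need only be tested on short exact
  sequences with finitely generated middle term.\<close>

type_synonym 'm sigma_obj = "(nat \<Rightarrow> 'm) set"

definition generator_in_sigma :: "('a, 'r) ring_scheme \<Rightarrow> ('a, 'm) module \<Rightarrow> bool" where
  "generator_in_sigma R M \<longleftrightarrow>
    (\<forall>N :: ('a, 'm sigma_obj) module. in_sigma R M N \<longrightarrow> generated_by R M N)"

definition short_exact ::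
  "('a, 'r) ring_scheme \<Rightarrow> ('a, 'x) module \<Rightarrow> ('a, 'y) module \<Rightarrow> ('a, 'z) module \<Rightarrow>
    ('x \<Rightarrow> 'y) \<Rightarrow> ('y \<Rightarrow> 'z) \<Rightarrow> bool" where
  "short_exact R A B C f g \<longleftrightarrow>
    f \<in> Hom R A B \<and> g \<in> Hom R B C \<and> inj_on f (carrier A) \<and>
    f ` carrier A = a_kernel B C g \<and> g ` carrier B = carrier C"

text \<open>The three conclusions say that \<open>0 \<rightarrow> Hom(M,A) \<rightarrow> Hom(M,B) \<rightarrow> Hom(M,C) \<rightarrow> 0\<close> is exact.\<close>

definition projective_in_sigma :: "('a, 'r) ring_scheme \<Rightarrow> ('a, 'm) module \<Rightarrow> bool" where
  "projective_in_sigma R M \<longleftrightarrow>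
    (\<forall>(A :: ('a, 'm sigma_obj) module) (B :: ('a, 'm sigma_obj) module)
      (C :: ('a, 'm sigma_obj) module) f g.
       in_sigma R M A \<longrightarrow> in_sigma R M B \<longrightarrow> in_sigma R M C \<longrightarrow> short_exact R A B C f g \<longrightarrow>
         inj_on (\<lambda>h. compose (carrier M) f h) (Hom R M A) \<and>
         (\<lambda>h. compose (carrier M) f h) ` Hom R M A =
           {h \<in> Hom R M B. compose (carrier M) g h = (\<lambda>x\<in>carrier M. \<zero>\<^bsub>C\<^esub>)} \<and>
         (\<lambda>h. compose (carrier M) g h) ` Hom R M B = Hom R M C)"

definition injective_in_sigma ::
  "('a, 'r) ring_scheme \<Rightarrow> ('a, 'm) module \<Rightarrow> ('a, 'e) module \<Rightarrow> bool" where
  "injective_in_sigma R M E \<longleftrightarrow> in_sigma R M E \<and>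
    (\<forall>(A :: ('a, 'm sigma_obj) module) (B :: ('a, 'm sigma_obj) module) f g.
       in_sigma R M A \<longrightarrow> in_sigma R M B \<longrightarrow>
       f \<in> Hom R A B \<longrightarrow> inj_on f (carrier A) \<longrightarrow> g \<in> Hom R A E \<longrightarrow>
         (\<exists>h\<in>Hom R B E. compose (carrier A) h f = g))"

definition progenerator_in_sigma :: "('a, 'r) ring_scheme \<Rightarrow> ('a, 'm) module \<Rightarrow> bool" where
  "progenerator_in_sigma R M \<longleftrightarrow>
    finitely_generated_module R M \<and> projective_in_sigma R M \<and> generator_in_sigma R M"

definition essential_submodule ::
  "('a, 'r) ring_scheme \<Rightarrow> ('a, 'm) module \<Rightarrow> 'm set \<Rightarrow> bool" where
  "essential_submodule R M K \<longleftrightarrow> submodule K R M \<and>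
    (\<forall>L. submodule L R M \<longrightarrow> K \<inter> L = {\<zero>\<^bsub>M\<^esub>} \<longrightarrow> L = {\<zero>\<^bsub>M\<^esub>})"

text \<open>\<open>E\<close> together with the embedding \<open>j\<close> is an injective hull of \<open>K\<close> in \<open>\<sigma>[X]\<close>.\<close>

definition injective_hull_in_sigma ::
  "('a, 'r) ring_scheme \<Rightarrow> ('a, 'x) module \<Rightarrow> ('a, 'k) module \<Rightarrow> ('a, 'e) module \<Rightarrow> ('k \<Rightarrow> 'e) \<Rightarrow> bool"
  where
  "injective_hull_in_sigma R X K E j \<longleftrightarrow>
    in_sigma R X K \<and> injective_in_sigma R X E \<and>
    j \<in> Hom R K E \<and> inj_on j (carrier K) \<and> essential_submodule R E (j ` carrier K)"


section \<open>Prime and semiprime, Goldie modules\<close>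

definition fully_invariant :: "('a, 'r) ring_scheme \<Rightarrow> ('a, 'm) module \<Rightarrow> 'm set \<Rightarrow> bool" where
  "fully_invariant R M N \<longleftrightarrow> submodule N R M \<and> (\<forall>f\<in>Hom R M M. f ` N \<subseteq> N)"

text \<open>The product \<open>N\<^sub>MK\<close>.\<close>

definition submodule_prod ::
  "('a, 'r) ring_scheme \<Rightarrow> ('a, 'm) module \<Rightarrow> 'm set \<Rightarrow> 'm set \<Rightarrow> 'm set" where
  "submodule_prod R M N K =
    submodule_generated R M (\<Union>f\<in>Hom R M (submodule_as_module M K). f ` N)"

definition prime_in :: "('a, 'r) ring_scheme \<Rightarrow> ('a, 'm) module \<Rightarrow> 'm set \<Rightarrow> bool" where
  "prime_in R M P \<longleftrightarrow> fully_invariant R M P \<and> P \<noteq> carrier M \<and>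
    (\<forall>N K. fully_invariant R M N \<longrightarrow> fully_invariant R M K \<longrightarrow>
       submodule_prod R M N K \<subseteq> P \<longrightarrow> N \<subseteq> P \<or> K \<subseteq> P)"

definition minimal_primes_in :: "('a, 'r) ring_scheme \<Rightarrow> ('a, 'm) module \<Rightarrow> 'm set set" where
  "minimal_primes_in R M =
    {P. prime_in R M P \<and> (\<forall>Q. prime_in R M Q \<longrightarrow> Q \<subseteq> P \<longrightarrow> Q = P)}"

definition semiprime_module :: "('a, 'r) ring_scheme \<Rightarrow> ('a, 'm) module \<Rightarrow> bool" where
  "semiprime_module R M \<longleftrightarrow>
    (\<forall>K. fully_invariant R M K \<longrightarrow> submodule_prod R M K K = {\<zero>\<^bsub>M\<^esub>} \<longrightarrow> K = {\<zero>\<^bsub>M\<^esub>})"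

text \<open>The intersection with \<^term>\<open>carrier M\<close> only matters for \<open>X = {}\<close>, whose annihilator is \<open>M\<close>.\<close>

definition left_annihilator_in :: "('a, 'r) ring_scheme \<Rightarrow> ('a, 'm) module \<Rightarrow> 'm set \<Rightarrow> bool" where
  "left_annihilator_in R M L \<longleftrightarrow>
    (\<exists>X\<subseteq>Hom R M M. L = carrier M \<inter> (\<Inter>f\<in>X. a_kernel M M f))"

definition acc_left_annihilators :: "('a, 'r) ring_scheme \<Rightarrow> ('a, 'm) module \<Rightarrow> bool" where
  "acc_left_annihilators R M \<longleftrightarrow>
    (\<forall>L :: nat \<Rightarrow> 'm set.
       (\<forall>k. left_annihilator_in R M (L k) \<and> L k \<subseteq> L (Suc k)) \<longrightarrow> (\<exists>k. \<forall>l\<ge>k. L l = L k))"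

definition uniform_submodule ::
  "('a, 'r) ring_scheme \<Rightarrow> ('a, 'm) module \<Rightarrow> 'm set \<Rightarrow> bool" where
  "uniform_submodule R M U \<longleftrightarrow> submodule U R M \<and> U \<noteq> {\<zero>\<^bsub>M\<^esub>} \<and>
    (\<forall>A B. submodule A R M \<longrightarrow> submodule B R M \<longrightarrow> A \<subseteq> U \<longrightarrow> B \<subseteq> U \<longrightarrow>
       A \<noteq> {\<zero>\<^bsub>M\<^esub>} \<longrightarrow> B \<noteq> {\<zero>\<^bsub>M\<^esub>} \<longrightarrow> A \<inter> B \<noteq> {\<zero>\<^bsub>M\<^esub>})"

definition independent_submodules ::
  "('a, 'r) ring_scheme \<Rightarrow> ('a, 'm) module \<Rightarrow> 'i set \<Rightarrow> ('i \<Rightarrow> 'm set) \<Rightarrow> bool" where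
  "independent_submodules R M I U \<longleftrightarrow> (\<forall>i\<in>I. submodule (U i) R M) \<and>
    (\<forall>i\<in>I. U i \<inter> submodule_generated R M (\<Union>j\<in>I - {i}. U j) = {\<zero>\<^bsub>M\<^esub>})"

text \<open>\<open>M\<close> has uniform dimension \<open>d\<close> iff it has an essential submodule that is a direct sum of \<open>d\<close>
  uniform submodules.\<close>

definition has_uniform_dimension :: "('a, 'r) ring_scheme \<Rightarrow> ('a, 'm) module \<Rightarrow> nat \<Rightarrow> bool" where
  "has_uniform_dimension R M d \<longleftrightarrow>
    (\<exists>U :: nat \<Rightarrow> 'm set. (\<forall>i<d. uniform_submodule R M (U i)) \<and>
       independent_submodules R M {..<d} U \<and>
       essential_submodule R M (submodule_generated R M (\<Union>i<d. U i)))"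

definition Goldie_module :: "('a, 'r) ring_scheme \<Rightarrow> ('a, 'm) module \<Rightarrow> bool" where
  "Goldie_module R M \<longleftrightarrow> acc_left_annihilators R M \<and> (\<exists>d. has_uniform_dimension R M d)"


section \<open>Rings\<close>

definition right_ideal :: "'a set \<Rightarrow> ('a, 'r) ring_scheme \<Rightarrow> bool" where
  "right_ideal I Q \<longleftrightarrow> additive_subgroup I Q \<and> (\<forall>a\<in>I. \<forall>x\<in>carrier Q. a \<otimes>\<^bsub>Q\<^esub> x \<in> I)"

definition right_artinian :: "('a, 'r) ring_scheme \<Rightarrow> bool" where
  "right_artinian Q \<longleftrightarrow> ring Q \<and>
    (\<forall>I :: nat \<Rightarrow> 'a set.
       (\<forall>k. right_ideal (I k) Q \<and> I (Suc k) \<subseteq> I k) \<longrightarrow> (\<exists>k. \<forall>l\<ge>k. I l = I k))"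

definition simple_ring :: "('a, 'r) ring_scheme \<Rightarrow> bool" where
  "simple_ring Q \<longleftrightarrow> ring Q \<and> \<one>\<^bsub>Q\<^esub> \<noteq> \<zero>\<^bsub>Q\<^esub> \<and>
    (\<forall>I. ideal I Q \<longrightarrow> I = {\<zero>\<^bsub>Q\<^esub>} \<or> I = carrier Q)"

definition regular_elements :: "('a, 'r) ring_scheme \<Rightarrow> 'a set" where
  "regular_elements S = {s \<in> carrier S. \<forall>x\<in>carrier S.
     (s \<otimes>\<^bsub>S\<^esub> x = \<zero>\<^bsub>S\<^esub> \<longrightarrow> x = \<zero>\<^bsub>S\<^esub>) \<and> (x \<otimes>\<^bsub>S\<^esub> s = \<zero>\<^bsub>S\<^esub> \<longrightarrow> x = \<zero>\<^bsub>S\<^esub>)}"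

text \<open>\<open>Q\<close> is a classical right ring of quotients of \<open>S\<close>, where \<open>S\<close> is regarded as a subring of \<open>Q\<close>
  along some embedding \<open>\<phi>\<close>: regular elements of \<open>S\<close> become units and every element of \<open>Q\<close> is a
  fraction \<open>as\<^sup>-\<^sup>1\<close>.\<close>

definition classical_right_quotient_ring ::
  "('q, 'u) ring_scheme \<Rightarrow> ('s, 'v) ring_scheme \<Rightarrow> bool" where
  "classical_right_quotient_ring Q S \<longleftrightarrow> ring Q \<and> ring S \<and>
    (\<exists>\<phi>\<in>ring_hom S Q. inj_on \<phi> (carrier S) \<and>
       (\<forall>s\<in>regular_elements S. \<phi> s \<in> Units Q) \<and>
       (\<forall>q\<in>carrier Q. \<exists>a\<in>carrier S. \<exists>s\<in>regular_elements S. q = \<phi> a \<otimes>\<^bsub>Q\<^esub> inv\<^bsub>Q\<^esub> (\<phi> s)))"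

end

theory Submission
  imports Defs
begin

text \<open>Write \<open>K\<^sup>\<bottom>\<close> for the common kernel of all endomorphisms of \<open>M\<close> with image in \<open>K\<close>.  As \<open>M\<close> generates its
  submodules and is semiprime and nonsingular, \<open>K \<inter> K\<^sup>\<bottom> = 0\<close>, and \<open>K\<^sup>\<bottom>\<close> contains every submodule that meets the fully
  invariant submodule \<open>K\<close> trivially.  If \<open>U\<^sub>1 \<oplus> \<dots> \<oplus> U\<^sub>d\<close> is an essential sum of uniform submodules, the
  minimal primes are exactly the \<open>U\<^sub>i\<^sup>\<bottom>\<close>.  For a minimal prime \<open>P\<close> the submodule \<open>N = P\<^sup>\<bottom>\<close> embeds
  essentially into \<open>M/P\<close>, and the \<open>U\<^sub>i\<close> inside \<open>N\<close> have essential sum there.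

  Maps into the hull \<open>E\<close> of \<open>M/P\<close> are determined on essential submodules, so the partial projections
  onto those \<open>U\<^sub>i\<close> extend uniquely to a complete orthogonal system of primitive, mutually linked idempotents of
  \<open>End(E)\<close>; hence \<open>End(E)\<close> is simple and right artinian.  Since it is artinian, Goldie's argument puts an
  injective image of \<open>M/P\<close> into every essential submodule of \<open>N\<close>, which yields fractions.
  There are no nonzero maps between the hulls for different \<open>P\<close>, and the sum of the submodules \<open>P\<^sup>\<bottom>\<close> is essential in \<open>M\<close>;
  this splits the endomorphism ring of the hull of \<open>M\<close>.\<close>

section \<open>Linear maps on submodules\<close>

text \<open>The hypotheses on generators, projectivity and injectivity speak of modules of one
  carrier type, while the hulls have types of their own. They are therefore always applied to
  submodules of the countable direct sum of copies of M: every cyclic module in sigma[M] is a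
  quotient of a cyclic submodule of that sum, and such a submodule can be copied into the prescribed
  type.

  Semiprimeness enters only in one form: if f is a nonzero endomorphism of M, then f g f is nonzero
  for some endomorphism g. Passing from fully invariant submodules to single maps is where finite
  generation and projectivity are spent. Afterwards the statements on \<open>perp\<close>, on primes
  and on maps between hulls are short computations with such composites.

  The chain condition on left annihilators enters only through nonsingularity: an endomorphism with
  essential kernel is zero, since otherwise the maps f, f g f, ... would have strictly growing
  kernels.\<close>

context left_module
begin

lemma smult_l_null: "x \<in> carrier M \<Longrightarrow> \<zero>\<^bsub>R\<^esub> \<odot>\<^bsub>M\<^esub> x = \<zero>\<^bsub>M\<^esub>"
  by (metis M.add.l_cancel_one M.add.m_closed R.add.one_closed R.add.r_one smult_closed smult_l_distr)

lemma smult_r_null: "a \<in> carrier R \<Longrightarrow> a \<odot>\<^bsub>M\<^esub> \<zero>\<^bsub>M\<^esub> = \<zero>\<^bsub>M\<^esub>"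
  by (metis M.add.l_cancel_one M.add.r_one M.zero_closed smult_closed smult_r_distr)

lemma smult_minus_one: "x \<in> carrier M \<Longrightarrow> (\<ominus>\<^bsub>R\<^esub> \<one>\<^bsub>R\<^esub>) \<odot>\<^bsub>M\<^esub> x = \<ominus>\<^bsub>M\<^esub> x"
  by (metis M.minus_equality R.add.inv_closed R.l_neg R.one_closed smult_closed smult_l_distr smult_l_null smult_one)

lemma smult_r_neg:
  assumes "a \<in> carrier R" "x \<in> carrier M" shows "a \<odot>\<^bsub>M\<^esub> (\<ominus>\<^bsub>M\<^esub> x) = \<ominus>\<^bsub>M\<^esub> (a \<odot>\<^bsub>M\<^esub> x)"
proof -
  have "a \<odot>\<^bsub>M\<^esub> (\<ominus>\<^bsub>M\<^esub> x) \<oplus>\<^bsub>M\<^esub> a \<odot>\<^bsub>M\<^esub> x = \<zero>\<^bsub>M\<^esub>"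
    using assms smult_r_distr[of a "\<ominus>\<^bsub>M\<^esub> x" x] by (simp add: M.l_neg smult_r_null)
  then show ?thesis using assms by (simp add: M.minus_equality)
qed

lemma smult_l_neg:
  assumes "a \<in> carrier R" "x \<in> carrier M" shows "(\<ominus>\<^bsub>R\<^esub> a) \<odot>\<^bsub>M\<^esub> x = \<ominus>\<^bsub>M\<^esub> (a \<odot>\<^bsub>M\<^esub> x)"
proof -
  have "(\<ominus>\<^bsub>R\<^esub> a) \<odot>\<^bsub>M\<^esub> x \<oplus>\<^bsub>M\<^esub> a \<odot>\<^bsub>M\<^esub> x = \<zero>\<^bsub>M\<^esub>"
    using assms smult_l_distr[of "\<ominus>\<^bsub>R\<^esub> a" a x] by (simp add: R.l_neg smult_l_null)
  then show ?thesis using assms by (simp add: M.minus_equality)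
qed

text \<open>Closure under negation follows from closure under scalars, since negation is
  multiplication by minus one.\<close>

lemma submodule_iff:
  "submodule L R M \<longleftrightarrow> L \<subseteq> carrier M \<and> \<zero>\<^bsub>M\<^esub> \<in> L \<and> (\<forall>x\<in>L. \<forall>y\<in>L. x \<oplus>\<^bsub>M\<^esub> y \<in> L) \<and>
     (\<forall>r\<in>carrier R. \<forall>x\<in>L. r \<odot>\<^bsub>M\<^esub> x \<in> L)" (is "_ \<longleftrightarrow> ?r")
proof
  assume "submodule L R M"
  then interpret submodule L R M .
  show ?r using subset one_closed m_closed smult_closed by auto
next
  assume r: ?r
  have neg: "\<ominus>\<^bsub>M\<^esub> x \<in> L" if "x \<in> L" for x
    using r that smult_minus_one by (metis R.add.inv_closed R.one_closed subsetD)
  show "submodule L R M"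
    by (intro submodule.intro subgroup.intro)
       (use r neg in \<open>auto simp: submodule_axioms_def a_inv_def\<close>)
qed

lemma submoduleI:
  assumes "L \<subseteq> carrier M" "\<zero>\<^bsub>M\<^esub> \<in> L" "\<And>x y. x \<in> L \<Longrightarrow> y \<in> L \<Longrightarrow> x \<oplus>\<^bsub>M\<^esub> y \<in> L"
    "\<And>r x. r \<in> carrier R \<Longrightarrow> x \<in> L \<Longrightarrow> r \<odot>\<^bsub>M\<^esub> x \<in> L"
  shows "submodule L R M"
  using assms by (auto simp: submodule_iff)

lemma submodule_subset: "submodule L R M \<Longrightarrow> L \<subseteq> carrier M"
  and submodule_mem: "submodule L R M \<Longrightarrow> x \<in> L \<Longrightarrow> x \<in> carrier M"
  and submodule_zero: "submodule L R M \<Longrightarrow> \<zero>\<^bsub>M\<^esub> \<in> L"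
  and submodule_add: "submodule L R M \<Longrightarrow> x \<in> L \<Longrightarrow> y \<in> L \<Longrightarrow> x \<oplus>\<^bsub>M\<^esub> y \<in> L"
  and submodule_smult: "submodule L R M \<Longrightarrow> r \<in> carrier R \<Longrightarrow> x \<in> L \<Longrightarrow> r \<odot>\<^bsub>M\<^esub> x \<in> L"
  by (auto simp: submodule_iff)

lemma submodule_neg: "submodule L R M \<Longrightarrow> x \<in> L \<Longrightarrow> \<ominus>\<^bsub>M\<^esub> x \<in> L"
  using smult_minus_one submodule_smult submodule_mem
  by (metis R.add.inv_closed R.one_closed)

lemma submodule_minus: "submodule L R M \<Longrightarrow> x \<in> L \<Longrightarrow> y \<in> L \<Longrightarrow> x \<ominus>\<^bsub>M\<^esub> y \<in> L"
  by (simp add: a_minus_def submodule_add submodule_neg)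

lemma submodule_carrier: "submodule (carrier M) R M"
  by (rule submoduleI) auto

lemma submodule_zero_set: "submodule {\<zero>\<^bsub>M\<^esub>} R M"
  by (rule submoduleI) (auto simp: smult_r_null)

lemma submodule_Int: "submodule K R M \<Longrightarrow> submodule L R M \<Longrightarrow> submodule (K \<inter> L) R M"
  by (auto simp: submodule_iff)

lemma nonzero_submodule: "submodule L R M \<Longrightarrow> L \<noteq> {\<zero>\<^bsub>M\<^esub>} \<Longrightarrow> \<exists>x\<in>L. x \<noteq> \<zero>\<^bsub>M\<^esub>"
  using submodule_zero by blast

lemma minus_zero_eq: "x \<in> carrier M \<Longrightarrow> y \<in> carrier M \<Longrightarrow> x \<ominus>\<^bsub>M\<^esub> y = \<zero>\<^bsub>M\<^esub> \<longleftrightarrow> x = y"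
  by (metis M.add.inv_closed M.add.inv_inv M.minus_equality M.r_neg a_minus_def)

definition cyclic where "cyclic x = (\<lambda>r. r \<odot>\<^bsub>M\<^esub> x) ` carrier R"

lemma submodule_cyclic: "x \<in> carrier M \<Longrightarrow> submodule (cyclic x) R M"
proof (rule submoduleI)
  assume x: "x \<in> carrier M"
  show "\<zero>\<^bsub>M\<^esub> \<in> cyclic x" using x unfolding cyclic_def
    by (metis R.zero_closed imageI smult_l_null)
  fix u v assume "u \<in> cyclic x" "v \<in> cyclic x"
  then obtain r s where "r \<in> carrier R" "s \<in> carrier R" "u = r \<odot>\<^bsub>M\<^esub> x" "v = s \<odot>\<^bsub>M\<^esub> x"
    by (auto simp: cyclic_def)
  then show "u \<oplus>\<^bsub>M\<^esub> v \<in> cyclic x"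
    using x by (auto simp: cyclic_def smult_l_distr intro!: image_eqI[where x="r \<oplus>\<^bsub>R\<^esub> s"])
next
  fix r u assume x: "x \<in> carrier M" and "r \<in> carrier R" "u \<in> cyclic x"
  then obtain s where "r \<in> carrier R" "s \<in> carrier R" "u = s \<odot>\<^bsub>M\<^esub> x"
    by (auto simp: cyclic_def)
  then show "r \<odot>\<^bsub>M\<^esub> u \<in> cyclic x"
    using x by (auto simp: cyclic_def smult_assoc1 intro!: image_eqI[where x="r \<otimes>\<^bsub>R\<^esub> s"])
qed (auto simp: cyclic_def)

lemma cyclic_self: "x \<in> carrier M \<Longrightarrow> x \<in> cyclic x"
  unfolding cyclic_def by (metis R.one_closed imageI smult_one)

definition sum_set where "sum_set A B = {u \<oplus>\<^bsub>M\<^esub> v |u v. u \<in> A \<and> v \<in> B}"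

lemma sum_setI: "u \<in> A \<Longrightarrow> v \<in> B \<Longrightarrow> u \<oplus>\<^bsub>M\<^esub> v \<in> sum_set A B"
  by (auto simp: sum_set_def)

lemma sum_setE: assumes "x \<in> sum_set A B" obtains u v where "u \<in> A" "v \<in> B" "x = u \<oplus>\<^bsub>M\<^esub> v"
  using assms by (auto simp: sum_set_def)

lemma submodule_sum_set:
  assumes A: "submodule A R M" and B: "submodule B R M"
  shows "submodule (sum_set A B) R M"
proof (rule submoduleI)
  note m = submodule_mem[OF A] submodule_mem[OF B]
  show "sum_set A B \<subseteq> carrier M" by (auto simp: sum_set_def m)
  show "\<zero>\<^bsub>M\<^esub> \<in> sum_set A B" using sum_setI[OF submodule_zero[OF A] submodule_zero[OF B]] by simp
  fix x y assume "x \<in> sum_set A B" "y \<in> sum_set A B"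
  then obtain u v u' v' where "u \<in> A" "v \<in> B" "x = u \<oplus>\<^bsub>M\<^esub> v" "u' \<in> A" "v' \<in> B" "y = u' \<oplus>\<^bsub>M\<^esub> v'"
    by (auto simp: sum_set_def)
  moreover from this have "x \<oplus>\<^bsub>M\<^esub> y = (u \<oplus>\<^bsub>M\<^esub> u') \<oplus>\<^bsub>M\<^esub> (v \<oplus>\<^bsub>M\<^esub> v')"
    by (simp add: m M.add.m_ac)
  ultimately show "x \<oplus>\<^bsub>M\<^esub> y \<in> sum_set A B"
    using sum_setI submodule_add A B by metis
next
  fix r x assume r: "r \<in> carrier R" and "x \<in> sum_set A B"
  then obtain u v where "u \<in> A" "v \<in> B" "x = u \<oplus>\<^bsub>M\<^esub> v"
    by (auto simp: sum_set_def)
  moreover from this have "r \<odot>\<^bsub>M\<^esub> x = r \<odot>\<^bsub>M\<^esub> u \<oplus>\<^bsub>M\<^esub> r \<odot>\<^bsub>M\<^esub> v"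
    using r submodule_mem A B smult_r_distr by metis
  ultimately show "r \<odot>\<^bsub>M\<^esub> x \<in> sum_set A B"
    using sum_setI submodule_smult A B r by metis
qed

lemma sum_set_left: "submodule A R M \<Longrightarrow> submodule B R M \<Longrightarrow> A \<subseteq> sum_set A B"
  using sum_setI[of _ A "\<zero>\<^bsub>M\<^esub>" B] submodule_zero submodule_mem by fastforce

lemma sum_set_right: "submodule A R M \<Longrightarrow> submodule B R M \<Longrightarrow> B \<subseteq> sum_set A B"
  using sum_setI[of "\<zero>\<^bsub>M\<^esub>" A _ B] submodule_zero submodule_mem by fastforce

lemma sum_set_least: "submodule L R M \<Longrightarrow> A \<subseteq> L \<Longrightarrow> B \<subseteq> L \<Longrightarrow> sum_set A B \<subseteq> L"
  by (auto simp: sum_set_def intro!: submodule_add)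

lemma add_eq_imp_minus_eq:
  assumes c: "u \<in> carrier M" "u' \<in> carrier M" "v \<in> carrier M" "v' \<in> carrier M"
    and "u \<oplus>\<^bsub>M\<^esub> v = u' \<oplus>\<^bsub>M\<^esub> v'"
  shows "u \<ominus>\<^bsub>M\<^esub> u' = v' \<ominus>\<^bsub>M\<^esub> v"
proof -
  have "u = (u \<oplus>\<^bsub>M\<^esub> v) \<ominus>\<^bsub>M\<^esub> v" using c by (simp add: a_minus_def M.add.m_assoc M.r_neg)
  then have "u = u' \<oplus>\<^bsub>M\<^esub> v' \<ominus>\<^bsub>M\<^esub> v" using assms by simp
  then have "u \<ominus>\<^bsub>M\<^esub> u' = (v' \<ominus>\<^bsub>M\<^esub> v) \<oplus>\<^bsub>M\<^esub> (u' \<ominus>\<^bsub>M\<^esub> u')"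
    using c by (simp add: a_minus_def M.add.m_ac)
  then show ?thesis using c by (simp add: a_minus_def M.r_neg)
qed

lemma submodule_submodule_generated:
  assumes "S \<subseteq> carrier M" shows "submodule (submodule_generated R M S) R M"
  unfolding submodule_generated_def
  by (rule submoduleI) (use assms submodule_carrier in \<open>auto simp: submodule_zero submodule_add submodule_smult\<close>)

lemma submodule_generated_incl: "S \<subseteq> submodule_generated R M S"
  unfolding submodule_generated_def by auto

lemma submodule_generated_least: "submodule L R M \<Longrightarrow> S \<subseteq> L \<Longrightarrow> submodule_generated R M S \<subseteq> L"
  unfolding submodule_generated_def by auto

lemma submodule_generated_mono:
  "S \<subseteq> T \<Longrightarrow> submodule_generated R M S \<subseteq> submodule_generated R M T"
  unfolding submodule_generated_def by auto

lemma submodule_generated_empty: "submodule_generated R M {} = {\<zero>\<^bsub>M\<^esub>}"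
  using submodule_generated_least[OF submodule_zero_set, of "{}"]
    submodule_zero[OF submodule_submodule_generated, of "{}"] by auto

lemma submodule_generated_Un:
  assumes "submodule A R M" "S \<subseteq> carrier M"
  shows "submodule_generated R M (A \<union> S) = sum_set A (submodule_generated R M S)"
proof
  note s = submodule_submodule_generated[OF assms(2)]
  show "submodule_generated R M (A \<union> S) \<subseteq> sum_set A (submodule_generated R M S)"
    using sum_set_left[OF assms(1) s] sum_set_right[OF assms(1) s] submodule_generated_incl
    by (intro submodule_generated_least submodule_sum_set assms(1) s) blast
  show "sum_set A (submodule_generated R M S) \<subseteq> submodule_generated R M (A \<union> S)"
    using submodule_generated_incl assms submodule_subset
    by (intro sum_set_least submodule_submodule_generated submodule_generated_mono) blast+
qed

end

text \<open>Partial homomorphisms: values outside \<open>L\<close> are unconstrained, so a map can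
  be restricted, composed and glued without passing to the extensional functions of
  \<open>Hom\<close> or to a new module record for its domain.\<close>

definition linear_on ::
  "('a, 'r) ring_scheme \<Rightarrow> ('a, 'x) module \<Rightarrow> 'x set \<Rightarrow> ('a, 'y) module \<Rightarrow> ('x \<Rightarrow> 'y) \<Rightarrow> bool" where
  "linear_on R X L Y f \<longleftrightarrow> f \<in> L \<rightarrow> carrier Y \<and>
     (\<forall>x\<in>L. \<forall>y\<in>L. f (x \<oplus>\<^bsub>X\<^esub> y) = f x \<oplus>\<^bsub>Y\<^esub> f y) \<and>
     (\<forall>r\<in>carrier R. \<forall>x\<in>L. f (r \<odot>\<^bsub>X\<^esub> x) = r \<odot>\<^bsub>Y\<^esub> f x)"

abbreviation linear where "linear R X Y \<equiv> linear_on R X (carrier X) Y"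

lemma Hom_iff: "f \<in> Hom R X Y \<longleftrightarrow> f \<in> extensional (carrier X) \<and> linear R X Y f"
  by (auto simp: Hom_def linear_on_def PiE_def)

lemma linear_Hom: "f \<in> Hom R X Y \<Longrightarrow> linear R X Y f"
  by (simp add: Hom_iff)

lemma linear_onI:
  assumes "\<And>x. x \<in> L \<Longrightarrow> f x \<in> carrier Y"
    "\<And>x y. x \<in> L \<Longrightarrow> y \<in> L \<Longrightarrow> f (x \<oplus>\<^bsub>X\<^esub> y) = f x \<oplus>\<^bsub>Y\<^esub> f y"
    "\<And>r x. r \<in> carrier R \<Longrightarrow> x \<in> L \<Longrightarrow> f (r \<odot>\<^bsub>X\<^esub> x) = r \<odot>\<^bsub>Y\<^esub> f x"
  shows "linear_on R X L Y f"
  using assms by (auto simp: linear_on_def)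

lemma linear_on_closed: "linear_on R X L Y f \<Longrightarrow> x \<in> L \<Longrightarrow> f x \<in> carrier Y"
  and linear_on_add: "linear_on R X L Y f \<Longrightarrow> x \<in> L \<Longrightarrow> y \<in> L \<Longrightarrow> f (x \<oplus>\<^bsub>X\<^esub> y) = f x \<oplus>\<^bsub>Y\<^esub> f y"
  and linear_on_smult: "linear_on R X L Y f \<Longrightarrow> r \<in> carrier R \<Longrightarrow> x \<in> L \<Longrightarrow> f (r \<odot>\<^bsub>X\<^esub> x) = r \<odot>\<^bsub>Y\<^esub> f x"
  by (auto simp: linear_on_def)

lemma linear_on_subset: "linear_on R X L Y f \<Longrightarrow> K \<subseteq> L \<Longrightarrow> linear_on R X K Y f"
  unfolding linear_on_def by blast

lemma linear_on_comp:
  assumes "linear_on R X L Y f" "linear_on R Y K Z g" "f ` L \<subseteq> K"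
  shows "linear_on R X L Z (\<lambda>x. g (f x))"
  using assms by (auto simp: linear_on_def image_subset_iff)

lemma linear_comp:
  assumes "linear_on R X L Y f" "linear R Y Z g"
  shows "linear_on R X L Z (\<lambda>x. g (f x))"
  using assms by (auto intro: linear_on_comp dest: linear_on_closed)

locale two_modules = X: left_module R X + Y: left_module R Y
  for R :: "('a, 'r) ring_scheme" and X :: "('a, 'x) module" and Y :: "('a, 'y) module"
begin

lemma linear_on_cong:
  assumes "linear_on R X L Y f" "submodule L R X" "\<And>x. x \<in> L \<Longrightarrow> f x = g x"
  shows "linear_on R X L Y g"
  using assms(1) assms(3)[symmetric] X.submodule_add[OF assms(2)] X.submodule_smult[OF assms(2)]
  by (intro linear_onI) (auto simp: linear_on_closed linear_on_add linear_on_smult)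

lemma Hom_restrict:
  assumes "linear R X Y f" shows "restrict f (carrier X) \<in> Hom R X Y"
  using linear_on_cong[OF assms X.submodule_carrier, of "restrict f (carrier X)"]
  by (simp add: Hom_iff)

lemma linear_on_zero:
  assumes "linear_on R X L Y f" "submodule L R X" shows "f \<zero>\<^bsub>X\<^esub> = \<zero>\<^bsub>Y\<^esub>"
proof -
  have z: "\<zero>\<^bsub>X\<^esub> \<in> L" using X.submodule_zero[OF assms(2)] .
  have "f (\<zero>\<^bsub>R\<^esub> \<odot>\<^bsub>X\<^esub> \<zero>\<^bsub>X\<^esub>) = \<zero>\<^bsub>R\<^esub> \<odot>\<^bsub>Y\<^esub> f \<zero>\<^bsub>X\<^esub>"
    by (rule linear_on_smult[OF assms(1) X.R.zero_closed z])
  then show ?thesis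
    using linear_on_closed[OF assms(1) z] by (simp add: X.smult_l_null Y.smult_l_null)
qed

lemma linear_on_neg:
  assumes "linear_on R X L Y f" "submodule L R X" "x \<in> L" shows "f (\<ominus>\<^bsub>X\<^esub> x) = \<ominus>\<^bsub>Y\<^esub> f x"
proof -
  have "f ((\<ominus>\<^bsub>R\<^esub> \<one>\<^bsub>R\<^esub>) \<odot>\<^bsub>X\<^esub> x) = (\<ominus>\<^bsub>R\<^esub> \<one>\<^bsub>R\<^esub>) \<odot>\<^bsub>Y\<^esub> f x"
    by (rule linear_on_smult[OF assms(1) _ assms(3)]) simp
  then show ?thesis
    using linear_on_closed[OF assms(1,3)] X.submodule_mem[OF assms(2,3)]
    by (simp add: X.smult_minus_one Y.smult_minus_one)
qed

lemma linear_on_minus: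
  assumes "linear_on R X L Y f" "submodule L R X" "x \<in> L" "y \<in> L"
  shows "f (x \<ominus>\<^bsub>X\<^esub> y) = f x \<ominus>\<^bsub>Y\<^esub> f y"
  using assms by (simp add: a_minus_def linear_on_add X.submodule_neg linear_on_neg)

lemma linear_on_sum:
  assumes "linear_on R X L Y f" "linear_on R X L Y g"
  shows "linear_on R X L Y (\<lambda>x. f x \<oplus>\<^bsub>Y\<^esub> g x)"
  using assms
  by (intro linear_onI) (simp_all add: linear_on_closed linear_on_add linear_on_smult Y.M.add.m_ac Y.smult_r_distr)

lemma linear_on_uminus:
  assumes "linear_on R X L Y f"
  shows "linear_on R X L Y (\<lambda>x. \<ominus>\<^bsub>Y\<^esub> f x)"
proof (rule linear_onI)
qed (use assms in \<open>auto simp: linear_on_closed linear_on_add linear_on_smult Y.M.minus_add Y.smult_r_neg\<close>)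

lemma linear_on_diff:
  assumes "linear_on R X L Y f" "linear_on R X L Y g"
  shows "linear_on R X L Y (\<lambda>x. f x \<ominus>\<^bsub>Y\<^esub> g x)"
  unfolding a_minus_def by (intro linear_on_sum linear_on_uminus assms)

lemma linear_zero: "linear_on R X L Y (\<lambda>x. \<zero>\<^bsub>Y\<^esub>)"
  by (rule linear_onI) (auto simp: Y.smult_r_null)

lemma submodule_preimage:
  assumes "linear_on R X L Y f" "submodule L R X" "submodule K R Y"
  shows "submodule {x\<in>L. f x \<in> K} R X"
  using assms linear_on_zero[OF assms(1,2)]
  by (intro X.submoduleI) (auto simp: X.submodule_zero X.submodule_add X.submodule_smult X.submodule_mem
      linear_on_add linear_on_smult Y.submodule_zero Y.submodule_add Y.submodule_smult)

lemma submodule_kernel: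
  assumes "linear_on R X L Y f" "submodule L R X"
  shows "submodule {x\<in>L. f x = \<zero>\<^bsub>Y\<^esub>} R X"
  using submodule_preimage[OF assms Y.submodule_zero_set] by simp

lemma submodule_image:
  assumes "linear_on R X L Y f" "submodule L R X"
  shows "submodule (f ` L) R Y"
proof (rule Y.submoduleI)
  show "\<zero>\<^bsub>Y\<^esub> \<in> f ` L" using linear_on_zero[OF assms] X.submodule_zero[OF assms(2)] by force
  fix x y assume "x \<in> f ` L" "y \<in> f ` L"
  then obtain u v where "u \<in> L" "v \<in> L" "x = f u" "y = f v" by auto
  then show "x \<oplus>\<^bsub>Y\<^esub> y \<in> f ` L"
    using linear_on_add[OF assms(1)] X.submodule_add[OF assms(2)] by (metis imageI)
next
  fix r x assume "r \<in> carrier R" "x \<in> f ` L"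
  then obtain u where "u \<in> L" "x = f u" by auto
  then show "r \<odot>\<^bsub>Y\<^esub> x \<in> f ` L"
    using linear_on_smult[OF assms(1)] X.submodule_smult[OF assms(2)] \<open>r \<in> carrier R\<close> by (metis imageI)
qed (use assms linear_on_closed in fastforce)

lemma inj_on_iff_kernel:
  assumes "linear_on R X L Y f" "submodule L R X"
  shows "inj_on f L \<longleftrightarrow> (\<forall>x\<in>L. f x = \<zero>\<^bsub>Y\<^esub> \<longrightarrow> x = \<zero>\<^bsub>X\<^esub>)"
proof
  assume "inj_on f L"
  then show "\<forall>x\<in>L. f x = \<zero>\<^bsub>Y\<^esub> \<longrightarrow> x = \<zero>\<^bsub>X\<^esub>"
    using linear_on_zero[OF assms] X.submodule_zero[OF assms(2)] by (metis inj_onD)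
next
  assume k: "\<forall>x\<in>L. f x = \<zero>\<^bsub>Y\<^esub> \<longrightarrow> x = \<zero>\<^bsub>X\<^esub>"
  show "inj_on f L"
  proof (rule inj_onI)
    fix x y assume xy: "x \<in> L" "y \<in> L" "f x = f y"
    then have "f (x \<ominus>\<^bsub>X\<^esub> y) = \<zero>\<^bsub>Y\<^esub>"
      using assms linear_on_closed[OF assms(1)] by (simp add: linear_on_minus Y.minus_zero_eq)
    then have "x \<ominus>\<^bsub>X\<^esub> y = \<zero>\<^bsub>X\<^esub>" using k X.submodule_minus assms xy by blast
    then show "x = y" using xy X.submodule_mem[OF assms(2)] by (metis X.minus_zero_eq)
  qed
qed

lemma linear_on_inv_into:
  assumes "linear_on R X L Y f" "submodule L R X" "inj_on f L"
  shows "linear_on R Y (f ` L) X (inv_into L f)"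
proof (rule linear_onI)
  fix x y assume "x \<in> f ` L" "y \<in> f ` L"
  then obtain u v where uv: "u \<in> L" "v \<in> L" "x = f u" "y = f v" by auto
  then have "x \<oplus>\<^bsub>Y\<^esub> y = f (u \<oplus>\<^bsub>X\<^esub> v)" using assms by (simp add: linear_on_add)
  then show "inv_into L f (x \<oplus>\<^bsub>Y\<^esub> y) = inv_into L f x \<oplus>\<^bsub>X\<^esub> inv_into L f y"
    using uv assms by (simp add: inv_into_f_f X.submodule_add)
next
  fix r x assume r: "r \<in> carrier R" and "x \<in> f ` L"
  then obtain u where uv: "u \<in> L" "x = f u" by auto
  then have "r \<odot>\<^bsub>Y\<^esub> x = f (r \<odot>\<^bsub>X\<^esub> u)" using assms r by (simp add: linear_on_smult)
  then show "inv_into L f (r \<odot>\<^bsub>Y\<^esub> x) = r \<odot>\<^bsub>X\<^esub> inv_into L f x"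
    using uv assms r by (simp add: inv_into_f_f X.submodule_smult)
qed (use assms X.submodule_mem in \<open>auto simp: inv_into_f_f\<close>)

text \<open>Two decompositions of one element of A + B satisfy u - u' = v' - v. This difference lies
  in both submodules, where f and g agree, so f u + g v depends on the sum only.\<close>

lemma linear_on_glue:
  assumes A: "submodule A R X" and B: "submodule B R X" and I: "\<And>x. x \<in> A \<Longrightarrow> x \<in> B \<Longrightarrow> f x = g x"
    and f: "linear_on R X A Y f" and g: "linear_on R X B Y g"
  obtains h where "linear_on R X (X.sum_set A B) Y h" "\<And>u v. u \<in> A \<Longrightarrow> v \<in> B \<Longrightarrow> h (u \<oplus>\<^bsub>X\<^esub> v) = f u \<oplus>\<^bsub>Y\<^esub> g v"
proof -
  note mA = X.submodule_mem[OF A] X.submodule_add[OF A] X.submodule_smult[OF A] linear_on_closed[OF f]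
  note mB = X.submodule_mem[OF B] X.submodule_add[OF B] X.submodule_smult[OF B] linear_on_closed[OF g]
  have wd: "f u \<oplus>\<^bsub>Y\<^esub> g v = f u' \<oplus>\<^bsub>Y\<^esub> g v'"
    if "u \<in> A" "u' \<in> A" "v \<in> B" "v' \<in> B" and e: "u \<oplus>\<^bsub>X\<^esub> v = u' \<oplus>\<^bsub>X\<^esub> v'" for u u' v v'
  proof -
    have d: "u \<ominus>\<^bsub>X\<^esub> u' = v' \<ominus>\<^bsub>X\<^esub> v"
      by (rule X.add_eq_imp_minus_eq) (use that mA mB in auto)
    then have "f (u \<ominus>\<^bsub>X\<^esub> u') = g (v' \<ominus>\<^bsub>X\<^esub> v)"
      using I[of "u \<ominus>\<^bsub>X\<^esub> u'"] X.submodule_minus[OF A that(1,2)] X.submodule_minus[OF B that(4,3)] by simp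
    then have "f u \<ominus>\<^bsub>Y\<^esub> f u' = g v' \<ominus>\<^bsub>Y\<^esub> g v"
      using linear_on_minus[OF f A that(1,2)] linear_on_minus[OF g B that(4,3)] by simp
    moreover have "f u = (f u \<ominus>\<^bsub>Y\<^esub> f u') \<oplus>\<^bsub>Y\<^esub> f u'"
      using mA(4)[OF that(1)] mA(4)[OF that(2)] by (simp add: a_minus_def Y.M.add.m_assoc Y.M.l_neg)
    ultimately have "f u = (g v' \<ominus>\<^bsub>Y\<^esub> g v) \<oplus>\<^bsub>Y\<^esub> f u'" by simp
    then show ?thesis
      using mA(4)[OF that(2)] mB(4)[OF that(3)] mB(4)[OF that(4)] by (simp add: a_minus_def Y.M.add.m_ac Y.M.r_neg)
  qed
  define h where "h = (\<lambda>x. let p = SOME p. fst p \<in> A \<and> snd p \<in> B \<and> x = fst p \<oplus>\<^bsub>X\<^esub> snd p in f (fst p) \<oplus>\<^bsub>Y\<^esub> g (snd p))"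
  have h: "h (u \<oplus>\<^bsub>X\<^esub> v) = f u \<oplus>\<^bsub>Y\<^esub> g v" if "u \<in> A" "v \<in> B" for u v
  proof -
    have e: "\<exists>p. fst p \<in> A \<and> snd p \<in> B \<and> u \<oplus>\<^bsub>X\<^esub> v = fst p \<oplus>\<^bsub>X\<^esub> snd p" using that by force
    define p where "p = (SOME p. fst p \<in> A \<and> snd p \<in> B \<and> u \<oplus>\<^bsub>X\<^esub> v = fst p \<oplus>\<^bsub>X\<^esub> snd p)"
    have "fst p \<in> A \<and> snd p \<in> B \<and> u \<oplus>\<^bsub>X\<^esub> v = fst p \<oplus>\<^bsub>X\<^esub> snd p"
      unfolding p_def by (rule someI_ex[OF e])
    then have "f u \<oplus>\<^bsub>Y\<^esub> g v = f (fst p) \<oplus>\<^bsub>Y\<^esub> g (snd p)" using wd that by blast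
    then show ?thesis unfolding h_def p_def Let_def by simp
  qed
  have "linear_on R X (X.sum_set A B) Y h"
  proof (rule linear_onI)
    fix x assume "x \<in> X.sum_set A B"
    then show "h x \<in> carrier Y" by (elim X.sum_setE) (simp add: h mA mB)
  next
    fix x y assume "x \<in> X.sum_set A B" "y \<in> X.sum_set A B"
    then obtain u v u' v' where *: "u \<in> A" "v \<in> B" "x = u \<oplus>\<^bsub>X\<^esub> v" "u' \<in> A" "v' \<in> B" "y = u' \<oplus>\<^bsub>X\<^esub> v'"
      by (auto simp: X.sum_set_def)
    then have "x \<oplus>\<^bsub>X\<^esub> y = (u \<oplus>\<^bsub>X\<^esub> u') \<oplus>\<^bsub>X\<^esub> (v \<oplus>\<^bsub>X\<^esub> v')"
      by (simp add: mA mB X.M.add.m_ac)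
    then have "h (x \<oplus>\<^bsub>X\<^esub> y) = f (u \<oplus>\<^bsub>X\<^esub> u') \<oplus>\<^bsub>Y\<^esub> g (v \<oplus>\<^bsub>X\<^esub> v')"
      using * by (simp add: h mA mB)
    then show "h (x \<oplus>\<^bsub>X\<^esub> y) = h x \<oplus>\<^bsub>Y\<^esub> h y"
      using * f g by (simp add: h mA mB linear_on_add Y.M.add.m_ac)
  next
    fix r x assume r: "r \<in> carrier R" and "x \<in> X.sum_set A B"
    then obtain u v where *: "u \<in> A" "v \<in> B" "x = u \<oplus>\<^bsub>X\<^esub> v"
      by (auto simp: X.sum_set_def)
    then have "r \<odot>\<^bsub>X\<^esub> x = r \<odot>\<^bsub>X\<^esub> u \<oplus>\<^bsub>X\<^esub> r \<odot>\<^bsub>X\<^esub> v"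
      using r by (simp add: mA mB X.smult_r_distr)
    then show "h (r \<odot>\<^bsub>X\<^esub> x) = r \<odot>\<^bsub>Y\<^esub> h x"
      using * f g r by (simp add: h mA mB linear_on_smult Y.smult_r_distr)
  qed
  then show ?thesis using h that by blast
qed

text \<open>The cyclic module of \<open>x\<close> is R modulo the annihilator of \<open>x\<close>,
  so a map out of it amounts to an element \<open>y\<close> killed by that annihilator.\<close>

lemma linear_on_cyclic:
  assumes x: "x \<in> carrier X" and y: "y \<in> carrier Y"
    and ann: "\<And>r. r \<in> carrier R \<Longrightarrow> r \<odot>\<^bsub>X\<^esub> x = \<zero>\<^bsub>X\<^esub> \<Longrightarrow> r \<odot>\<^bsub>Y\<^esub> y = \<zero>\<^bsub>Y\<^esub>"
  obtains h where "linear_on R X (X.cyclic x) Y h" "\<And>r. r \<in> carrier R \<Longrightarrow> h (r \<odot>\<^bsub>X\<^esub> x) = r \<odot>\<^bsub>Y\<^esub> y"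
proof -
  have wd: "r \<odot>\<^bsub>Y\<^esub> y = s \<odot>\<^bsub>Y\<^esub> y"
    if rs: "r \<in> carrier R" "s \<in> carrier R" and e: "r \<odot>\<^bsub>X\<^esub> x = s \<odot>\<^bsub>X\<^esub> x" for r s
  proof -
    have "(r \<oplus>\<^bsub>R\<^esub> \<ominus>\<^bsub>R\<^esub> s) \<odot>\<^bsub>X\<^esub> x = \<zero>\<^bsub>X\<^esub>"
      using rs x e by (simp add: X.smult_l_distr X.smult_l_neg X.M.r_neg)
    then have "(r \<oplus>\<^bsub>R\<^esub> \<ominus>\<^bsub>R\<^esub> s) \<odot>\<^bsub>Y\<^esub> y = \<zero>\<^bsub>Y\<^esub>" using rs by (intro ann) auto
    then have "r \<odot>\<^bsub>Y\<^esub> y \<ominus>\<^bsub>Y\<^esub> s \<odot>\<^bsub>Y\<^esub> y = \<zero>\<^bsub>Y\<^esub>"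
      using rs y by (simp add: Y.smult_l_distr Y.smult_l_neg a_minus_def)
    then show ?thesis using rs y by (simp add: Y.minus_zero_eq)
  qed
  define h where "h z = (SOME r. r \<in> carrier R \<and> z = r \<odot>\<^bsub>X\<^esub> x) \<odot>\<^bsub>Y\<^esub> y" for z
  have h: "h (r \<odot>\<^bsub>X\<^esub> x) = r \<odot>\<^bsub>Y\<^esub> y" if r: "r \<in> carrier R" for r
  proof -
    have e: "\<exists>s. s \<in> carrier R \<and> r \<odot>\<^bsub>X\<^esub> x = s \<odot>\<^bsub>X\<^esub> x" using r by blast
    show ?thesis unfolding h_def using someI_ex[OF e] wd[OF _ r] by (elim conjE) (rule wd[OF _ r], simp_all)
  qed
  have "linear_on R X (X.cyclic x) Y h"
  proof (rule linear_onI)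
    fix u assume "u \<in> X.cyclic x"
    then obtain r where "r \<in> carrier R" "u = r \<odot>\<^bsub>X\<^esub> x" by (auto simp: X.cyclic_def)
    then show "h u \<in> carrier Y" using y by (simp add: h)
  next
    fix u v assume "u \<in> X.cyclic x" "v \<in> X.cyclic x"
    then obtain r s where rs: "r \<in> carrier R" "u = r \<odot>\<^bsub>X\<^esub> x" "s \<in> carrier R" "v = s \<odot>\<^bsub>X\<^esub> x"
      by (auto simp: X.cyclic_def)
    then have "u \<oplus>\<^bsub>X\<^esub> v = (r \<oplus>\<^bsub>R\<^esub> s) \<odot>\<^bsub>X\<^esub> x" using x by (simp add: X.smult_l_distr)
    then show "h (u \<oplus>\<^bsub>X\<^esub> v) = h u \<oplus>\<^bsub>Y\<^esub> h v" using rs x y by (simp add: h Y.smult_l_distr)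
  next
    fix s u assume s: "s \<in> carrier R" and "u \<in> X.cyclic x"
    then obtain r where rs: "r \<in> carrier R" "u = r \<odot>\<^bsub>X\<^esub> x" by (auto simp: X.cyclic_def)
    then have "s \<odot>\<^bsub>X\<^esub> u = (s \<otimes>\<^bsub>R\<^esub> r) \<odot>\<^bsub>X\<^esub> x" using x s by (simp add: X.smult_assoc1)
    then show "h (s \<odot>\<^bsub>X\<^esub> u) = s \<odot>\<^bsub>Y\<^esub> h u" using rs x y s by (simp add: h Y.smult_assoc1)
  qed
  then show ?thesis using h that by blast
qed

end

section \<open>Submodules as modules in their own right\<close>

lemma left_module_submodule_as_module:
  assumes "left_module R X" "submodule L R X"
  shows "left_module R (submodule_as_module X L)"
proof -
  interpret X: left_module R X by fact
  note m = X.submodule_mem[OF assms(2)] X.submodule_add[OF assms(2)] X.submodule_smult[OF assms(2)]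
    X.submodule_zero[OF assms(2)] X.submodule_neg[OF assms(2)]
  have "abelian_group (submodule_as_module X L)"
    unfolding submodule_as_module_def
  proof (rule abelian_groupI; simp)
    fix x assume "x \<in> L"
    then show "\<exists>y\<in>L. y \<oplus>\<^bsub>X\<^esub> x = \<zero>\<^bsub>X\<^esub>" using m by (metis X.l_neg)
  next
    fix x y assume "x \<in> L" "y \<in> L" then show "x \<oplus>\<^bsub>X\<^esub> y = y \<oplus>\<^bsub>X\<^esub> x" by (intro X.a_comm m)
  next
    fix x y z assume "x \<in> L" "y \<in> L" "z \<in> L"
    then show "x \<oplus>\<^bsub>X\<^esub> y \<oplus>\<^bsub>X\<^esub> z = x \<oplus>\<^bsub>X\<^esub> (y \<oplus>\<^bsub>X\<^esub> z)" by (intro X.a_assoc m)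
  qed (auto simp: m)
  then show ?thesis
    unfolding left_module_def left_module_axioms_def
    by (auto simp: X.R.ring_axioms submodule_as_module_def m X.smult_l_distr X.smult_r_distr X.smult_assoc1)
qed

lemma submodule_as_module_simps [simp]:
  "carrier (submodule_as_module X L) = L" "zero (submodule_as_module X L) = zero X"
  "add (submodule_as_module X L) = add X" "smult (submodule_as_module X L) = smult X"
  by (simp_all add: submodule_as_module_def)

lemma linear_on_submodule_as_module:
  "linear_on R (submodule_as_module X L) K Y f \<longleftrightarrow> linear_on R X K Y f"
  by (simp add: linear_on_def)

lemma linear_on_into_submodule_as_module:
  "submodule K R Y \<Longrightarrow> left_module R Y \<Longrightarrow>
   linear_on R X L (submodule_as_module Y K) f \<longleftrightarrow> linear_on R X L Y f \<and> f ` L \<subseteq> K"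
  by (auto simp: linear_on_def left_module.submodule_mem image_subset_iff dest: left_module.submodule_subset)

section \<open>Quotients, direct sums and endomorphism rings\<close>

context left_module
begin

section \<open>Direct sums of copies of M\<close>

lemma carrier_copower:
  "carrier (copower I M) = {x \<in> I \<rightarrow>\<^sub>E carrier M. finite {i\<in>I. x i \<noteq> \<zero>\<^bsub>M\<^esub>}}"
  unfolding copower_def using carrier_sum_group[of I "\<lambda>_. add_monoid M"] M.a_group by simp

lemma copower_simps:
  "zero (copower I M) = (\<lambda>i\<in>I. \<zero>\<^bsub>M\<^esub>)"
  "add (copower I M) = (\<lambda>x y. \<lambda>i\<in>I. x i \<oplus>\<^bsub>M\<^esub> y i)"
  "smult (copower I M) = (\<lambda>r x. \<lambda>i\<in>I. r \<odot>\<^bsub>M\<^esub> x i)"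
  unfolding copower_def sum_group_def subgroup_generated_def by simp_all

lemma copower_mem: "x \<in> carrier (copower I M) \<Longrightarrow> i \<in> I \<Longrightarrow> x i \<in> carrier M"
  by (auto simp: carrier_copower)

lemma copower_add_closed:
  assumes "x \<in> carrier (copower I M)" "y \<in> carrier (copower I M)"
  shows "(\<lambda>i\<in>I. x i \<oplus>\<^bsub>M\<^esub> y i) \<in> carrier (copower I M)"
proof -
  have "{i\<in>I. (\<lambda>i\<in>I. x i \<oplus>\<^bsub>M\<^esub> y i) i \<noteq> \<zero>\<^bsub>M\<^esub>} \<subseteq> {i\<in>I. x i \<noteq> \<zero>\<^bsub>M\<^esub>} \<union> {i\<in>I. y i \<noteq> \<zero>\<^bsub>M\<^esub>}"
    by auto
  moreover have "finite \<dots>" using assms by (auto simp: carrier_copower)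
  ultimately have "finite {i\<in>I. (\<lambda>i\<in>I. x i \<oplus>\<^bsub>M\<^esub> y i) i \<noteq> \<zero>\<^bsub>M\<^esub>}" by (rule finite_subset)
  then show ?thesis using assms unfolding carrier_copower by auto
qed

lemma copower_map_closed:
  assumes "x \<in> carrier (copower I M)" "h \<zero>\<^bsub>M\<^esub> = \<zero>\<^bsub>M\<^esub>" "\<And>x. x \<in> carrier M \<Longrightarrow> h x \<in> carrier M"
  shows "(\<lambda>i\<in>I. h (x i)) \<in> carrier (copower I M)"
proof -
  have "{i\<in>I. (\<lambda>i\<in>I. h (x i)) i \<noteq> \<zero>\<^bsub>M\<^esub>} \<subseteq> {i\<in>I. x i \<noteq> \<zero>\<^bsub>M\<^esub>}"
    using assms by auto
  moreover have "finite \<dots>" using assms by (auto simp: carrier_copower)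
  ultimately have "finite {i\<in>I. (\<lambda>i\<in>I. h (x i)) i \<noteq> \<zero>\<^bsub>M\<^esub>}" by (rule finite_subset)
  then show ?thesis using assms unfolding carrier_copower by auto
qed

lemma copower_ext:
  assumes "x \<in> carrier (copower I M)" "y \<in> carrier (copower I M)" "\<And>i. i \<in> I \<Longrightarrow> x i = y i"
  shows "x = y"
proof -
  have "x \<in> I \<rightarrow>\<^sub>E carrier M" "y \<in> I \<rightarrow>\<^sub>E carrier M" using assms unfolding carrier_copower by auto
  then show ?thesis by (rule PiE_ext) (rule assms(3))
qed

lemma left_module_copower: "left_module R (copower I M)"
proof -
  note mem = copower_mem[of _ I]
  note ac = copower_add_closed[of _ I] and mc = copower_map_closed[of _ I]
  have sc: "(\<lambda>i\<in>I. r \<odot>\<^bsub>M\<^esub> x i) \<in> carrier (copower I M)"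
    if "r \<in> carrier R" "x \<in> carrier (copower I M)" for r x
    by (rule mc) (use that in \<open>auto simp: smult_r_null\<close>)
  have zc: "(\<lambda>i\<in>I. \<zero>\<^bsub>M\<^esub>) \<in> carrier (copower I M)"
    by (auto simp: carrier_copower)
  have "abelian_group (copower I M)"
  proof (rule abelian_groupI, goal_cases)
    case (6 x)
    have "(\<lambda>i\<in>I. \<ominus>\<^bsub>M\<^esub> x i) \<in> carrier (copower I M)" by (rule mc) (use 6 in auto)
    moreover have "(\<lambda>i\<in>I. \<ominus>\<^bsub>M\<^esub> x i) \<oplus>\<^bsub>copower I M\<^esub> x = \<zero>\<^bsub>copower I M\<^esub>"
      using 6 mem by (auto simp: copower_simps M.l_neg intro!: restrict_ext)
    ultimately show ?case by blast
  next
    case (5 x)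
    show ?case
      unfolding copower_simps
      by (rule copower_ext[OF ac[OF zc 5] 5]) (simp add: mem[OF 5])
  next
    case (3 x y z)
    then show ?case unfolding copower_simps by (intro restrict_ext) (simp add: mem M.a_assoc)
  next
    case (4 x y)
    then show ?case unfolding copower_simps by (intro restrict_ext) (simp add: mem M.a_comm)
  qed (simp_all add: copower_simps ac zc)
  moreover have "left_module_axioms R (copower I M)"
  proof (unfold_locales, unfold copower_simps)
    fix x assume x: "x \<in> carrier (copower I M)"
    show "(\<lambda>i\<in>I. \<one>\<^bsub>R\<^esub> \<odot>\<^bsub>M\<^esub> x i) = x"
      by (rule copower_ext[OF sc[OF R.one_closed x] x]) (simp add: mem[OF x])
  next
    fix r s x assume "r \<in> carrier R" "s \<in> carrier R" "x \<in> carrier (copower I M)"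
    then show "(\<lambda>i\<in>I. (r \<oplus>\<^bsub>R\<^esub> s) \<odot>\<^bsub>M\<^esub> x i) = (\<lambda>i\<in>I. (\<lambda>i\<in>I. r \<odot>\<^bsub>M\<^esub> x i) i \<oplus>\<^bsub>M\<^esub> (\<lambda>i\<in>I. s \<odot>\<^bsub>M\<^esub> x i) i)"
      by (intro restrict_ext) (simp add: mem smult_l_distr)
    show "(\<lambda>i\<in>I. (r \<otimes>\<^bsub>R\<^esub> s) \<odot>\<^bsub>M\<^esub> x i) = (\<lambda>i\<in>I. r \<odot>\<^bsub>M\<^esub> (\<lambda>i\<in>I. s \<odot>\<^bsub>M\<^esub> x i) i)"
      using \<open>r \<in> carrier R\<close> \<open>s \<in> carrier R\<close> \<open>x \<in> carrier (copower I M)\<close>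
      by (intro restrict_ext) (simp add: mem smult_assoc1)
  next
    fix r x y assume "r \<in> carrier R" "x \<in> carrier (copower I M)" "y \<in> carrier (copower I M)"
    then show "(\<lambda>i\<in>I. r \<odot>\<^bsub>M\<^esub> (\<lambda>i\<in>I. x i \<oplus>\<^bsub>M\<^esub> y i) i) = (\<lambda>i\<in>I. (\<lambda>i\<in>I. r \<odot>\<^bsub>M\<^esub> x i) i \<oplus>\<^bsub>M\<^esub> (\<lambda>i\<in>I. r \<odot>\<^bsub>M\<^esub> y i) i)"
      by (intro restrict_ext) (simp add: mem smult_r_distr)
  qed (rule sc)
  ultimately show ?thesis by (simp add: left_module_def R.ring_axioms)
qed

section \<open>Cosets and quotient modules\<close>

lemma coset_mem_quotient: "submodule N R M \<Longrightarrow> X \<in> carrier (quotient_module M N) \<longleftrightarrow> (\<exists>x\<in>carrier M. X = N +>\<^bsub>M\<^esub> x)"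
  by (auto simp: quotient_module_def A_RCOSETS_def')

lemma abelian_subgroup_submodule: "submodule N R M \<Longrightarrow> abelian_subgroup N M"
  using submodule.axioms(1)[of N R M]
  by (intro abelian_subgroupI3 M.abelian_group_axioms) (simp add: additive_subgroup_def)

lemma coset_eq_iff:
  assumes "submodule N R M" "x \<in> carrier M" "y \<in> carrier M"
  shows "N +>\<^bsub>M\<^esub> x = N +>\<^bsub>M\<^esub> y \<longleftrightarrow> x \<ominus>\<^bsub>M\<^esub> y \<in> N"
proof -
  interpret N: abelian_subgroup N M by (rule abelian_subgroup_submodule[OF assms(1)])
  have "N +>\<^bsub>M\<^esub> x = N +>\<^bsub>M\<^esub> y \<longleftrightarrow> x \<in> N +>\<^bsub>M\<^esub> y"
    using assms N.a_repr_independence' N.a_rcos_self by blast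
  also have "\<dots> \<longleftrightarrow> x \<ominus>\<^bsub>M\<^esub> y \<in> N"
    using assms by (simp add: N.a_rcos_module a_minus_def)
  finally show ?thesis .
qed

lemma coset_add:
  assumes "submodule N R M" "x \<in> carrier M" "y \<in> carrier M"
  shows "(N +>\<^bsub>M\<^esub> x) \<oplus>\<^bsub>quotient_module M N\<^esub> (N +>\<^bsub>M\<^esub> y) = N +>\<^bsub>M\<^esub> (x \<oplus>\<^bsub>M\<^esub> y)"
proof -
  interpret N: abelian_subgroup N M by (rule abelian_subgroup_submodule[OF assms(1)])
  show ?thesis using assms by (simp add: quotient_module_def N.a_rcos_sum)
qed

text \<open>Scalar multiplication of a coset is defined as a union over its elements; each of them
  contributes the same coset.\<close>

lemma coset_smult:
  assumes "submodule N R M" "r \<in> carrier R" "x \<in> carrier M"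
  shows "r \<odot>\<^bsub>quotient_module M N\<^esub> (N +>\<^bsub>M\<^esub> x) = N +>\<^bsub>M\<^esub> (r \<odot>\<^bsub>M\<^esub> x)"
proof -
  interpret N: abelian_subgroup N M by (rule abelian_subgroup_submodule[OF assms(1)])
  have "N +>\<^bsub>M\<^esub> (r \<odot>\<^bsub>M\<^esub> y) = N +>\<^bsub>M\<^esub> (r \<odot>\<^bsub>M\<^esub> x)" if "y \<in> N +>\<^bsub>M\<^esub> x" for y
  proof -
    have y: "y \<in> carrier M" using that N.a_elemrcos_carrier assms by blast
    have "y \<ominus>\<^bsub>M\<^esub> x \<in> N" using that assms y
      by (simp add: N.a_rcos_module a_minus_def)
    then have "r \<odot>\<^bsub>M\<^esub> (y \<ominus>\<^bsub>M\<^esub> x) \<in> N" by (rule submodule_smult[OF assms(1,2)])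
    then have "r \<odot>\<^bsub>M\<^esub> y \<ominus>\<^bsub>M\<^esub> r \<odot>\<^bsub>M\<^esub> x \<in> N"
      using y assms by (simp add: a_minus_def smult_r_distr smult_r_neg)
    then show ?thesis using coset_eq_iff[OF assms(1)] y assms by simp
  qed
  moreover have "x \<in> N +>\<^bsub>M\<^esub> x" using N.a_rcos_self assms by blast
  ultimately have "(\<Union>y\<in>N +>\<^bsub>M\<^esub> x. N +>\<^bsub>M\<^esub> (r \<odot>\<^bsub>M\<^esub> y)) = N +>\<^bsub>M\<^esub> (r \<odot>\<^bsub>M\<^esub> x)"
    by (intro SUP_eq_const) blast+
  then show ?thesis by (simp add: quotient_module_def)
qed

lemma coset_zero: "submodule N R M \<Longrightarrow> \<zero>\<^bsub>quotient_module M N\<^esub> = N +>\<^bsub>M\<^esub> \<zero>\<^bsub>M\<^esub>"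
  using abelian_subgroup_submodule[of N] M.a_coset_add_zero[OF submodule_subset, of N]
  by (simp add: quotient_module_def)

lemma coset_closed: "submodule N R M \<Longrightarrow> x \<in> carrier M \<Longrightarrow> N +>\<^bsub>M\<^esub> x \<in> carrier (quotient_module M N)"
  by (auto simp: coset_mem_quotient)

lemma coset_eq_zero_iff:
  assumes "submodule N R M" "x \<in> carrier M"
  shows "N +>\<^bsub>M\<^esub> x = \<zero>\<^bsub>quotient_module M N\<^esub> \<longleftrightarrow> x \<in> N"
proof -
  have "\<ominus>\<^bsub>M\<^esub> \<zero>\<^bsub>M\<^esub> = \<zero>\<^bsub>M\<^esub>" by (rule M.minus_equality) simp_all
  then have "x \<ominus>\<^bsub>M\<^esub> \<zero>\<^bsub>M\<^esub> = x" using assms unfolding a_minus_def by simp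
  then show ?thesis using assms by (simp add: coset_zero coset_eq_iff)
qed

lemma left_module_quotient:
  assumes N: "submodule N R M" shows "left_module R (quotient_module M N)"
proof -
  note simps = coset_add[OF N] coset_smult[OF N] coset_zero[OF N] coset_closed[OF N]
  have "abelian_group (quotient_module M N)"
  proof (rule abelian_groupI, unfold coset_mem_quotient[OF N])
    fix X Y Z assume "\<exists>x\<in>carrier M. X = N +>\<^bsub>M\<^esub> x" "\<exists>x\<in>carrier M. Y = N +>\<^bsub>M\<^esub> x" "\<exists>x\<in>carrier M. Z = N +>\<^bsub>M\<^esub> x"
    then obtain x y z where "x \<in> carrier M" "y \<in> carrier M" "z \<in> carrier M"
      "X = N +>\<^bsub>M\<^esub> x" "Y = N +>\<^bsub>M\<^esub> y" "Z = N +>\<^bsub>M\<^esub> z" by blast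
    then show "X \<oplus>\<^bsub>quotient_module M N\<^esub> Y \<oplus>\<^bsub>quotient_module M N\<^esub> Z =
        X \<oplus>\<^bsub>quotient_module M N\<^esub> (Y \<oplus>\<^bsub>quotient_module M N\<^esub> Z)"
      by (simp add: simps M.a_assoc)
  next
    fix X Y assume "\<exists>x\<in>carrier M. X = N +>\<^bsub>M\<^esub> x" "\<exists>x\<in>carrier M. Y = N +>\<^bsub>M\<^esub> x"
    then obtain x y where xy: "x \<in> carrier M" "y \<in> carrier M"
      "X = N +>\<^bsub>M\<^esub> x" "Y = N +>\<^bsub>M\<^esub> y" by blast
    then show "\<exists>x\<in>carrier M. X \<oplus>\<^bsub>quotient_module M N\<^esub> Y = N +>\<^bsub>M\<^esub> x"
      by (auto simp: simps intro!: bexI[of _ "x \<oplus>\<^bsub>M\<^esub> y"])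
    show "X \<oplus>\<^bsub>quotient_module M N\<^esub> Y = Y \<oplus>\<^bsub>quotient_module M N\<^esub> X"
      using xy M.a_comm[of x y] by (simp add: simps)
  next
    show "\<exists>x\<in>carrier M. \<zero>\<^bsub>quotient_module M N\<^esub> = N +>\<^bsub>M\<^esub> x"
      using simps(3) by blast
  next
    fix X assume "\<exists>x\<in>carrier M. X = N +>\<^bsub>M\<^esub> x"
    then obtain x where x: "x \<in> carrier M" "X = N +>\<^bsub>M\<^esub> x" by blast
    then show "\<zero>\<^bsub>quotient_module M N\<^esub> \<oplus>\<^bsub>quotient_module M N\<^esub> X = X" by (simp add: simps)
    show "\<exists>Y\<in>carrier (quotient_module M N). Y \<oplus>\<^bsub>quotient_module M N\<^esub> X = \<zero>\<^bsub>quotient_module M N\<^esub>"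
      by (rule bexI[of _ "N +>\<^bsub>M\<^esub> (\<ominus>\<^bsub>M\<^esub> x)"]) (use x in \<open>simp_all add: simps M.l_neg\<close>)
  qed
  moreover have "left_module_axioms R (quotient_module M N)"
  proof (unfold_locales, unfold coset_mem_quotient[OF N])
    fix r s X assume rs: "r \<in> carrier R" "s \<in> carrier R" and "\<exists>x\<in>carrier M. X = N +>\<^bsub>M\<^esub> x"
    then obtain x where x: "x \<in> carrier M" "X = N +>\<^bsub>M\<^esub> x" by blast
    show "(r \<oplus>\<^bsub>R\<^esub> s) \<odot>\<^bsub>quotient_module M N\<^esub> X =
        r \<odot>\<^bsub>quotient_module M N\<^esub> X \<oplus>\<^bsub>quotient_module M N\<^esub> s \<odot>\<^bsub>quotient_module M N\<^esub> X"
      using rs x by (simp add: simps smult_l_distr)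
    show "(r \<otimes>\<^bsub>R\<^esub> s) \<odot>\<^bsub>quotient_module M N\<^esub> X = r \<odot>\<^bsub>quotient_module M N\<^esub> (s \<odot>\<^bsub>quotient_module M N\<^esub> X)"
      using rs x by (simp add: simps smult_assoc1)
  next
    fix r X assume r: "r \<in> carrier R" and "\<exists>x\<in>carrier M. X = N +>\<^bsub>M\<^esub> x"
    then obtain x where x: "x \<in> carrier M" "X = N +>\<^bsub>M\<^esub> x" by blast
    show "\<exists>x\<in>carrier M. r \<odot>\<^bsub>quotient_module M N\<^esub> X = N +>\<^bsub>M\<^esub> x"
      by (rule bexI[of _ "r \<odot>\<^bsub>M\<^esub> x"]) (use r x in \<open>simp_all add: simps\<close>)
  next
    fix X assume "\<exists>x\<in>carrier M. X = N +>\<^bsub>M\<^esub> x"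
    then obtain x where x: "x \<in> carrier M" "X = N +>\<^bsub>M\<^esub> x" by blast
    then show "\<one>\<^bsub>R\<^esub> \<odot>\<^bsub>quotient_module M N\<^esub> X = X" by (simp add: simps)
  next
    fix r X Y assume r: "r \<in> carrier R" and "\<exists>x\<in>carrier M. X = N +>\<^bsub>M\<^esub> x" "\<exists>x\<in>carrier M. Y = N +>\<^bsub>M\<^esub> x"
    then obtain x y where "x \<in> carrier M" "X = N +>\<^bsub>M\<^esub> x" "y \<in> carrier M" "Y = N +>\<^bsub>M\<^esub> y" by blast
    then show "r \<odot>\<^bsub>quotient_module M N\<^esub> (X \<oplus>\<^bsub>quotient_module M N\<^esub> Y) =
        r \<odot>\<^bsub>quotient_module M N\<^esub> X \<oplus>\<^bsub>quotient_module M N\<^esub> r \<odot>\<^bsub>quotient_module M N\<^esub> Y"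
      using r by (simp add: simps smult_r_distr)
  qed
  ultimately show ?thesis by (simp add: left_module_def R.ring_axioms)
qed

lemma linear_coset: "submodule N R M \<Longrightarrow> linear R M (quotient_module M N) (\<lambda>x. N +>\<^bsub>M\<^esub> x)"
  by (intro linear_onI) (simp_all add: coset_closed coset_add coset_smult)

text \<open>The universal property of the quotient: \<open>g\<close> evaluates \<open>f\<close> at a
  chosen representative, and the choice is irrelevant because two representatives differ by an
  element of N.\<close>

lemma linear_from_quotient:
  assumes "left_module R Y" "submodule N R M" "linear R M Y f" "\<And>x. x \<in> N \<Longrightarrow> f x = \<zero>\<^bsub>Y\<^esub>"
  obtains g where "linear R (quotient_module M N) Y g" "\<And>x. x \<in> carrier M \<Longrightarrow> g (N +>\<^bsub>M\<^esub> x) = f x"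
proof -
  interpret MY: two_modules R M Y using assms left_module_axioms by (simp add: two_modules_def)
  define g where "g X = f (SOME x. x \<in> carrier M \<and> X = N +>\<^bsub>M\<^esub> x)" for X
  have g: "g (N +>\<^bsub>M\<^esub> x) = f x" if "x \<in> carrier M" for x
  proof -
    let ?y = "SOME y. y \<in> carrier M \<and> N +>\<^bsub>M\<^esub> x = N +>\<^bsub>M\<^esub> y"
    have y: "?y \<in> carrier M \<and> N +>\<^bsub>M\<^esub> x = N +>\<^bsub>M\<^esub> ?y"
      by (rule someI[of _ x]) (use that in auto)
    then have "f (x \<ominus>\<^bsub>M\<^esub> ?y) = \<zero>\<^bsub>Y\<^esub>" using coset_eq_iff[OF assms(2) that] assms(4) by blast
    then have "f x \<ominus>\<^bsub>Y\<^esub> f ?y = \<zero>\<^bsub>Y\<^esub>"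
      using MY.linear_on_minus[OF assms(3) submodule_carrier that] y by simp
    then have "f x = f ?y"
      using MY.Y.minus_zero_eq[OF linear_on_closed[OF assms(3) that] linear_on_closed[OF assms(3)]] y by blast
    then show ?thesis unfolding g_def by (rule sym)
  qed
  have "linear R (quotient_module M N) Y g"
    by (rule linear_onI) (use assms in \<open>auto simp: coset_mem_quotient g coset_add coset_smult
          linear_on_closed linear_on_add linear_on_smult\<close>)
  then show ?thesis using g that by blast
qed

end

section \<open>Endomorphism rings\<close>

lemma End_ring_simps:
  "carrier (End_ring R X) = Hom R X X" "mult (End_ring R X) = (\<lambda>f g. compose (carrier X) f g)"
  "one (End_ring R X) = (\<lambda>x\<in>carrier X. x)" "zero (End_ring R X) = (\<lambda>x\<in>carrier X. \<zero>\<^bsub>X\<^esub>)"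
  "add (End_ring R X) = (\<lambda>f g. \<lambda>x\<in>carrier X. f x \<oplus>\<^bsub>X\<^esub> g x)"
  by (simp_all add: End_ring_def)

lemma Hom_closed: "f \<in> Hom R X Y \<Longrightarrow> x \<in> carrier X \<Longrightarrow> f x \<in> carrier Y"
  by (auto simp: Hom_def)

lemma Hom_ext:
  assumes "f \<in> Hom R X Y" "g \<in> Hom R X Y" "\<And>x. x \<in> carrier X \<Longrightarrow> f x = g x"
  shows "f = g"
  using assms by (auto simp: Hom_iff intro: extensionalityI)

lemma (in left_module) ring_End_ring: "ring (End_ring R M)"
proof -
  interpret MM: two_modules R M M by (simp add: two_modules_def left_module_axioms)
  note cl = Hom_closed[of _ R M M]
  have add: "(\<lambda>x\<in>carrier M. f x \<oplus>\<^bsub>M\<^esub> g x) \<in> Hom R M M" if "f \<in> Hom R M M" "g \<in> Hom R M M" for f g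
    by (rule MM.Hom_restrict) (intro MM.linear_on_sum linear_Hom that)
  have neg: "(\<lambda>x\<in>carrier M. \<ominus>\<^bsub>M\<^esub> f x) \<in> Hom R M M" if "f \<in> Hom R M M" for f
    by (rule MM.Hom_restrict) (intro MM.linear_on_uminus linear_Hom that)
  have mul: "compose (carrier M) f g \<in> Hom R M M" if "f \<in> Hom R M M" "g \<in> Hom R M M" for f g
    unfolding compose_def by (rule MM.Hom_restrict, rule linear_comp[OF linear_Hom[OF that(2)] linear_Hom[OF that(1)]])
  have one: "(\<lambda>x\<in>carrier M. x) \<in> Hom R M M" by (rule MM.Hom_restrict) (auto simp: linear_on_def)
  have zero: "(\<lambda>x\<in>carrier M. \<zero>\<^bsub>M\<^esub>) \<in> Hom R M M" by (rule MM.Hom_restrict) (rule MM.linear_zero)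
  show ?thesis
  proof (rule ringI)
    show "abelian_group (End_ring R M)"
    proof (rule abelian_groupI, unfold End_ring_simps, goal_cases)
      case (6 f)
      show ?case by (rule bexI[OF _ neg[OF 6]]) (use 6 cl in \<open>auto simp: M.l_neg intro!: restrict_ext\<close>)
    next
      case (5 f)
      show ?case by (rule Hom_ext[OF add[OF zero 5] 5]) (use 5 cl in auto)
    next
      case (3 f g h)
      then show ?case by (auto simp: cl M.a_assoc intro!: restrict_ext)
    next
      case (4 f g)
      then show ?case by (auto simp: cl M.a_comm intro!: restrict_ext)
    qed (auto simp: add zero)
    show "Group.monoid (End_ring R M)"
    proof (rule monoidI, unfold End_ring_simps, goal_cases)
      case (3 f g h)
      then show ?case by (auto simp: compose_def cl intro!: restrict_ext)
    next
      case (4 f)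
      show ?case by (rule Hom_ext[OF mul[OF one 4] 4]) (use 4 cl in \<open>auto simp: compose_def\<close>)
    next
      case (5 f)
      show ?case by (rule Hom_ext[OF mul[OF 5 one] 5]) (use 5 cl in \<open>auto simp: compose_def\<close>)
    qed (auto simp: mul one)
  next
    fix f g h assume "f \<in> carrier (End_ring R M)" "g \<in> carrier (End_ring R M)" "h \<in> carrier (End_ring R M)"
    then have *: "f \<in> Hom R M M" "g \<in> Hom R M M" "h \<in> Hom R M M" by (simp_all add: End_ring_simps)
    then show "(f \<oplus>\<^bsub>End_ring R M\<^esub> g) \<otimes>\<^bsub>End_ring R M\<^esub> h =
        f \<otimes>\<^bsub>End_ring R M\<^esub> h \<oplus>\<^bsub>End_ring R M\<^esub> g \<otimes>\<^bsub>End_ring R M\<^esub> h"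
      by (auto simp: End_ring_simps compose_def cl intro!: restrict_ext)
    show "h \<otimes>\<^bsub>End_ring R M\<^esub> (f \<oplus>\<^bsub>End_ring R M\<^esub> g) =
        h \<otimes>\<^bsub>End_ring R M\<^esub> f \<oplus>\<^bsub>End_ring R M\<^esub> h \<otimes>\<^bsub>End_ring R M\<^esub> g"
      using * linear_on_add[OF linear_Hom[OF *(3)]]
      by (auto simp: End_ring_simps compose_def cl intro!: restrict_ext)
  qed
qed

section \<open>Generation and injectivity for objects of arbitrary carrier type\<close>

context left_module
begin

text \<open>The coordinate embedding of M into the direct sum at position i; for i outside I it is
  the zero family.\<close>

definition single where "single I i m = (\<lambda>l\<in>I. if l = i then m else \<zero>\<^bsub>M\<^esub>)"

lemma single_closed: "m \<in> carrier M \<Longrightarrow> single I i m \<in> carrier (copower I M)"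
proof -
  assume m: "m \<in> carrier M"
  have "{l\<in>I. single I i m l \<noteq> \<zero>\<^bsub>M\<^esub>} \<subseteq> {i}" by (auto simp: single_def)
  then have "finite {l\<in>I. single I i m l \<noteq> \<zero>\<^bsub>M\<^esub>}" by (rule finite_subset) simp
  then show ?thesis using m by (auto simp: carrier_copower single_def)
qed

lemma linear_single: "linear R M (copower I M) (single I i)"
proof (rule linear_onI)
  fix x y assume "x \<in> carrier M" "y \<in> carrier M"
  then show "single I i (x \<oplus>\<^bsub>M\<^esub> y) = single I i x \<oplus>\<^bsub>copower I M\<^esub> single I i y"
    unfolding single_def copower_simps by (intro restrict_ext) simp
next
  fix r x assume "r \<in> carrier R" "x \<in> carrier M"
  then show "single I i (r \<odot>\<^bsub>M\<^esub> x) = r \<odot>\<^bsub>copower I M\<^esub> single I i x"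
    unfolding single_def copower_simps by (intro restrict_ext) (simp add: smult_r_null)
qed (rule single_closed)

text \<open>Peels one coordinate off a family, for inductions over its support.\<close>

lemma copower_split:
  assumes x: "x \<in> carrier (copower I M)" and i: "i \<in> I"
  shows "x(i := \<zero>\<^bsub>M\<^esub>) \<in> carrier (copower I M)"
    and "x = single I i (x i) \<oplus>\<^bsub>copower I M\<^esub> x(i := \<zero>\<^bsub>M\<^esub>)"
proof -
  have "{l\<in>I. (x(i := \<zero>\<^bsub>M\<^esub>)) l \<noteq> \<zero>\<^bsub>M\<^esub>} \<subseteq> {l\<in>I. x l \<noteq> \<zero>\<^bsub>M\<^esub>}" by auto
  moreover have "finite \<dots>" using x by (auto simp: carrier_copower)
  ultimately have "finite {l\<in>I. (x(i := \<zero>\<^bsub>M\<^esub>)) l \<noteq> \<zero>\<^bsub>M\<^esub>}" by (rule finite_subset)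
  moreover have "x \<in> I \<rightarrow>\<^sub>E carrier M" using x by (simp add: carrier_copower)
  then have "x(i := \<zero>\<^bsub>M\<^esub>) \<in> I \<rightarrow>\<^sub>E carrier M" using i by (auto simp: PiE_iff extensional_def)
  ultimately show c: "x(i := \<zero>\<^bsub>M\<^esub>) \<in> carrier (copower I M)" by (simp add: carrier_copower)
  have xi: "x i \<in> carrier M" using copower_mem[OF x i] .
  show "x = single I i (x i) \<oplus>\<^bsub>copower I M\<^esub> x(i := \<zero>\<^bsub>M\<^esub>)"
    unfolding copower_simps
    by (rule copower_ext[OF x copower_add_closed[OF single_closed[OF xi] c]])
      (use copower_mem[OF x] xi in \<open>simp add: single_def\<close>)
qed

text \<open>The images of the coordinate embeddings generate the direct sum: induction over a finite
  set of indices that contains the support.\<close>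

lemma copower_linear_eq_zero:
  assumes Y: "left_module R Y" and p: "linear R (copower I M) Y p"
    and z: "\<And>i m. i \<in> I \<Longrightarrow> m \<in> carrier M \<Longrightarrow> p (single I i m) = \<zero>\<^bsub>Y\<^esub>"
    and x: "x \<in> carrier (copower I M)"
  shows "p x = \<zero>\<^bsub>Y\<^esub>"
proof -
  interpret C: left_module R "copower I M" by (rule left_module_copower)
  interpret CY: two_modules R "copower I M" Y using Y C.left_module_axioms by (simp add: two_modules_def)
  have "p x = \<zero>\<^bsub>Y\<^esub>" if "finite F" "F \<subseteq> I" "x \<in> carrier (copower I M)" "\<And>i. i \<in> I - F \<Longrightarrow> x i = \<zero>\<^bsub>M\<^esub>" for F x
    using that
  proof (induction F arbitrary: x)
    case empty
    have "x = \<zero>\<^bsub>copower I M\<^esub>"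
      by (rule copower_ext[OF empty(2) C.zero_closed]) (use empty in \<open>auto simp: copower_simps\<close>)
    then show ?case using CY.linear_on_zero[OF p C.submodule_carrier] by simp
  next
    case (insert i F)
    have i: "i \<in> I" using insert by auto
    have xi: "x i \<in> carrier M" using copower_mem[OF insert.prems(2) i] .
    have "p x = p (single I i (x i)) \<oplus>\<^bsub>Y\<^esub> p (x(i := \<zero>\<^bsub>M\<^esub>))"
      using linear_on_add[OF p single_closed[OF xi, of I i] copower_split(1)[OF insert.prems(2) i]]
      by (simp flip: copower_split(2)[OF insert.prems(2) i])
    moreover have "p (x(i := \<zero>\<^bsub>M\<^esub>)) = \<zero>\<^bsub>Y\<^esub>"
    proof (rule insert.IH[OF _ copower_split(1)[OF insert.prems(2) i]])
      show "F \<subseteq> I" using insert by auto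
      show "(x(i := \<zero>\<^bsub>M\<^esub>)) l = \<zero>\<^bsub>M\<^esub>" if "l \<in> I - F" for l using insert.prems(3)[of l] that by auto
    qed
    ultimately show ?case using z[OF i xi] by simp
  qed
  moreover have "finite {i\<in>I. x i \<noteq> \<zero>\<^bsub>M\<^esub>}" using x by (simp add: carrier_copower)
  ultimately show ?thesis using x by blast
qed

abbreviation countable_copower :: "('a, nat \<Rightarrow> 'm) module" where
  "countable_copower \<equiv> copower (UNIV :: nat set) M"

text \<open>Subquotients of the countable direct sum are the supply of objects of sigma[M] to which
  the hypotheses on M are applied.\<close>

lemma in_sigma_submodule_quotient:
  assumes W: "submodule W R countable_copower" and K: "submodule K R (quotient_module countable_copower W)"
  shows "in_sigma R M (submodule_as_module (quotient_module countable_copower W) K)"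
proof -
  interpret B: left_module R countable_copower by (rule left_module_copower)
  interpret Q: left_module R "quotient_module countable_copower W" by (rule B.left_module_quotient[OF W])
  \<comment> \<open>A copy of the natural numbers inside the index type demanded by
    \<open>in_sigma\<close>; the fixed first component \<open>undefined\<close> stands for an
    arbitrary element.\<close>
  define I :: "((nat \<Rightarrow> 'm) set \<times> nat) set" where "I = {p. fst p = undefined}"
  interpret C: left_module R "copower I M" by (rule left_module_copower)
  interpret BC: two_modules R countable_copower "copower I M" by unfold_locales
  define \<psi> where "\<psi> x = (\<lambda>p\<in>I. x (snd p))" for x :: "nat \<Rightarrow> 'm"
  have cl: "\<psi> x \<in> carrier (copower I M)" if "x \<in> carrier countable_copower" for x
  proof -
    have "{p\<in>I. \<psi> x p \<noteq> \<zero>\<^bsub>M\<^esub>} \<subseteq> Pair undefined ` {n. x n \<noteq> \<zero>\<^bsub>M\<^esub>}"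
      by (auto simp: \<psi>_def I_def)
    moreover have "finite {n. x n \<noteq> \<zero>\<^bsub>M\<^esub>}" using that by (simp add: carrier_copower)
    ultimately have "finite {p\<in>I. \<psi> x p \<noteq> \<zero>\<^bsub>M\<^esub>}" by (meson finite_imageI finite_subset)
    then show ?thesis using that by (auto simp: carrier_copower \<psi>_def)
  qed
  have lin: "linear R countable_copower (copower I M) \<psi>"
    by (rule linear_onI) (use cl in \<open>auto simp: \<psi>_def copower_simps intro!: restrict_ext\<close>)
  have inj: "inj_on \<psi> (carrier countable_copower)"
  proof (rule inj_onI)
    fix x y assume xy: "x \<in> carrier countable_copower" "y \<in> carrier countable_copower" "\<psi> x = \<psi> y"
    have "x n = y n" for n
      using fun_cong[OF xy(3), of "(undefined, n)"] by (simp add: \<psi>_def I_def)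
    then show "x = y" by auto
  qed
  define U where "U = \<psi> ` W"
  have U: "submodule U R (copower I M)"
    unfolding U_def
    by (rule BC.submodule_image[OF linear_on_subset[OF lin B.submodule_subset[OF W]] W])
  have Uq: "left_module R (quotient_module (copower I M) U)" by (rule C.left_module_quotient[OF U])
  have l2: "linear R countable_copower (quotient_module (copower I M) U) (\<lambda>x. U +>\<^bsub>copower I M\<^esub> \<psi> x)"
    by (rule linear_comp[OF lin C.linear_coset[OF U]])
  have "U +>\<^bsub>copower I M\<^esub> \<psi> x = \<zero>\<^bsub>quotient_module (copower I M) U\<^esub>" if "x \<in> W" for x
    using C.coset_eq_zero_iff[OF U cl] B.submodule_mem[OF W that] that by (auto simp: U_def)
  then obtain g where g: "linear R (quotient_module countable_copower W) (quotient_module (copower I M) U) g"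
    "\<And>x. x \<in> carrier countable_copower \<Longrightarrow> g (W +>\<^bsub>countable_copower\<^esub> x) = U +>\<^bsub>copower I M\<^esub> \<psi> x"
    using B.linear_from_quotient[OF Uq W l2] by blast
  interpret QU: two_modules R "quotient_module countable_copower W" "quotient_module (copower I M) U"
    using Uq Q.left_module_axioms by (simp add: two_modules_def)
  have injg: "inj_on g (carrier (quotient_module countable_copower W))"
    unfolding QU.inj_on_iff_kernel[OF g(1) Q.submodule_carrier]
  proof (intro ballI impI)
    fix X assume "X \<in> carrier (quotient_module countable_copower W)" and gX: "g X = \<zero>\<^bsub>quotient_module (copower I M) U\<^esub>"
    then obtain x where x: "x \<in> carrier countable_copower" "X = W +>\<^bsub>countable_copower\<^esub> x"
      using B.coset_mem_quotient[OF W] by blast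
    then have "\<psi> x \<in> U" using gX g(2) C.coset_eq_zero_iff[OF U cl] by auto
    then have "x \<in> W" using inj x(1) B.submodule_subset[OF W] unfolding U_def
      by (meson inj_on_image_mem_iff)
    then show "X = \<zero>\<^bsub>quotient_module countable_copower W\<^esub>"
      using B.coset_eq_zero_iff[OF W x(1)] x(2) by simp
  qed
  let ?N = "submodule_as_module (quotient_module countable_copower W) K"
  have Km: "K \<subseteq> carrier (quotient_module countable_copower W)" using Q.submodule_subset[OF K] .
  have N: "left_module R ?N" by (rule left_module_submodule_as_module[OF Q.left_module_axioms K])
  interpret NU: two_modules R ?N "quotient_module (copower I M) U"
    using Uq N by (simp add: two_modules_def)
  have "linear R ?N (quotient_module (copower I M) U) g"
    using linear_on_subset[OF g(1) Km] by (simp add: linear_on_submodule_as_module)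
  then have "restrict g (carrier ?N) \<in> Hom R ?N (quotient_module (copower I M) U)" by (rule NU.Hom_restrict)
  moreover have "inj_on (restrict g (carrier ?N)) (carrier ?N)"
    using inj_on_subset[OF injg Km] by (simp add: inj_on_def)
  ultimately show ?thesis unfolding in_sigma_def using N U by blast
qed

text \<open>Represent \<open>x\<close> by a family of finite support and renumber the support by
  natural numbers. Everything that kills the resulting \<open>y\<close> kills \<open>x\<close>, so
  the cyclic module of \<open>x\<close> is a quotient of a cyclic submodule of the countable direct
  sum.\<close>

lemma in_sigma_cyclic:
  fixes X :: "('a, 'x) module"
  assumes X: "in_sigma R M X" and x: "x \<in> carrier X"
  obtains y where "y \<in> carrier countable_copower"
    "\<And>r. r \<in> carrier R \<Longrightarrow> r \<odot>\<^bsub>countable_copower\<^esub> y = \<zero>\<^bsub>countable_copower\<^esub> \<Longrightarrow> r \<odot>\<^bsub>X\<^esub> x = \<zero>\<^bsub>X\<^esub>"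
proof -
  obtain I :: "('x \<times> nat) set" and U j where U: "submodule U R (copower I M)"
    and j: "j \<in> Hom R X (quotient_module (copower I M) U)" "inj_on j (carrier X)" and Xm: "left_module R X"
    using X unfolding in_sigma_def by blast
  interpret X: left_module R X by fact
  interpret C: left_module R "copower I M" by (rule left_module_copower)
  have Q: "left_module R (quotient_module (copower I M) U)" by (rule C.left_module_quotient[OF U])
  interpret XQ: two_modules R X "quotient_module (copower I M) U" using Xm Q by (simp add: two_modules_def)
  have "j x \<in> carrier (quotient_module (copower I M) U)" using Hom_closed[OF j(1) x] .
  then obtain z where z: "z \<in> carrier (copower I M)" "j x = U +>\<^bsub>copower I M\<^esub> z"
    using C.coset_mem_quotient[OF U] by blast
  define F where "F = {i\<in>I. z i \<noteq> \<zero>\<^bsub>M\<^esub>}"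
  have "finite F" using z(1) by (simp add: F_def carrier_copower)
  then obtain e where e: "bij_betw e {0..<card F} F" using ex_bij_betw_nat_finite by blast
  define y where "y n = (if n < card F then z (e n) else \<zero>\<^bsub>M\<^esub>)" for n
  have eF: "e n \<in> F" if "n < card F" for n using e that by (auto simp: bij_betw_def)
  have "finite {n. y n \<noteq> \<zero>\<^bsub>M\<^esub>}" by (rule finite_subset[of _ "{..<card F}"]) (auto simp: y_def)
  moreover have "y n \<in> carrier M" for n using copower_mem[OF z(1)] eF by (auto simp: y_def F_def)
  ultimately have y: "y \<in> carrier countable_copower" by (auto simp: carrier_copower)
  moreover have "r \<odot>\<^bsub>X\<^esub> x = \<zero>\<^bsub>X\<^esub>"
    if r: "r \<in> carrier R" and ry: "r \<odot>\<^bsub>countable_copower\<^esub> y = \<zero>\<^bsub>countable_copower\<^esub>" for r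
  proof -
    have ryn: "r \<odot>\<^bsub>M\<^esub> y n = \<zero>\<^bsub>M\<^esub>" for n
      using fun_cong[OF ry, of n] by (simp add: copower_simps)
    have rzi: "r \<odot>\<^bsub>M\<^esub> z i = \<zero>\<^bsub>M\<^esub>" if i: "i \<in> I" for i
    proof (cases "i \<in> F")
      case True
      then obtain n where n: "n < card F" "i = e n" using e unfolding bij_betw_def by (metis atLeastLessThan_iff imageE)
      then show ?thesis using ryn[of n] by (simp add: y_def)
    qed (use i r in \<open>auto simp: F_def smult_r_null\<close>)
    have "r \<odot>\<^bsub>copower I M\<^esub> z = \<zero>\<^bsub>copower I M\<^esub>"
      unfolding copower_simps by (rule restrict_ext) (rule rzi)
    then have "j (r \<odot>\<^bsub>X\<^esub> x) = \<zero>\<^bsub>quotient_module (copower I M) U\<^esub>"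
      using linear_on_smult[OF linear_Hom[OF j(1)] r x] z C.coset_smult[OF U r z(1)] C.coset_zero[OF U] by simp
    then show ?thesis
      using XQ.inj_on_iff_kernel[OF linear_Hom[OF j(1)] X.submodule_carrier] j(2) r x by simp
  qed
  ultimately show ?thesis using that by blast
qed

text \<open>Submodules of the countable direct sum, moved along \<open>z \<mapsto> {z}\<close> to the carrier type over which
  \<^const>\<open>generator_in_sigma\<close>, \<^const>\<open>projective_in_sigma\<close> and \<^const>\<open>injective_in_sigma\<close> quantify.\<close>

definition sigma_copy :: "(nat \<Rightarrow> 'm) set \<Rightarrow> ('a, 'm sigma_obj) module" where
  "sigma_copy C = submodule_as_module (quotient_module countable_copower {\<zero>\<^bsub>countable_copower\<^esub>})
     ((\<lambda>z. {\<zero>\<^bsub>countable_copower\<^esub>} +>\<^bsub>countable_copower\<^esub> z) ` C)"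

definition to_copy :: "(nat \<Rightarrow> 'm) \<Rightarrow> 'm sigma_obj" where
  "to_copy z = {\<zero>\<^bsub>countable_copower\<^esub>} +>\<^bsub>countable_copower\<^esub> z"

lemma to_copy:
  assumes C: "submodule C R countable_copower"
  shows "in_sigma R M (sigma_copy C)" "carrier (sigma_copy C) = to_copy ` C"
    "inj_on to_copy C" "linear_on R countable_copower C (sigma_copy C) to_copy"
    "left_module R (sigma_copy C)"
proof -
  interpret B: left_module R countable_copower by (rule left_module_copower)
  note Z = B.submodule_zero_set
  let ?Q = "quotient_module countable_copower {\<zero>\<^bsub>countable_copower\<^esub>}"
  interpret BQ: two_modules R countable_copower ?Q
    using B.left_module_quotient[OF Z] B.left_module_axioms by (simp add: two_modules_def)
  have lin: "linear R countable_copower ?Q to_copy"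
    unfolding to_copy_def by (rule B.linear_coset[OF Z])
  have sc: "sigma_copy C = submodule_as_module ?Q (to_copy ` C)"
    unfolding sigma_copy_def to_copy_def ..
  have linC: "linear_on R countable_copower C ?Q to_copy"
    by (rule linear_on_subset[OF lin B.submodule_subset[OF C]])
  have K: "submodule (to_copy ` C) R ?Q"
    by (rule BQ.submodule_image[OF linC C])
  show "in_sigma R M (sigma_copy C)" unfolding sc by (rule in_sigma_submodule_quotient[OF Z K])
  show "carrier (sigma_copy C) = to_copy ` C" unfolding sc by simp
  show "left_module R (sigma_copy C)" unfolding sc
    by (rule left_module_submodule_as_module[OF BQ.Y.left_module_axioms K])
  show "inj_on to_copy C"
    unfolding BQ.inj_on_iff_kernel[OF linC C]
    using B.coset_eq_zero_iff[OF Z] B.submodule_mem[OF C] unfolding to_copy_def by blast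
  show "linear_on R countable_copower C (sigma_copy C) to_copy"
    unfolding sc using linC by (auto simp: linear_on_def)
qed

definition from_copy where "from_copy C = inv_into C to_copy"

lemma from_copy:
  assumes C: "submodule C R countable_copower"
  shows "linear R (sigma_copy C) countable_copower (from_copy C)"
    "\<And>z. z \<in> C \<Longrightarrow> from_copy C (to_copy z) = z" "from_copy C ` carrier (sigma_copy C) = C"
proof -
  interpret BC: two_modules R countable_copower "sigma_copy C"
    using to_copy(5)[OF C] left_module_copower by (simp add: two_modules_def)
  show "linear R (sigma_copy C) countable_copower (from_copy C)"
    unfolding from_copy_def to_copy(2)[OF C]
    by (rule BC.linear_on_inv_into[OF to_copy(4)[OF C] C to_copy(3)[OF C]])
  show "\<And>z. z \<in> C \<Longrightarrow> from_copy C (to_copy z) = z"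
    unfolding from_copy_def using to_copy(3)[OF C] by (rule inv_into_f_f)
  show "from_copy C ` carrier (sigma_copy C) = C"
    unfolding from_copy_def to_copy(2)[OF C] using to_copy(3)[OF C] by (simp add: image_image)
qed

text \<open>Carries the generator property over to objects of any carrier type. The cyclic module of
  \<open>x\<close> is an image of a cyclic submodule of the countable direct sum, whose copy is
  generated by M, so \<open>x\<close> is reached from a direct sum of copies of M. A map that is
  nonzero at \<open>x\<close> is then nonzero on one of the summands.\<close>

theorem generator_detects:
  assumes gen: "generator_in_sigma R M" and X: "in_sigma R M X" and L: "submodule L R X"
    and Y: "left_module R Y" and f: "linear_on R X L Y f" and x: "x \<in> L" and fx: "f x \<noteq> \<zero>\<^bsub>Y\<^esub>"
  obtains g m where "linear R M X g" "g ` carrier M \<subseteq> L" "m \<in> carrier M" "f (g m) \<noteq> \<zero>\<^bsub>Y\<^esub>"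
proof -
  have Xm: "left_module R X" using X by (simp add: in_sigma_def)
  interpret X: left_module R X by fact
  interpret B: left_module R countable_copower by (rule left_module_copower)
  interpret BX: two_modules R countable_copower X by unfold_locales
  obtain y where y: "y \<in> carrier countable_copower"
    "\<And>r. r \<in> carrier R \<Longrightarrow> r \<odot>\<^bsub>countable_copower\<^esub> y = \<zero>\<^bsub>countable_copower\<^esub> \<Longrightarrow> r \<odot>\<^bsub>X\<^esub> x = \<zero>\<^bsub>X\<^esub>"
    using in_sigma_cyclic[OF X X.submodule_mem[OF L x]] by blast
  obtain \<psi> where \<psi>: "linear_on R countable_copower (B.cyclic y) X \<psi>"
    "\<And>r. r \<in> carrier R \<Longrightarrow> \<psi> (r \<odot>\<^bsub>countable_copower\<^esub> y) = r \<odot>\<^bsub>X\<^esub> x"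
    using BX.linear_on_cyclic[OF y(1) X.submodule_mem[OF L x] y(2)] by blast
  have C: "submodule (B.cyclic y) R countable_copower" by (rule B.submodule_cyclic[OF y(1)])
  have \<psi>L: "\<psi> ` B.cyclic y \<subseteq> L"
    using \<psi>(2) X.submodule_smult[OF L _ x] by (auto simp: B.cyclic_def)
  have \<psi>y: "\<psi> y = x" using \<psi>(2)[of "\<one>\<^bsub>R\<^esub>"] y(1) X.submodule_mem[OF L x] by simp
  let ?N = "sigma_copy (B.cyclic y)"
  have "generated_by R M ?N" using gen to_copy(1)[OF C] unfolding generator_in_sigma_def by blast
  then obtain I :: "('m sigma_obj \<times> nat) set" and p
    where p: "p \<in> Hom R (copower I M) ?N" "p ` carrier (copower I M) = carrier ?N"
    unfolding generated_by_def by blast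
  define h where "h w = \<psi> (from_copy (B.cyclic y) (p w))" for w
  have l1: "linear R (copower I M) countable_copower (\<lambda>w. from_copy (B.cyclic y) (p w))"
    by (rule linear_comp[OF linear_Hom[OF p(1)] from_copy(1)[OF C]])
  have im1: "(\<lambda>w. from_copy (B.cyclic y) (p w)) ` carrier (copower I M) \<subseteq> B.cyclic y"
    using from_copy(3)[OF C] p(2) by blast
  have h: "linear R (copower I M) X h"
    unfolding h_def by (rule linear_on_comp[OF l1 \<psi>(1) im1])
  have hL: "h w \<in> L" if "w \<in> carrier (copower I M)" for w
    unfolding h_def using im1 \<psi>L that by blast
  have "to_copy y \<in> carrier ?N" using to_copy(2)[OF C] B.cyclic_self[OF y(1)] by blast
  then have "to_copy y \<in> p ` carrier (copower I M)" unfolding p(2) .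
  then obtain w where w: "w \<in> carrier (copower I M)" "p w = to_copy y" by (elim imageE) blast
  have hw: "h w = x" unfolding h_def w(2) from_copy(2)[OF C B.cyclic_self[OF y(1)]] by (rule \<psi>y)
  have fh: "linear R (copower I M) Y (\<lambda>w. f (h w))"
    by (rule linear_on_comp[OF h f]) (use hL in blast)
  have "\<exists>i m. i \<in> I \<and> m \<in> carrier M \<and> f (h (single I i m)) \<noteq> \<zero>\<^bsub>Y\<^esub>"
    using copower_linear_eq_zero[OF Y fh _ w(1)] hw fx by blast
  then obtain i m where im: "i \<in> I" "m \<in> carrier M" "f (h (single I i m)) \<noteq> \<zero>\<^bsub>Y\<^esub>" by blast
  show ?thesis
  proof (rule that[OF _ _ im(2)])
    show "linear R M X (\<lambda>m. h (single I i m))" by (rule linear_comp[OF linear_single h])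
    show "(\<lambda>m. h (single I i m)) ` carrier M \<subseteq> L" by (intro image_subsetI hL single_closed)
  qed (rule im(3))
qed

text \<open>One step of Baer's argument. The extension problem is pulled back from Rx to a cyclic
  submodule Ry of the countable direct sum, whose submodules have copies among the test objects of
  \<open>injective_in_sigma\<close>. There it is solved, and the solution descends to Rx.\<close>

lemma injective_extend_cyclic:
  assumes inj: "injective_in_sigma R M Y" and X: "in_sigma R M X" and D: "submodule D R X"
    and h: "linear_on R X D Y h" and x: "x \<in> carrier X"
  obtains g where "linear_on R X (left_module.cyclic R X x) Y g"
    "\<And>z. z \<in> D \<Longrightarrow> z \<in> left_module.cyclic R X x \<Longrightarrow> g z = h z"
proof -
  have Xm: "left_module R X" using X by (simp add: in_sigma_def)
  have Ym: "left_module R Y" using inj by (simp add: injective_in_sigma_def in_sigma_def)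
  interpret XY: two_modules R X Y using Xm Ym by (simp add: two_modules_def)
  interpret B: left_module R countable_copower by (rule left_module_copower)
  interpret BX: two_modules R countable_copower X by unfold_locales
  obtain y where y: "y \<in> carrier countable_copower"
    "\<And>r. r \<in> carrier R \<Longrightarrow> r \<odot>\<^bsub>countable_copower\<^esub> y = \<zero>\<^bsub>countable_copower\<^esub> \<Longrightarrow> r \<odot>\<^bsub>X\<^esub> x = \<zero>\<^bsub>X\<^esub>"
    using in_sigma_cyclic[OF X x] by blast
  obtain \<psi> where \<psi>: "linear_on R countable_copower (B.cyclic y) X \<psi>"
    "\<And>r. r \<in> carrier R \<Longrightarrow> \<psi> (r \<odot>\<^bsub>countable_copower\<^esub> y) = r \<odot>\<^bsub>X\<^esub> x"
    using BX.linear_on_cyclic[OF y(1) x y(2)] by blast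
  have C: "submodule (B.cyclic y) R countable_copower" by (rule B.submodule_cyclic[OF y(1)])
  \<comment> \<open>The preimage of D in Ry, which is the domain of the pulled-back map.\<close>
  define A where "A = {z \<in> B.cyclic y. \<psi> z \<in> D}"
  have A: "submodule A R countable_copower" unfolding A_def by (rule BX.submodule_preimage[OF \<psi>(1) C D])
  have AC: "A \<subseteq> B.cyclic y" by (auto simp: A_def)
  let ?A = "sigma_copy A" and ?C = "sigma_copy (B.cyclic y)"
  interpret AC: two_modules R ?A ?C using to_copy(5)[OF A] to_copy(5)[OF C] by (simp add: two_modules_def)
  interpret AY: two_modules R ?A Y using to_copy(5)[OF A] Ym by (simp add: two_modules_def)
  have f: "linear R ?A ?C (\<lambda>z. z)"
  proof -
    have "carrier ?A \<subseteq> carrier ?C" using AC by (auto simp: to_copy(2)[OF A] to_copy(2)[OF C])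
    moreover have "add ?A = add ?C" "smult ?A = smult ?C" by (simp_all add: sigma_copy_def)
    ultimately show ?thesis by (auto simp: linear_on_def)
  qed
  have l1: "linear R ?A X (\<lambda>z. \<psi> (from_copy A z))"
    by (rule linear_on_comp[OF from_copy(1)[OF A] \<psi>(1)]) (use from_copy(3)[OF A] AC in blast)
  have l2: "linear R ?A Y (\<lambda>z. h (\<psi> (from_copy A z)))"
    by (rule linear_on_comp[OF l1 h]) (use from_copy(3)[OF A] in \<open>auto simp: A_def\<close>)
  have inj': "inj_on (restrict (\<lambda>z. z) (carrier ?A)) (carrier ?A)" by (simp add: inj_on_def)
  obtain k where k: "k \<in> Hom R ?C Y"
    "compose (carrier ?A) k (restrict (\<lambda>z. z) (carrier ?A)) = restrict (\<lambda>z. h (\<psi> (from_copy A z))) (carrier ?A)"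
    using inj to_copy(1)[OF A] to_copy(1)[OF C] AC.Hom_restrict[OF f] inj' AY.Hom_restrict[OF l2]
    unfolding injective_in_sigma_def by blast
  have kA: "k (to_copy z) = h (\<psi> z)" if "z \<in> A" for z
  proof -
    have "to_copy z \<in> carrier ?A" using that to_copy(2)[OF A] by blast
    then show ?thesis using fun_cong[OF k(2), of "to_copy z"] from_copy(2)[OF A that] by (simp add: compose_def)
  qed
  have yC: "y \<in> B.cyclic y" by (rule B.cyclic_self[OF y(1)])
  have tyC: "to_copy y \<in> carrier ?C" using yC to_copy(2)[OF C] by blast
  have kr: "k (to_copy (r \<odot>\<^bsub>countable_copower\<^esub> y)) = r \<odot>\<^bsub>Y\<^esub> k (to_copy y)" if "r \<in> carrier R" for r
    using linear_on_smult[OF to_copy(4)[OF C] that yC] linear_on_smult[OF linear_Hom[OF k(1)] that tyC] by simp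
  have rC: "r \<odot>\<^bsub>countable_copower\<^esub> y \<in> B.cyclic y" if "r \<in> carrier R" for r
    using that by (auto simp: B.cyclic_def)
  \<comment> \<open>If \<open>r\<close> annihilates \<open>x\<close>, the right-hand side is h 0 =
    0; this is what lets the extension descend from Ry to Rx.\<close>
  have rA: "r \<odot>\<^bsub>Y\<^esub> k (to_copy y) = h (r \<odot>\<^bsub>X\<^esub> x)" if "r \<in> carrier R" "r \<odot>\<^bsub>X\<^esub> x \<in> D" for r
  proof -
    have "r \<odot>\<^bsub>countable_copower\<^esub> y \<in> A" unfolding A_def using rC that \<psi>(2) by simp
    then show ?thesis using kA kr \<psi>(2) that by metis
  qed
  have "r \<odot>\<^bsub>Y\<^esub> k (to_copy y) = \<zero>\<^bsub>Y\<^esub>" if "r \<in> carrier R" "r \<odot>\<^bsub>X\<^esub> x = \<zero>\<^bsub>X\<^esub>" for r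
    using rA[OF that(1)] that XY.X.submodule_zero[OF D] XY.linear_on_zero[OF h D] by simp
  then obtain g where g: "linear_on R X (XY.X.cyclic x) Y g" "\<And>r. r \<in> carrier R \<Longrightarrow> g (r \<odot>\<^bsub>X\<^esub> x) = r \<odot>\<^bsub>Y\<^esub> k (to_copy y)"
    using XY.linear_on_cyclic[OF x Hom_closed[OF k(1) tyC]] by blast
  show ?thesis
    by (rule that[OF g(1)]) (use g(2) rA in \<open>auto simp: XY.X.cyclic_def\<close>)
qed

end

text \<open>Zorn's lemma gives a maximal partial extension of \<open>h\<close>. If some
  \<open>x\<close> lay outside its domain, the cyclic step could be glued to it, so the domain is
  everything.\<close>

theorem (in left_module) injective_extend:
  fixes X :: "('a, 'x) module" and Y :: "('a, 'y) module"
  assumes inj: "injective_in_sigma R M Y" and X: "in_sigma R M X" and D: "submodule D R X"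
    and h: "linear_on R X D Y h"
  obtains g where "linear R X Y g" "\<And>z. z \<in> D \<Longrightarrow> g z = h z"
proof -
  have Xm: "left_module R X" using X by (simp add: in_sigma_def)
  have Ym: "left_module R Y" using inj by (simp add: injective_in_sigma_def in_sigma_def)
  interpret XY: two_modules R X Y using Xm Ym by (simp add: two_modules_def)
  \<comment> \<open>Graphs order the partial extensions by inclusion; a pair of domain and function
    would also carry arbitrary values outside the domain.\<close>
  define gr where "gr L f = (\<lambda>x. (x, f x)) ` L" for L :: "'x set" and f :: "'x \<Rightarrow> 'y"
  define E where "E L f \<longleftrightarrow> submodule L R X \<and> linear_on R X L Y f \<and> D \<subseteq> L \<and> (\<forall>z\<in>D. f z = h z)" for L f
  define \<G> where "\<G> = {gr L f |L f. E L f}"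
  have grI: "(x, f x) \<in> gr L f" if "x \<in> L" for x L f using that by (auto simp: gr_def)
  have grD: "x \<in> L \<and> y = f x" if "(x, y) \<in> gr L f" for x y L f using that by (auto simp: gr_def)
  have "gr D h \<in> \<G>" using D h by (auto simp: \<G>_def E_def)
  then have ne: "\<G> \<noteq> {}" by blast
  have "\<exists>G\<in>\<G>. \<forall>H\<in>\<G>. G \<subseteq> H \<longrightarrow> H = G"
  proof (rule subset_Zorn_nonempty[OF ne])
    fix \<C> assume Cne: "\<C> \<noteq> {}" and chain: "subset.chain \<G> \<C>"
    have CG: "\<C> \<subseteq> \<G>" and lin: "\<And>G H. G \<in> \<C> \<Longrightarrow> H \<in> \<C> \<Longrightarrow> G \<subseteq> H \<or> H \<subseteq> G"
      using chain by (auto simp: subset_chain_def)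
    \<comment> \<open>Two elements of the union of the chain already lie in one member, so every
      closure property of the union is inherited from a single partial extension.\<close>
    have common: "\<exists>L f. E L f \<and> gr L f \<in> \<C> \<and> p \<in> gr L f \<and> q \<in> gr L f" if "p \<in> \<Union>\<C>" "q \<in> \<Union>\<C>" for p q
    proof -
      obtain G H where GH: "G \<in> \<C>" "H \<in> \<C>" "p \<in> G" "q \<in> H" using \<open>p \<in> \<Union>\<C>\<close> \<open>q \<in> \<Union>\<C>\<close> by blast
      then obtain K where "K \<in> \<C>" "p \<in> K" "q \<in> K" using lin[of G H] by blast
      then show ?thesis using CG unfolding \<G>_def by blast
    qed
    have fn: "y = y'" if "(x, y) \<in> \<Union>\<C>" "(x, y') \<in> \<Union>\<C>" for x y y'
      using common[OF that] grD by metis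
    define L where "L = fst ` \<Union>\<C>"
    define f where "f x = (THE y. (x, y) \<in> \<Union>\<C>)" for x
    have fI: "f x = y" if "(x, y) \<in> \<Union>\<C>" for x y
      unfolding f_def by (rule the_equality) (use that fn in blast)+
    have inL: "x \<in> L \<longleftrightarrow> (x, f x) \<in> \<Union>\<C>" for x
    proof
      assume "x \<in> L"
      then obtain y where "(x, y) \<in> \<Union>\<C>" unfolding L_def by (metis imageE prod.collapse)
      then show "(x, f x) \<in> \<Union>\<C>" using fI by simp
    next
      assume "(x, f x) \<in> \<Union>\<C>"
      then show "x \<in> L" unfolding L_def by (metis fst_conv imageI)
    qed
    have gre: "gr L f = \<Union>\<C>"
    proof
      show "gr L f \<subseteq> \<Union>\<C>" using inL by (auto simp: gr_def)
      show "\<Union>\<C> \<subseteq> gr L f"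
      proof
        fix p assume p: "p \<in> \<Union>\<C>"
        then have "f (fst p) = snd p" "fst p \<in> L" using fI[of "fst p" "snd p"] by (auto simp: L_def)
        then show "p \<in> gr L f" by (cases p) (auto simp: gr_def)
      qed
    qed
    have key: "\<exists>L' f'. E L' f' \<and> x \<in> L' \<and> y \<in> L' \<and> L' \<subseteq> L \<and> (\<forall>z\<in>L'. f z = f' z)" if xy: "x \<in> L" "y \<in> L" for x y
    proof -
      obtain L' f' where E: "E L' f'" "gr L' f' \<in> \<C>" "(x, f x) \<in> gr L' f'" "(y, f y) \<in> gr L' f'"
        using common xy inL by meson
      have in': "(z, f' z) \<in> \<Union>\<C>" if "z \<in> L'" for z using E(2) grI[OF that] by blast
      have "f z = f' z \<and> z \<in> L" if "z \<in> L'" for z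
        using in'[OF that] fI[OF in'[OF that]] inL[of z] by simp
      then have "\<forall>z\<in>L'. f z = f' z" "L' \<subseteq> L" by blast+
      then show ?thesis using E grD by blast
    qed
    obtain L0 f0 where E0: "E L0 f0" "gr L0 f0 \<in> \<C>" using Cne CG unfolding \<G>_def by blast
    have D0: "D \<subseteq> L" "\<forall>z\<in>D. f z = h z"
    proof -
      have in': "(z, h z) \<in> \<Union>\<C>" if "z \<in> D" for z
        using E0 that grI[of z L0 f0] unfolding E_def by (metis UnionI subsetD)
      have "f z = h z \<and> z \<in> L" if "z \<in> D" for z
        using in'[OF that] fI[OF in'[OF that]] inL[of z] by simp
      then show "D \<subseteq> L" "\<forall>z\<in>D. f z = h z" by blast+
    qed
    have "E L f" unfolding E_def
    proof (intro conjI)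
      show "submodule L R X"
      proof (rule XY.X.submoduleI)
        show "L \<subseteq> carrier X" using key XY.X.submodule_mem unfolding E_def by blast
        show "\<zero>\<^bsub>X\<^esub> \<in> L" using D0 XY.X.submodule_zero[OF D] by blast
        show "x \<oplus>\<^bsub>X\<^esub> y \<in> L" if "x \<in> L" "y \<in> L" for x y
          using key[OF that] XY.X.submodule_add unfolding E_def by blast
        show "r \<odot>\<^bsub>X\<^esub> x \<in> L" if "r \<in> carrier R" "x \<in> L" for r x
          using key[OF that(2) that(2)] XY.X.submodule_smult that(1) unfolding E_def by blast
      qed
      show "linear_on R X L Y f"
      proof (rule linear_onI)
        fix x y assume "x \<in> L" "y \<in> L"
        then obtain L' f' where E: "E L' f'" "x \<in> L'" "y \<in> L'" "\<forall>z\<in>L'. f z = f' z" using key by blast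
        then show "f x \<in> carrier Y" using linear_on_closed unfolding E_def by metis
      next
        fix x y assume "x \<in> L" "y \<in> L"
        then obtain L' f' where E: "E L' f'" "x \<in> L'" "y \<in> L'" "\<forall>z\<in>L'. f z = f' z" using key by blast
        then have "x \<oplus>\<^bsub>X\<^esub> y \<in> L'" using XY.X.submodule_add unfolding E_def by blast
        then show "f (x \<oplus>\<^bsub>X\<^esub> y) = f x \<oplus>\<^bsub>Y\<^esub> f y"
          using E linear_on_add[of R X L' Y f' x y] unfolding E_def by simp
      next
        fix r x assume r: "r \<in> carrier R" and "x \<in> L"
        then obtain L' f' where E: "E L' f'" "x \<in> L'" "\<forall>z\<in>L'. f z = f' z" using key by blast
        then have "r \<odot>\<^bsub>X\<^esub> x \<in> L'" using XY.X.submodule_smult r unfolding E_def by blast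
        then show "f (r \<odot>\<^bsub>X\<^esub> x) = r \<odot>\<^bsub>Y\<^esub> f x"
          using E r linear_on_smult[of R X L' Y f' r x] unfolding E_def by simp
      qed
    qed (rule D0)+
    then show "\<Union>\<C> \<in> \<G>" unfolding \<G>_def gre[symmetric] by blast
  qed
  then obtain G where G: "G \<in> \<G>" "\<And>H. H \<in> \<G> \<Longrightarrow> G \<subseteq> H \<Longrightarrow> H = G" by blast
  then obtain L f where E: "E L f" and GL: "G = gr L f" unfolding \<G>_def by blast
  have max: "gr L' f' = gr L f" if "E L' f'" "gr L f \<subseteq> gr L' f'" for L' f'
    using G(2)[of "gr L' f'"] that unfolding GL \<G>_def by blast
  have L: "submodule L R X" and f: "linear_on R X L Y f" and DL: "D \<subseteq> L" "\<forall>z\<in>D. f z = h z"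
    using E unfolding E_def by auto
  have "carrier X \<subseteq> L"
  proof
    fix x assume x: "x \<in> carrier X"
    have cx: "submodule (XY.X.cyclic x) R X" by (rule XY.X.submodule_cyclic[OF x])
    obtain g where g: "linear_on R X (XY.X.cyclic x) Y g" "\<And>z. z \<in> L \<Longrightarrow> z \<in> XY.X.cyclic x \<Longrightarrow> g z = f z"
      using injective_extend_cyclic[OF inj X L f x] by blast
    obtain k where k: "linear_on R X (XY.X.sum_set L (XY.X.cyclic x)) Y k"
      "\<And>u v. u \<in> L \<Longrightarrow> v \<in> XY.X.cyclic x \<Longrightarrow> k (u \<oplus>\<^bsub>X\<^esub> v) = f u \<oplus>\<^bsub>Y\<^esub> g v"
      using XY.linear_on_glue[OF L cx _ f g(1)] g(2) by metis
    have kL: "k u = f u" if "u \<in> L" for u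
      using k(2)[OF that XY.X.submodule_zero[OF cx]] XY.linear_on_zero[OF g(1) cx]
        XY.X.submodule_mem[OF L that] linear_on_closed[OF f that] by simp
    have sub: "L \<subseteq> XY.X.sum_set L (XY.X.cyclic x)" by (rule XY.X.sum_set_left[OF L cx])
    have "E (XY.X.sum_set L (XY.X.cyclic x)) k"
      unfolding E_def using XY.X.submodule_sum_set[OF L cx] k(1) sub DL kL by auto
    moreover have "gr L f \<subseteq> gr (XY.X.sum_set L (XY.X.cyclic x)) k"
      using sub kL unfolding gr_def by force
    ultimately have "gr (XY.X.sum_set L (XY.X.cyclic x)) k = gr L f" by (rule max)
    moreover have "x \<in> XY.X.sum_set L (XY.X.cyclic x)"
      using XY.X.sum_set_right[OF L cx] XY.X.cyclic_self[OF x] by blast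
    ultimately show "x \<in> L" using grI grD by metis
  qed
  then have "L = carrier X" using XY.X.submodule_subset[OF L] by blast
  then show ?thesis using that f DL by blast
qed

section \<open>Semiprime and nonsingular modules\<close>

context left_module
begin

section \<open>Lifting along maps from the direct sum, and the elementwise form of
  semiprimeness\<close>

lemma linear_component: "linear R countable_copower M (\<lambda>x. x n)"
  by (rule linear_onI) (auto simp: copower_mem copower_simps)

text \<open>With U the kernel of \<open>p\<close>, the direct sum modulo U is the image of
  \<open>p\<close>. So \<open>h\<close> becomes a map into this quotient, and projectivity lifts it
  along the projection. The first two terms of the exact sequence are replaced by copies, to have
  the carrier type required by \<open>projective_in_sigma\<close>.\<close>

lemma projective_lift:
  assumes proj: "projective_in_sigma R M" and p: "linear R countable_copower M p"
    and h: "linear R M M h" and im: "h ` carrier M \<subseteq> p ` carrier countable_copower"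
  obtains k where "linear R M countable_copower k" "\<And>m. m \<in> carrier M \<Longrightarrow> p (k m) = h m"
proof -
  interpret B: left_module R countable_copower by (rule left_module_copower)
  interpret BM: two_modules R countable_copower M by unfold_locales
  define U where "U = {x \<in> carrier countable_copower. p x = \<zero>\<^bsub>M\<^esub>}"
  have U: "submodule U R countable_copower" unfolding U_def by (rule BM.submodule_kernel[OF p B.submodule_carrier])
  have U0: "U \<subseteq> carrier countable_copower" by (rule B.submodule_subset[OF U])
  let ?A = "sigma_copy U" and ?B = "sigma_copy (carrier countable_copower)" and ?C = "quotient_module countable_copower U"
  note cB = B.submodule_carrier
  interpret C: left_module R ?C by (rule B.left_module_quotient[OF U])
  interpret AB: two_modules R ?A ?B using to_copy(5)[OF U] to_copy(5)[OF cB] by (simp add: two_modules_def)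
  interpret BC: two_modules R ?B ?C by unfold_locales
  interpret MC: two_modules R M ?C by unfold_locales
  interpret MB: two_modules R M ?B by unfold_locales
  have sC: "in_sigma R M ?C"
    using in_sigma_submodule_quotient[OF U C.submodule_carrier] by (simp add: submodule_as_module_def)
  have f: "linear R ?A ?B (\<lambda>z. z)"
  proof -
    have "carrier ?A \<subseteq> carrier ?B" using U0 by (auto simp: to_copy(2)[OF U] to_copy(2)[OF cB])
    moreover have "add ?A = add ?B" "smult ?A = smult ?B" by (simp_all add: sigma_copy_def)
    ultimately show ?thesis by (auto simp: linear_on_def)
  qed
  define g where "g X = U +>\<^bsub>countable_copower\<^esub> from_copy (carrier countable_copower) X" for X
  have g: "linear R ?B ?C g" unfolding g_def by (rule linear_comp[OF from_copy(1)[OF cB] B.linear_coset[OF U]])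
  have gt: "g (to_copy x) = U +>\<^bsub>countable_copower\<^esub> x" if "x \<in> carrier countable_copower" for x
    unfolding g_def by (simp add: from_copy(2)[OF cB that])
  let ?f = "restrict (\<lambda>z. z) (carrier ?A)" and ?g = "restrict g (carrier ?B)"
  have "short_exact R ?A ?B ?C ?f ?g"
    unfolding short_exact_def
  proof (intro conjI)
    show "?f \<in> Hom R ?A ?B" by (rule AB.Hom_restrict[OF f])
    show "?g \<in> Hom R ?B ?C" by (rule BC.Hom_restrict[OF g])
    show "inj_on ?f (carrier ?A)" by (simp add: inj_on_def)
    have gz: "?g (to_copy x) = \<zero>\<^bsub>?C\<^esub> \<longleftrightarrow> x \<in> U" if "x \<in> carrier countable_copower" for x
      using that gt[OF that] B.coset_eq_zero_iff[OF U that] by (simp add: to_copy(2)[OF cB])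
    have "a_kernel ?B ?C ?g = {X \<in> to_copy ` carrier countable_copower. ?g X = \<zero>\<^bsub>?C\<^esub>}"
      unfolding a_kernel_def kernel_def by (simp add: to_copy(2)[OF cB])
    also have "\<dots> = to_copy ` U" using gz U0 by blast
    finally show "?f ` carrier ?A = a_kernel ?B ?C ?g" by (simp add: to_copy(2)[OF U])
    have "?g ` carrier ?B = (\<lambda>x. U +>\<^bsub>countable_copower\<^esub> x) ` carrier countable_copower"
      by (simp add: to_copy(2)[OF cB] image_image gt cong: image_cong)
    moreover have "carrier ?C = (\<lambda>x. U +>\<^bsub>countable_copower\<^esub> x) ` carrier countable_copower"
    proof (intro equalityI subsetI)
      fix X assume "X \<in> carrier ?C"
      then show "X \<in> (\<lambda>x. U +>\<^bsub>countable_copower\<^esub> x) ` carrier countable_copower"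
        unfolding B.coset_mem_quotient[OF U] image_iff .
    next
      fix X assume "X \<in> (\<lambda>x. U +>\<^bsub>countable_copower\<^esub> x) ` carrier countable_copower"
      then show "X \<in> carrier ?C"
        unfolding B.coset_mem_quotient[OF U] image_iff .
    qed
    ultimately show "?g ` carrier ?B = carrier ?C" by simp
  qed
  then have sur: "(\<lambda>h. compose (carrier M) ?g h) ` Hom R M ?B = Hom R M ?C"
    using proj to_copy(1)[OF U] to_copy(1)[OF cB] sC unfolding projective_in_sigma_def by blast
  have same: "U +>\<^bsub>countable_copower\<^esub> x = U +>\<^bsub>countable_copower\<^esub> y \<longleftrightarrow> p x = p y"
    if "x \<in> carrier countable_copower" "y \<in> carrier countable_copower" for x y
  proof -
    have "U +>\<^bsub>countable_copower\<^esub> x = U +>\<^bsub>countable_copower\<^esub> y \<longleftrightarrow> p (x \<ominus>\<^bsub>countable_copower\<^esub> y) = \<zero>\<^bsub>M\<^esub>"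
      using B.coset_eq_iff[OF U that] B.submodule_minus[OF cB that] by (simp add: U_def)
    also have "\<dots> \<longleftrightarrow> p x = p y"
      using BM.linear_on_minus[OF p cB that] linear_on_closed[OF p that(1)] linear_on_closed[OF p that(2)]
      by (simp add: minus_zero_eq)
    finally show ?thesis .
  qed
  have "\<forall>m\<in>carrier M. \<exists>x\<in>carrier countable_copower. p x = h m" using im by (metis image_subset_iff imageE)
  \<comment> \<open>\<open>s\<close> picks preimages under \<open>p\<close>; it is additive and
    R-linear only modulo U.\<close>
  then obtain s where s: "\<And>m. m \<in> carrier M \<Longrightarrow> s m \<in> carrier countable_copower \<and> p (s m) = h m" by metis
  have "linear R M ?C (\<lambda>m. U +>\<^bsub>countable_copower\<^esub> s m)"
  proof (rule linear_onI)
    fix x y assume xy: "x \<in> carrier M" "y \<in> carrier M"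
    have "p (s (x \<oplus>\<^bsub>M\<^esub> y)) = p (s x \<oplus>\<^bsub>countable_copower\<^esub> s y)"
      using s xy linear_on_add[OF h xy] by (simp add: linear_on_add[OF p])
    then show "U +>\<^bsub>countable_copower\<^esub> s (x \<oplus>\<^bsub>M\<^esub> y) =
      (U +>\<^bsub>countable_copower\<^esub> s x) \<oplus>\<^bsub>?C\<^esub> (U +>\<^bsub>countable_copower\<^esub> s y)"
      using s xy same by (simp add: B.coset_add[OF U])
  next
    fix r x assume rx: "r \<in> carrier R" "x \<in> carrier M"
    have "p (s (r \<odot>\<^bsub>M\<^esub> x)) = p (r \<odot>\<^bsub>countable_copower\<^esub> s x)"
      using s rx linear_on_smult[OF h rx] by (simp add: linear_on_smult[OF p])
    then show "U +>\<^bsub>countable_copower\<^esub> s (r \<odot>\<^bsub>M\<^esub> x) = r \<odot>\<^bsub>?C\<^esub> (U +>\<^bsub>countable_copower\<^esub> s x)"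
      using s rx same by (simp add: B.coset_smult[OF U])
  qed (use s B.coset_closed[OF U] in blast)
  then have "restrict (\<lambda>m. U +>\<^bsub>countable_copower\<^esub> s m) (carrier M) \<in> Hom R M ?C" by (rule MC.Hom_restrict)
  then obtain k where k: "k \<in> Hom R M ?B"
    "compose (carrier M) ?g k = restrict (\<lambda>m. U +>\<^bsub>countable_copower\<^esub> s m) (carrier M)"
    unfolding sur[symmetric] by (metis (no_types, lifting) imageE)
  show ?thesis
  proof (rule that)
    show "linear R M countable_copower (\<lambda>m. from_copy (carrier countable_copower) (k m))"
      by (rule linear_comp[OF linear_Hom[OF k(1)] from_copy(1)[OF cB]])
    fix m assume m: "m \<in> carrier M"
    have km: "k m \<in> carrier ?B" by (rule Hom_closed[OF k(1) m])
    have fk: "from_copy (carrier countable_copower) (k m) \<in> carrier countable_copower"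
      by (rule linear_on_closed[OF from_copy(1)[OF cB] km])
    have "g (k m) = U +>\<^bsub>countable_copower\<^esub> s m"
      using fun_cong[OF k(2), of m] m km by (simp add: compose_def)
    then show "p (from_copy (carrier countable_copower) (k m)) = h m"
      unfolding g_def using same[OF fk] s[OF m] by simp
  qed
qed

text \<open>Splitting the index set into even and odd numbers turns the sum of two maps from the countable
  direct sum into one such map.\<close>

definition even_part where "even_part x = (\<lambda>n. x (2 * n))" for x :: "nat \<Rightarrow> 'm"
definition odd_part where "odd_part x = (\<lambda>n. x (2 * n + 1))" for x :: "nat \<Rightarrow> 'm"

lemma linear_reindex:
  assumes "inj e" shows "linear R countable_copower countable_copower (\<lambda>x n. x (e n))"
proof (rule linear_onI)
  fix x assume x: "x \<in> carrier countable_copower"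
  have "{n. x (e n) \<noteq> \<zero>\<^bsub>M\<^esub>} = e -` {n. x n \<noteq> \<zero>\<^bsub>M\<^esub>}" by auto
  moreover have "finite (e -` {n. x n \<noteq> \<zero>\<^bsub>M\<^esub>})" using x assms by (intro finite_vimageI) (simp_all add: carrier_copower)
  ultimately have "finite {n. x (e n) \<noteq> \<zero>\<^bsub>M\<^esub>}" by simp
  then show "(\<lambda>n. x (e n)) \<in> carrier countable_copower" using copower_mem[OF x] by (auto simp: carrier_copower)
qed (simp_all add: copower_simps restrict_def)

lemma interleave:
  assumes x: "x \<in> carrier countable_copower" and y: "y \<in> carrier countable_copower"
  obtains z where "z \<in> carrier countable_copower" "even_part z = x" "odd_part z = y"
proof -
  define z where "z n = (if even n then x (n div 2) else y (n div 2))" for n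
  have "{n. z n \<noteq> \<zero>\<^bsub>M\<^esub>} \<subseteq> (\<lambda>n. 2 * n) ` {n. x n \<noteq> \<zero>\<^bsub>M\<^esub>} \<union> (\<lambda>n. 2 * n + 1) ` {n. y n \<noteq> \<zero>\<^bsub>M\<^esub>}"
  proof
    fix n assume "n \<in> {n. z n \<noteq> \<zero>\<^bsub>M\<^esub>}"
    then show "n \<in> (\<lambda>n. 2 * n) ` {n. x n \<noteq> \<zero>\<^bsub>M\<^esub>} \<union> (\<lambda>n. 2 * n + 1) ` {n. y n \<noteq> \<zero>\<^bsub>M\<^esub>}"
      by (cases "even n") (auto simp: z_def elim!: evenE oddE)
  qed
  moreover have "finite \<dots>" using x y by (simp add: carrier_copower)
  ultimately have "finite {n. z n \<noteq> \<zero>\<^bsub>M\<^esub>}" by (rule finite_subset)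
  then have "z \<in> carrier countable_copower" using copower_mem[OF x] copower_mem[OF y] by (auto simp: carrier_copower z_def)
  moreover have "even_part z = x" "odd_part z = y" by (auto simp: even_part_def odd_part_def z_def)
  ultimately show ?thesis using that by blast
qed

text \<open>Suppose f g f = 0 for all g. The images of all g f generate a fully invariant submodule
  K, nonzero since f is, so semiprimeness gives h from M to K that does not vanish on K. By finite
  generation the image of h lies in the image of a single map p from the direct sum that depends on
  the coordinates only through f, and projectivity lifts h through p. On the elements g (f m) the
  coordinates of the lift are killed by f, so h vanishes there: a contradiction.\<close>

lemma semiprime_endomorphism:
  assumes fg: "finitely_generated_module R M" and proj: "projective_in_sigma R M"
    and semi: "semiprime_module R M"
    and f: "linear R M M f" and m0: "m0 \<in> carrier M" "f m0 \<noteq> \<zero>\<^bsub>M\<^esub>"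
  shows "\<exists>g m. linear R M M g \<and> m \<in> carrier M \<and> f (g (f m)) \<noteq> \<zero>\<^bsub>M\<^esub>"
proof (rule ccontr)
  assume "\<not> ?thesis"
  then have fgf: "f (g (f m)) = \<zero>\<^bsub>M\<^esub>" if "linear R M M g" "m \<in> carrier M" for g m using that by blast
  interpret B: left_module R countable_copower by (rule left_module_copower)
  interpret BM: two_modules R countable_copower M by unfold_locales
  interpret MB: two_modules R M countable_copower by unfold_locales
  interpret MM: two_modules R M M by unfold_locales
  define G where "G = {g (f m) |g m. linear R M M g \<and> m \<in> carrier M}"
  define K where "K = submodule_generated R M G"
  have Gc: "G \<subseteq> carrier M" using linear_on_closed[OF f] linear_on_closed by (fastforce simp: G_def)
  have K: "submodule K R M" unfolding K_def by (rule submodule_submodule_generated[OF Gc])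
  have GK: "G \<subseteq> K" unfolding K_def by (rule submodule_generated_incl)
  have K_least: "K \<subseteq> L" if "submodule L R M" "G \<subseteq> L" for L
    unfolding K_def using that by (rule submodule_generated_least)
  have FI: "fully_invariant R M K" unfolding fully_invariant_def
  proof (intro conjI K ballI)
    fix u assume "u \<in> Hom R M M"
    then have u: "linear R M M u" by (rule linear_Hom)
    have "G \<subseteq> {z \<in> carrier M. u z \<in> K}"
    proof
      fix z assume "z \<in> G"
      then obtain g m where gm: "linear R M M g" "m \<in> carrier M" "z = g (f m)" by (auto simp: G_def)
      have "u z \<in> G" unfolding G_def gm(3) mem_Collect_eq
        by (intro exI[of _ "\<lambda>x. u (g x)"] exI[of _ m] conjI refl linear_comp[OF gm(1) u] gm(2))
      then show "z \<in> {z \<in> carrier M. u z \<in> K}" using Gc GK \<open>z \<in> G\<close> by auto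
    qed
    then show "u ` K \<subseteq> K" using K_least[OF MM.submodule_preimage[OF u submodule_carrier K]] by blast
  qed
  have "linear R M M (\<lambda>x. x)" by (simp add: linear_on_def)
  then have "f m0 \<in> K" using GK m0(1) unfolding G_def by blast
  then have "K \<noteq> {\<zero>\<^bsub>M\<^esub>}" using m0(2) by blast
  then have prod: "submodule_prod R M K K \<noteq> {\<zero>\<^bsub>M\<^esub>}" using semi FI unfolding semiprime_module_def by blast
  have "\<exists>h\<in>Hom R M (submodule_as_module M K). \<exists>z\<in>K. h z \<noteq> \<zero>\<^bsub>M\<^esub>"
  proof (rule ccontr)
    assume "\<not> ?thesis"
    then have "(\<Union>h\<in>Hom R M (submodule_as_module M K). h ` K) \<subseteq> {\<zero>\<^bsub>M\<^esub>}" by blast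
    then have "submodule_prod R M K K \<subseteq> {\<zero>\<^bsub>M\<^esub>}"
      unfolding submodule_prod_def by (rule submodule_generated_least[OF submodule_zero_set])
    moreover have "\<zero>\<^bsub>M\<^esub> \<in> submodule_prod R M K K"
      unfolding submodule_prod_def submodule_generated_def by (auto simp: submodule_zero)
    ultimately show False using prod by blast
  qed
  then obtain h z where h0: "h \<in> Hom R M (submodule_as_module M K)" and z: "z \<in> K" "h z \<noteq> \<zero>\<^bsub>M\<^esub>" by blast
  have "linear R M M h \<and> h ` carrier M \<subseteq> K"
    using linear_Hom[OF h0] by (simp only: linear_on_into_submodule_as_module[OF K left_module_axioms])
  then have h: "linear R M M h" and hK: "h ` carrier M \<subseteq> K" by simp_all
  have "\<not> K \<subseteq> {x \<in> carrier M. h x = \<zero>\<^bsub>M\<^esub>}" using z by blast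
  then obtain g m where g: "linear R M M g" and m: "m \<in> carrier M" and hgf: "h (g (f m)) \<noteq> \<zero>\<^bsub>M\<^esub>"
    using K_least[OF MM.submodule_kernel[OF h submodule_carrier]] Gc unfolding G_def by blast
  \<comment> \<open>The maps in T stand for finite sums of maps g f applied to the coordinates: a
    family whose coordinates all lie in the kernel of f is sent to zero.\<close>
  define T where "T = {p. linear R countable_copower M p \<and>
    (\<forall>x\<in>carrier countable_copower. (\<forall>n. f (x n) = \<zero>\<^bsub>M\<^esub>) \<longrightarrow> p x = \<zero>\<^bsub>M\<^esub>)}"
  \<comment> \<open>T is directed by images: let p act on the even coordinates and q on the odd
    ones.\<close>
  have join: "\<exists>t\<in>T. p ` carrier countable_copower \<union> q ` carrier countable_copower \<subseteq> t ` carrier countable_copower \<and>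
      (\<forall>u\<in>p ` carrier countable_copower. \<forall>v\<in>q ` carrier countable_copower. u \<oplus>\<^bsub>M\<^esub> v \<in> t ` carrier countable_copower)"
    if "p \<in> T" "q \<in> T" for p q
  proof -
    have p: "linear R countable_copower M p" "\<And>x. x\<in>carrier countable_copower \<Longrightarrow> (\<And>n. f (x n) = \<zero>\<^bsub>M\<^esub>) \<Longrightarrow> p x = \<zero>\<^bsub>M\<^esub>"
      and q: "linear R countable_copower M q" "\<And>x. x\<in>carrier countable_copower \<Longrightarrow> (\<And>n. f (x n) = \<zero>\<^bsub>M\<^esub>) \<Longrightarrow> q x = \<zero>\<^bsub>M\<^esub>"
      using that unfolding T_def by blast+
    have le: "linear R countable_copower countable_copower even_part" "linear R countable_copower countable_copower odd_part"
      unfolding even_part_def odd_part_def by (rule linear_reindex, simp add: inj_def)+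
    define t where "t x = p (even_part x) \<oplus>\<^bsub>M\<^esub> q (odd_part x)" for x
    have "linear R countable_copower M t"
      unfolding t_def by (intro BM.linear_on_sum linear_comp[OF le(1) p(1)] linear_comp[OF le(2) q(1)])
    moreover have "t x = \<zero>\<^bsub>M\<^esub>" if "x \<in> carrier countable_copower" "\<And>n. f (x n) = \<zero>\<^bsub>M\<^esub>" for x
    proof -
      have "p (even_part x) = \<zero>\<^bsub>M\<^esub>"
        by (rule p(2)[OF linear_on_closed[OF le(1) that(1)]]) (simp add: even_part_def that(2))
      moreover have "q (odd_part x) = \<zero>\<^bsub>M\<^esub>"
        by (rule q(2)[OF linear_on_closed[OF le(2) that(1)]]) (simp only: odd_part_def that(2))
      ultimately show ?thesis by (simp add: t_def)
    qed
    ultimately have "t \<in> T" by (simp add: T_def)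
    moreover have sum: "p x \<oplus>\<^bsub>M\<^esub> q y \<in> t ` carrier countable_copower"
      if xy: "x \<in> carrier countable_copower" "y \<in> carrier countable_copower" for x y
    proof -
      obtain w where "w \<in> carrier countable_copower" "even_part w = x" "odd_part w = y" using interleave[OF xy] .
      then show ?thesis unfolding t_def by (intro image_eqI[of _ _ w]) simp_all
    qed
    moreover have "p x \<in> t ` carrier countable_copower" if "x \<in> carrier countable_copower" for x
      using sum[OF that B.zero_closed] BM.linear_on_zero[OF q(1) B.submodule_carrier] linear_on_closed[OF p(1) that] by simp
    moreover have "q x \<in> t ` carrier countable_copower" if "x \<in> carrier countable_copower" for x
      using sum[OF B.zero_closed that] BM.linear_on_zero[OF p(1) B.submodule_carrier] linear_on_closed[OF q(1) that] by simp
    ultimately show ?thesis by blast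
  qed
  define K' where "K' = (\<Union>p\<in>T. p ` carrier countable_copower)"
  have T0: "(\<lambda>x. g (f (x 0))) \<in> T" if g: "linear R M M g" for g
    unfolding T_def mem_Collect_eq
    using linear_comp[OF linear_comp[OF linear_component f] g] MM.linear_on_zero[OF g submodule_carrier] by simp
  have K': "submodule K' R M"
  proof (rule submoduleI)
    show "K' \<subseteq> carrier M" unfolding K'_def T_def using linear_on_closed by fast
    show "x \<oplus>\<^bsub>M\<^esub> y \<in> K'" if "x \<in> K'" "y \<in> K'" for x y
      using that join unfolding K'_def by (smt (verit) UN_iff)
    show "r \<odot>\<^bsub>M\<^esub> x \<in> K'" if r: "r \<in> carrier R" and x: "x \<in> K'" for r x
    proof -
      obtain p w where p: "p \<in> T" and w: "w \<in> carrier countable_copower" "x = p w" using x unfolding K'_def by blast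
      have "linear R countable_copower M p" using p by (simp add: T_def)
      then have "r \<odot>\<^bsub>M\<^esub> x = p (r \<odot>\<^bsub>countable_copower\<^esub> w)" using linear_on_smult[of R countable_copower _ M p r w] r w by simp
      then show ?thesis unfolding K'_def using p B.smult_closed[OF r w(1)] by blast
    qed
    have "linear R M M (\<lambda>x. x)" by (simp add: linear_on_def)
    from T0[OF this] have "(\<lambda>x. f (x 0)) \<in> T" .
    moreover have "f (\<zero>\<^bsub>countable_copower\<^esub> 0) = \<zero>\<^bsub>M\<^esub>"
      using MM.linear_on_zero[OF f submodule_carrier] by (simp add: copower_simps)
    ultimately show "\<zero>\<^bsub>M\<^esub> \<in> K'" unfolding K'_def
      by (intro UN_I[of "\<lambda>x. f (x 0)"] image_eqI[of _ _ "\<zero>\<^bsub>countable_copower\<^esub>"] B.zero_closed) simp_all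
  qed
  have "G \<subseteq> K'"
  proof
    fix z assume "z \<in> G"
    then obtain g m where gm: "linear R M M g" "m \<in> carrier M" "z = g (f m)" by (auto simp: G_def)
    have "z = (\<lambda>x. g (f (x 0))) (single UNIV 0 m)" by (simp add: gm single_def)
    then show "z \<in> K'" unfolding K'_def by (intro UN_I[OF T0[OF gm(1)]] image_eqI[OF _ single_closed[OF gm(2)]])
  qed
  then have KK': "K \<subseteq> K'" by (rule K_least[OF K'])
  obtain S where S: "finite S" "S \<subseteq> carrier M" "carrier M = submodule_generated R M S"
    using fg unfolding finitely_generated_module_def by blast
  \<comment> \<open>A single value of h lies in the image of some member of T that depends on the
    value; directedness gives one member for finitely many values.\<close>
  have "\<exists>p\<in>T. h ` F \<subseteq> p ` carrier countable_copower" if "finite F" "F \<subseteq> carrier M" for F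
    using that
  proof (induction F)
    case empty
    then show ?case using T0[OF f] by blast
  next
    case (insert s F)
    then obtain p where p: "p \<in> T" "h ` F \<subseteq> p ` carrier countable_copower" by auto
    have "s \<in> carrier M" using insert.prems by blast
    then have "h s \<in> K'" using hK KK' by blast
    then obtain q where q: "q \<in> T" "h s \<in> q ` carrier countable_copower" unfolding K'_def by blast
    obtain t where t: "t \<in> T" "p ` carrier countable_copower \<union> q ` carrier countable_copower \<subseteq> t ` carrier countable_copower"
      using join[OF p(1) q(1)] by (elim bexE conjE) (rule that)
    show ?case
    proof (rule bexI[OF _ t(1)])
      have "h ` F \<subseteq> t ` carrier countable_copower" using p(2) t(2) by (meson Un_subset_iff order_trans)
      moreover have "h s \<in> t ` carrier countable_copower" using q(2) t(2) by (meson Un_subset_iff subsetD)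
      ultimately show "h ` insert s F \<subseteq> t ` carrier countable_copower" by simp
    qed
  qed
  from this[OF S(1,2)] obtain p where p: "p \<in> T" "h ` S \<subseteq> p ` carrier countable_copower" by (elim bexE)
  have pl: "linear R countable_copower M p" using p(1) by (simp add: T_def)
  have sub: "submodule {x \<in> carrier M. h x \<in> p ` carrier countable_copower} R M"
    by (rule MM.submodule_preimage[OF h submodule_carrier BM.submodule_image[OF pl B.submodule_carrier]])
  have "S \<subseteq> {x \<in> carrier M. h x \<in> p ` carrier countable_copower}"
    using p(2) S(2) by (simp add: image_subset_iff subset_iff)
  from submodule_generated_least[OF sub this]
  have "carrier M \<subseteq> {x \<in> carrier M. h x \<in> p ` carrier countable_copower}" using S(3) by simp
  then have "h ` carrier M \<subseteq> p ` carrier countable_copower" unfolding image_subset_iff by (simp add: subset_iff)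
  then obtain k where k: "linear R M countable_copower k" "\<And>m. m \<in> carrier M \<Longrightarrow> p (k m) = h m"
    using projective_lift[OF proj pl h] by metis
  have gfm: "g (f m) \<in> carrier M" using linear_on_closed[OF g linear_on_closed[OF f m]] .
  \<comment> \<open>The n-th coordinate of k after g is an endomorphism of M, so the assumption f g
    f = 0 applies to it.\<close>
  have "f (k (g (f m)) n) = \<zero>\<^bsub>M\<^esub>" for n
    using fgf[OF linear_comp[OF linear_comp[OF g k(1)] linear_component] m] by simp
  then have "p (k (g (f m))) = \<zero>\<^bsub>M\<^esub>"
    using p(1) linear_on_closed[OF k(1) gfm] unfolding T_def by simp
  then show False using k(2)[OF gfm] hgf by simp
qed

section \<open>Essential kernels and nonsingularity\<close>

definition ess_kernel where
  "ess_kernel X L Y f \<longleftrightarrow> (\<forall>K. submodule K R X \<longrightarrow> K \<subseteq> L \<longrightarrow> K \<noteq> {\<zero>\<^bsub>X\<^esub>} \<longrightarrow> (\<exists>x\<in>K. x \<noteq> \<zero>\<^bsub>X\<^esub> \<and> f x = \<zero>\<^bsub>Y\<^esub>))"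
  for X :: "('a, 'x) module" and Y :: "('a, 'y) module"

text \<open>Preimages of essential submodules are essential: a nonzero submodule is either killed by
  g, or has a nonzero image, which meets the kernel of f.\<close>

lemma ess_kernel_comp:
  assumes X: "left_module R X" and Z: "left_module R Z" and Y: "left_module R Y"
    and g: "linear R Z X g" and gL: "g ` carrier Z \<subseteq> L"
    and L: "submodule L R X" and f: "linear_on R X L Y f" and e: "ess_kernel X L Y f"
  shows "ess_kernel Z (carrier Z) Y (\<lambda>z. f (g z))"
  unfolding ess_kernel_def
proof (intro allI impI)
  fix K assume K: "submodule K R Z" "K \<subseteq> carrier Z" "K \<noteq> {\<zero>\<^bsub>Z\<^esub>}"
  interpret ZX: two_modules R Z X using X Z by (simp add: two_modules_def)
  interpret XY: two_modules R X Y using X Y by (simp add: two_modules_def)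
  have gK: "submodule (g ` K) R X" using ZX.submodule_image[OF linear_on_subset[OF g K(2)] K(1)] .
  show "\<exists>z\<in>K. z \<noteq> \<zero>\<^bsub>Z\<^esub> \<and> f (g z) = \<zero>\<^bsub>Y\<^esub>"
  proof (cases "g ` K = {\<zero>\<^bsub>X\<^esub>}")
    case True
    obtain z where z: "z \<in> K" "z \<noteq> \<zero>\<^bsub>Z\<^esub>" using ZX.X.nonzero_submodule[OF K(1,3)] by blast
    then have "g z = \<zero>\<^bsub>X\<^esub>" using True by blast
    then show ?thesis using z XY.linear_on_zero[OF f L] by auto
  next
    case False
    then obtain x where x: "x \<in> g ` K" "x \<noteq> \<zero>\<^bsub>X\<^esub>" "f x = \<zero>\<^bsub>Y\<^esub>"
      using e gK gL K(2) unfolding ess_kernel_def by (meson image_mono order_trans)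
    then obtain z where "z \<in> K" "x = g z" by blast
    then show ?thesis using x ZX.linear_on_zero[OF g ZX.X.submodule_carrier] by (intro bexI[of _ z]) auto
  qed
qed

text \<open>If f is nonzero, so is f g f for some g. Its kernel is again essential, and strictly
  contains the kernel of f because the image of f meets the essential kernel of f g. Iteration gives
  an infinite ascending chain of kernels, which are left annihilators.\<close>

lemma nonsingular:
  assumes fg: "finitely_generated_module R M" and proj: "projective_in_sigma R M"
    and semi: "semiprime_module R M" and acc: "acc_left_annihilators R M"
    and f: "linear R M M f" and e: "ess_kernel M (carrier M) M f" and m: "m \<in> carrier M"
  shows "f m = \<zero>\<^bsub>M\<^esub>"
proof (rule ccontr)
  assume fm: "f m \<noteq> \<zero>\<^bsub>M\<^esub>"
  interpret MM: two_modules R M M by unfold_locales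
  define Z where "Z = {f. linear R M M f \<and> ess_kernel M (carrier M) M f \<and> (\<exists>m\<in>carrier M. f m \<noteq> \<zero>\<^bsub>M\<^esub>)}"
  define ker where "ker f = {x \<in> carrier M. f x = \<zero>\<^bsub>M\<^esub>}" for f
  have step: "\<exists>f'\<in>Z. ker f \<subset> ker f'" if "f \<in> Z" for f
  proof -
    have f: "linear R M M f" and e: "ess_kernel M (carrier M) M f" and "\<exists>m\<in>carrier M. f m \<noteq> \<zero>\<^bsub>M\<^esub>"
      using that by (auto simp: Z_def)
    then obtain g m where g: "linear R M M g" and m: "m \<in> carrier M" and fgf: "f (g (f m)) \<noteq> \<zero>\<^bsub>M\<^esub>"
      using semiprime_endomorphism[OF fg proj semi f] by blast
    have fgl: "linear R M M (\<lambda>x. f (g x))" by (rule linear_comp[OF g f])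
    have im: "u ` carrier M \<subseteq> carrier M" if "linear R M M u" for u using linear_on_closed[OF that] by blast
    have e1: "ess_kernel M (carrier M) M (\<lambda>x. f (g x))"
      by (rule ess_kernel_comp[OF left_module_axioms left_module_axioms left_module_axioms g im[OF g] submodule_carrier f e])
    have e2: "ess_kernel M (carrier M) M (\<lambda>x. f (g (f x)))"
      by (rule ess_kernel_comp[OF left_module_axioms left_module_axioms left_module_axioms f im[OF f] submodule_carrier fgl e1])
    have "f m \<noteq> \<zero>\<^bsub>M\<^esub>" using fgf MM.linear_on_zero[OF fgl submodule_carrier] by auto
    then have "f ` carrier M \<noteq> {\<zero>\<^bsub>M\<^esub>}" using m by blast
    then obtain y where y: "y \<in> f ` carrier M" "y \<noteq> \<zero>\<^bsub>M\<^esub>" "f (g y) = \<zero>\<^bsub>M\<^esub>"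
      using e1 MM.submodule_image[OF f submodule_carrier] im[OF f] unfolding ess_kernel_def by blast
    then obtain x where x: "x \<in> carrier M" "y = f x" by blast
    have "(\<lambda>x. f (g (f x))) \<in> Z" unfolding Z_def using linear_comp[OF f fgl] e2 m fgf by blast
    moreover have "ker f \<subseteq> ker (\<lambda>x. f (g (f x)))"
      unfolding ker_def using MM.linear_on_zero[OF fgl submodule_carrier] by auto
    moreover have "x \<in> ker (\<lambda>x. f (g (f x)))" "x \<notin> ker f" using x y by (auto simp: ker_def)
    ultimately show ?thesis by blast
  qed
  have "\<exists>F. \<forall>n. F n \<in> Z \<and> ker (F n) \<subset> ker (F (Suc n))"
  proof (rule dependent_nat_choice)
    show "\<exists>f. f \<in> Z" using f e m fm unfolding Z_def by blast
  next
    fix x and n :: nat assume "x \<in> Z"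
    then show "\<exists>y. y \<in> Z \<and> ker x \<subset> ker y" using step by blast
  qed
  then obtain F where F: "\<And>n. F n \<in> Z" "\<And>n. ker (F n) \<subset> ker (F (Suc n))" by blast
  have "left_annihilator_in R M (ker (F n))" for n
  proof -
    have "restrict (F n) (carrier M) \<in> Hom R M M" using F(1)[of n] by (intro MM.Hom_restrict) (simp add: Z_def)
    moreover have "ker (F n) = carrier M \<inter> (\<Inter>f\<in>{restrict (F n) (carrier M)}. a_kernel M M f)"
      by (auto simp: ker_def a_kernel_def kernel_def)
    ultimately show ?thesis unfolding left_annihilator_in_def by blast
  qed
  then have *: "\<forall>n. left_annihilator_in R M (ker (F n)) \<and> ker (F n) \<subseteq> ker (F (Suc n))"
    using F(2) psubset_imp_subset by blast
  have "\<exists>k. \<forall>l\<ge>k. ker (F l) = ker (F k)"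
    by (rule acc[unfolded acc_left_annihilators_def, rule_format, of "\<lambda>n. ker (F n)"]) (rule *[rule_format])
  then obtain k where k: "\<forall>l\<ge>k. ker (F l) = ker (F k)" ..
  have "ker (F (Suc k)) = ker (F k)" by (rule k[rule_format]) simp
  then show False using F(2)[of k] by simp
qed

end

section \<open>Perpendicular submodules and minimal primes\<close>

text \<open>The condition \<open>self_in_sigma\<close> is part of the assertion that M has a hull in
  sigma[M], and is supplied from there.\<close>

locale semiprime_goldie = left_module R M
  for R :: "('a, 'r) ring_scheme" and M :: "('a, 'm) module" +
  assumes progenerator: "progenerator_in_sigma R M"
    and semiprime: "semiprime_module R M"
    and Goldie: "Goldie_module R M"
    and self_in_sigma: "in_sigma R M M"
begin

sublocale MM: two_modules R M M by unfold_locales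

section \<open>Uniqueness of maps into essential extensions\<close>

lemma detect:
  assumes "in_sigma R M X" "submodule L R X" "left_module R Y" "linear_on R X L Y f" "x \<in> L" "f x \<noteq> \<zero>\<^bsub>Y\<^esub>"
  obtains g m where "linear R M X g" "\<And>y. y \<in> carrier M \<Longrightarrow> g y \<in> L" "m \<in> carrier M" "f (g m) \<noteq> \<zero>\<^bsub>Y\<^esub>"
proof -
  have "generator_in_sigma R M" using progenerator by (simp add: progenerator_in_sigma_def)
  from generator_detects[OF this assms] obtain g m
    where "linear R M X g" "g ` carrier M \<subseteq> L" "m \<in> carrier M" "f (g m) \<noteq> \<zero>\<^bsub>Y\<^esub>" .
  then show ?thesis using that by (simp add: image_subset_iff)
qed

lemma endo_square:
  assumes "linear R M M f" "m0 \<in> carrier M" "f m0 \<noteq> \<zero>\<^bsub>M\<^esub>"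
  obtains g m where "linear R M M g" "m \<in> carrier M" "f (g (f m)) \<noteq> \<zero>\<^bsub>M\<^esub>"
  using semiprime_endomorphism[OF _ _ semiprime assms] progenerator
  by (auto simp: progenerator_in_sigma_def)

text \<open>A common description of the targets of later maps: M itself, the hull of M, and the
  hulls of the M/P. Each is an essential extension of a copy of a submodule of M, and this is enough
  to inherit nonsingularity from M.\<close>

definition ess_embedded where
  "ess_embedded N Y \<kappa> \<longleftrightarrow> left_module R Y \<and> submodule N R M \<and> linear_on R M N Y \<kappa> \<and> inj_on \<kappa> N \<and>
     (\<forall>L. submodule L R Y \<longrightarrow> L \<noteq> {\<zero>\<^bsub>Y\<^esub>} \<longrightarrow> (\<exists>x\<in>N. x \<noteq> \<zero>\<^bsub>M\<^esub> \<and> \<kappa> x \<in> L))"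
  for Y :: "('a, 'y) module"

lemma ess_embedded_self: "ess_embedded (carrier M) M (\<lambda>x. x)"
  unfolding ess_embedded_def using submodule_mem nonzero_submodule
  by (fastforce simp: left_module_axioms submodule_carrier linear_on_def)

text \<open>A nonzero value of f can be moved into the copy of N by essentiality. Restricting f to
  the preimage of that copy, precomposing with a map from M given by \<open>detect\<close> and
  inverting \<open>\<kappa>\<close> produces a nonzero endomorphism of M with essential kernel,
  against \<open>nonsingular\<close>.\<close>

lemma ess_embedded_nonsingular:
  assumes Y: "ess_embedded N Y \<kappa>" and X: "in_sigma R M X" and L: "submodule L R X"
    and f: "linear_on R X L Y f" and e: "ess_kernel X L Y f" and x: "x \<in> L"
  shows "f x = \<zero>\<^bsub>Y\<^esub>"
proof (rule ccontr)
  assume fx: "f x \<noteq> \<zero>\<^bsub>Y\<^esub>"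
  have Ym: "left_module R Y" and N: "submodule N R M" and \<kappa>: "linear_on R M N Y \<kappa>" "inj_on \<kappa> N"
    and ess: "\<And>L. submodule L R Y \<Longrightarrow> L \<noteq> {\<zero>\<^bsub>Y\<^esub>} \<Longrightarrow> \<exists>x\<in>N. x \<noteq> \<zero>\<^bsub>M\<^esub> \<and> \<kappa> x \<in> L"
    using Y by (simp_all add: ess_embedded_def)
  have Xm: "left_module R X" using X by (simp add: in_sigma_def)
  interpret XY: two_modules R X Y using Xm Ym by (simp add: two_modules_def)
  interpret MY: two_modules R M Y by unfold_locales
  have "f ` L \<noteq> {\<zero>\<^bsub>Y\<^esub>}" using fx x by blast
  from ess[OF XY.submodule_image[OF f L] this]
  obtain w where w: "w \<in> N" "w \<noteq> \<zero>\<^bsub>M\<^esub>" "\<kappa> w \<in> f ` L" by (elim bexE conjE)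
  obtain z where z: "z \<in> L" "\<kappa> w = f z" using w(3) by (rule imageE)
  have fz: "f z \<noteq> \<zero>\<^bsub>Y\<^esub>" using w z(2) MY.inj_on_iff_kernel[OF \<kappa>(1) N] \<kappa>(2) by auto
  define L1 where "L1 = {z\<in>L. f z \<in> \<kappa> ` N}"
  have \<kappa>N: "submodule (\<kappa> ` N) R Y" by (rule MY.submodule_image[OF \<kappa>(1) N])
  have L1: "submodule L1 R X" unfolding L1_def by (rule XY.submodule_preimage[OF f L \<kappa>N])
  have f1: "linear_on R X L1 Y f" by (rule linear_on_subset[OF f]) (simp add: L1_def)
  have "\<kappa> w \<in> \<kappa> ` N" using w(1) by (rule imageI)
  then have "z \<in> L1" using z by (simp add: L1_def)
  from detect[OF X L1 Ym f1 this fz] obtain g m where g: "linear R M X g" "\<And>y. y \<in> carrier M \<Longrightarrow> g y \<in> L1"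
    and m: "m \<in> carrier M" "f (g m) \<noteq> \<zero>\<^bsub>Y\<^esub>" by metis
  define u where "u y = inv_into N \<kappa> (f (g y))" for y
  have gL: "g ` carrier M \<subseteq> L" using g(2) by (auto simp: L1_def)
  have fg: "linear R M Y (\<lambda>y. f (g y))" by (rule linear_on_comp[OF g(1) f gL])
  have u: "linear R M M u" unfolding u_def
    by (rule linear_on_comp[OF fg MY.linear_on_inv_into[OF \<kappa>(1) N \<kappa>(2)]]) (use g(2) in \<open>auto simp: L1_def\<close>)
  have \<kappa>u: "\<kappa> (u y) = f (g y)" if "y \<in> carrier M" for y
    unfolding u_def using g(2)[OF that] by (simp add: L1_def f_inv_into_f)
  have uN: "u y \<in> N" if "y \<in> carrier M" for y
    unfolding u_def using g(2)[OF that] by (simp add: L1_def inv_into_into)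
  have "ess_kernel M (carrier M) Y (\<lambda>y. f (g y))"
    by (rule ess_kernel_comp[OF Xm left_module_axioms Ym g(1) gL L f e])
  moreover have "u y = \<zero>\<^bsub>M\<^esub>" if "y \<in> carrier M" "f (g y) = \<zero>\<^bsub>Y\<^esub>" for y
    using \<kappa>u[OF that(1)] uN[OF that(1)] that(2) MY.inj_on_iff_kernel[OF \<kappa>(1) N] \<kappa>(2) by auto
  ultimately have "ess_kernel M (carrier M) M u"
    unfolding ess_kernel_def using submodule_mem by meson
  from nonsingular[OF _ _ semiprime _ u this m(1)] have "u m = \<zero>\<^bsub>M\<^esub>"
    using progenerator Goldie by (simp add: progenerator_in_sigma_def Goldie_module_def)
  then show False using \<kappa>u[OF m(1)] m(2) MY.linear_on_zero[OF \<kappa>(1) N] by simp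
qed

text \<open>Nonsingularity applied to f - g. This is the uniqueness principle behind all later
  identities between maps of hulls.\<close>

lemma ess_embedded_eq:
  assumes Y: "ess_embedded N Y \<kappa>" and X: "in_sigma R M X" and L: "submodule L R X"
    and f: "linear_on R X L Y f" and g: "linear_on R X L Y g"
    and e: "\<And>K. submodule K R X \<Longrightarrow> K \<subseteq> L \<Longrightarrow> K \<noteq> {\<zero>\<^bsub>X\<^esub>} \<Longrightarrow> \<exists>x\<in>K. x \<noteq> \<zero>\<^bsub>X\<^esub> \<and> f x = g x"
    and x: "x \<in> L"
  shows "f x = g x"
proof -
  have Ym: "left_module R Y" using Y by (simp add: ess_embedded_def)
  have Xm: "left_module R X" using X by (simp add: in_sigma_def)
  interpret XY: two_modules R X Y using Xm Ym by (simp add: two_modules_def)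
  have eq: "f y \<ominus>\<^bsub>Y\<^esub> g y = \<zero>\<^bsub>Y\<^esub> \<longleftrightarrow> f y = g y" if "y \<in> L" for y
    by (rule XY.Y.minus_zero_eq[OF linear_on_closed[OF f that] linear_on_closed[OF g that]])
  have "ess_kernel X L Y (\<lambda>x. f x \<ominus>\<^bsub>Y\<^esub> g x)"
    unfolding ess_kernel_def
  proof (intro allI impI)
    fix K assume K: "submodule K R X" "K \<subseteq> L" "K \<noteq> {\<zero>\<^bsub>X\<^esub>}"
    then obtain x where "x \<in> K" "x \<noteq> \<zero>\<^bsub>X\<^esub>" "f x = g x" using e by blast
    then show "\<exists>x\<in>K. x \<noteq> \<zero>\<^bsub>X\<^esub> \<and> f x \<ominus>\<^bsub>Y\<^esub> g x = \<zero>\<^bsub>Y\<^esub>" using eq K(2) by blast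
  qed
  from ess_embedded_nonsingular[OF Y X L XY.linear_on_diff[OF f g] this x] show ?thesis
    using eq[OF x] by simp
qed

text \<open>Nonzero submodules of a uniform module meet each other, so the submodule where f and g
  agree is essential in \<open>U\<close> as soon as it is nonzero.\<close>

lemma uniform_eq:
  assumes Y: "ess_embedded N Y \<kappa>" and X: "in_sigma R M X" and U: "uniform_submodule R X U"
    and f: "linear_on R X U Y f" and g: "linear_on R X U Y g"
    and x: "x \<in> U" "x \<noteq> \<zero>\<^bsub>X\<^esub>" "f x = g x" and y: "y \<in> U"
  shows "f y = g y"
proof -
  have Ym: "left_module R Y" using Y by (simp add: ess_embedded_def)
  have Xm: "left_module R X" using X by (simp add: in_sigma_def)
  interpret XY: two_modules R X Y using Xm Ym by (simp add: two_modules_def)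
  have Us: "submodule U R X" using U by (simp add: uniform_submodule_def)
  define E where "E = {x\<in>U. f x \<ominus>\<^bsub>Y\<^esub> g x = \<zero>\<^bsub>Y\<^esub>}"
  have eq: "z \<in> E \<longleftrightarrow> z \<in> U \<and> f z = g z" for z
    unfolding E_def using XY.Y.minus_zero_eq linear_on_closed[OF f] linear_on_closed[OF g] by auto
  have E: "submodule E R X" unfolding E_def by (rule XY.submodule_kernel[OF XY.linear_on_diff[OF f g] Us])
  have "E \<noteq> {\<zero>\<^bsub>X\<^esub>}" "E \<subseteq> U" using eq x by blast+
  show ?thesis
  proof (rule ess_embedded_eq[OF Y X Us f g _ y])
    fix K assume K: "submodule K R X" "K \<subseteq> U" "K \<noteq> {\<zero>\<^bsub>X\<^esub>}"
    then have "K \<inter> E \<noteq> {\<zero>\<^bsub>X\<^esub>}"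
      using U E \<open>E \<noteq> _\<close> \<open>E \<subseteq> U\<close> unfolding uniform_submodule_def by blast
    then obtain x where "x \<in> K \<inter> E" "x \<noteq> \<zero>\<^bsub>X\<^esub>"
      using XY.X.nonzero_submodule[OF XY.X.submodule_Int[OF K(1) E]] by blast
    then show "\<exists>x\<in>K. x \<noteq> \<zero>\<^bsub>X\<^esub> \<and> f x = g x" using eq by blast
  qed
qed

text \<open>A map that vanishes at a nonzero element agrees there with the zero map, hence
  everywhere on \<open>U\<close> by \<open>uniform_eq\<close>.\<close>

lemma uniform_injective:
  assumes Y: "ess_embedded N Y \<kappa>" and X: "in_sigma R M X" and U: "uniform_submodule R X U"
    and f: "linear_on R X U Y f" and y: "y \<in> U" "f y \<noteq> \<zero>\<^bsub>Y\<^esub>" and x: "x \<in> U" "f x = \<zero>\<^bsub>Y\<^esub>"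
  shows "x = \<zero>\<^bsub>X\<^esub>"
proof (rule ccontr)
  assume "x \<noteq> \<zero>\<^bsub>X\<^esub>"
  have Ym: "left_module R Y" using Y by (simp add: ess_embedded_def)
  have Xm: "left_module R X" using X by (simp add: in_sigma_def)
  interpret XY: two_modules R X Y using Xm Ym by (simp add: two_modules_def)
  have "f y = \<zero>\<^bsub>Y\<^esub>"
    by (rule uniform_eq[OF Y X U f XY.linear_zero x(1) \<open>x \<noteq> \<zero>\<^bsub>X\<^esub>\<close> x(2) y(1)])
  then show False using y by simp
qed

section \<open>Perpendicular submodules\<close>

definition perp where
  "perp K = {x \<in> carrier M. \<forall>f. linear R M M f \<longrightarrow> f ` carrier M \<subseteq> K \<longrightarrow> f x = \<zero>\<^bsub>M\<^esub>}"

lemma perpD: "x \<in> perp K \<Longrightarrow> linear R M M f \<Longrightarrow> (\<And>y. y \<in> carrier M \<Longrightarrow> f y \<in> K) \<Longrightarrow> f x = \<zero>\<^bsub>M\<^esub>"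
  by (auto simp: perp_def)

lemma fully_invariant_closed:
  assumes "fully_invariant R M K" "linear R M M u" "x \<in> K"
  shows "u x \<in> K"
proof -
  have "restrict u (carrier M) \<in> Hom R M M" by (rule MM.Hom_restrict[OF assms(2)])
  then have "restrict u (carrier M) x \<in> K" using assms unfolding fully_invariant_def by blast
  moreover have "x \<in> carrier M" using assms submodule_mem unfolding fully_invariant_def by blast
  ultimately show ?thesis by simp
qed

lemma fully_invariant_submodule: "fully_invariant R M K \<Longrightarrow> submodule K R M"
  by (simp add: fully_invariant_def)

text \<open>Precomposing a map into K with an endomorphism of M gives another map into K.\<close>

lemma perp_fully_invariant: "fully_invariant R M (perp K)"
  unfolding fully_invariant_def
proof (intro conjI ballI)
  show "submodule (perp K) R M"
  proof (rule submoduleI)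
    show "\<zero>\<^bsub>M\<^esub> \<in> perp K" by (simp add: perp_def MM.linear_on_zero[OF _ submodule_carrier])
    show "x \<oplus>\<^bsub>M\<^esub> y \<in> perp K" if "x \<in> perp K" "y \<in> perp K" for x y
    proof -
      have c: "x \<in> carrier M" "y \<in> carrier M" using that by (simp_all add: perp_def)
      have "f (x \<oplus>\<^bsub>M\<^esub> y) = \<zero>\<^bsub>M\<^esub>" if "linear R M M f" "f ` carrier M \<subseteq> K" for f
      proof -
        have im: "\<And>y. y \<in> carrier M \<Longrightarrow> f y \<in> K" using that(2) by blast
        show ?thesis
          using linear_on_add[OF that(1) c] perpD[OF \<open>x \<in> perp K\<close> that(1) im] perpD[OF \<open>y \<in> perp K\<close> that(1) im] by simp
      qed
      then show ?thesis using c by (simp add: perp_def)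
    qed
    show "r \<odot>\<^bsub>M\<^esub> x \<in> perp K" if "r \<in> carrier R" "x \<in> perp K" for r x
    proof -
      have c: "x \<in> carrier M" using that by (simp add: perp_def)
      have "f (r \<odot>\<^bsub>M\<^esub> x) = \<zero>\<^bsub>M\<^esub>" if "linear R M M f" "f ` carrier M \<subseteq> K" for f
      proof -
        have im: "\<And>y. y \<in> carrier M \<Longrightarrow> f y \<in> K" using that(2) by blast
        show ?thesis
          using linear_on_smult[OF that(1) \<open>r \<in> carrier R\<close> c] perpD[OF \<open>x \<in> perp K\<close> that(1) im]
            smult_r_null[OF \<open>r \<in> carrier R\<close>] by simp
      qed
      then show ?thesis using c that by (simp add: perp_def)
    qed
  qed (auto simp: perp_def)
  fix u assume "u \<in> Hom R M M"
  then have u: "linear R M M u" by (rule linear_Hom)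
  show "u ` perp K \<subseteq> perp K"
  proof
    fix y assume "y \<in> u ` perp K"
    then obtain x where x: "x \<in> perp K" "y = u x" by (rule imageE)
    have xc: "x \<in> carrier M" using x by (simp add: perp_def)
    have "f (u x) = \<zero>\<^bsub>M\<^esub>" if "linear R M M f" "f ` carrier M \<subseteq> K" for f
      by (rule perpD[OF x(1) linear_comp[OF u that(1)]]) (use that(2) linear_on_closed[OF u] in blast)
    then show "y \<in> perp K" using x(2) linear_on_closed[OF u xc] by (simp add: perp_def)
  qed
qed

lemmas submodule_perp = perp_fully_invariant[THEN fully_invariant_submodule]

lemma fully_invariant_Inter_perp: "fully_invariant R M (carrier M \<inter> (\<Inter>i\<in>I. perp (V i)))"
  unfolding fully_invariant_def
proof (intro conjI ballI)
  show "submodule (carrier M \<inter> (\<Inter>i\<in>I. perp (V i))) R M"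
    by (rule submoduleI) (auto simp: submodule_zero[OF submodule_perp] submodule_add[OF submodule_perp] submodule_smult[OF submodule_perp])
  fix f assume "f \<in> Hom R M M"
  then have f: "linear R M M f" by (rule linear_Hom)
  show "f ` (carrier M \<inter> (\<Inter>i\<in>I. perp (V i))) \<subseteq> carrier M \<inter> (\<Inter>i\<in>I. perp (V i))"
    using linear_on_closed[OF f] fully_invariant_closed[OF perp_fully_invariant f] by auto
qed

lemma perp_antimono: "K \<subseteq> L \<Longrightarrow> perp L \<subseteq> perp K"
  by (auto simp: perp_def)

lemma detect_nonzero:
  assumes L: "submodule L R M" and x: "x \<in> L" "x \<noteq> \<zero>\<^bsub>M\<^esub>"
  obtains v m where "linear R M M v" "\<And>y. y \<in> carrier M \<Longrightarrow> v y \<in> L" "m \<in> carrier M" "v m \<noteq> \<zero>\<^bsub>M\<^esub>"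
proof -
  have "linear_on R M L M (\<lambda>x. x)" using submodule_mem[OF L] by (simp add: linear_on_def Pi_def)
  from detect[OF self_in_sigma L left_module_axioms this x] show ?thesis using that by metis
qed

text \<open>A nonzero v from M into the intersection would have v k v nonzero for some k. But v k
  maps M into K and v takes values in \<open>perp K\<close>, so v k v is zero.\<close>

lemma Int_perp:
  assumes K: "submodule K R M" and x: "x \<in> K" "x \<in> perp K"
  shows "x = \<zero>\<^bsub>M\<^esub>"
proof (rule ccontr)
  assume "x \<noteq> \<zero>\<^bsub>M\<^esub>"
  then obtain v m where v: "linear R M M v" "\<And>y. y \<in> carrier M \<Longrightarrow> v y \<in> K \<inter> perp K" "m \<in> carrier M" "v m \<noteq> \<zero>\<^bsub>M\<^esub>"
    using detect_nonzero[OF submodule_Int[OF K submodule_perp], of x K] x by blast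
  obtain k m' where k: "linear R M M k" "m' \<in> carrier M" "v (k (v m')) \<noteq> \<zero>\<^bsub>M\<^esub>"
    using endo_square[OF v(1,3,4)] .
  have "v m' \<in> perp K" using v(2) k(2) by blast
  from perpD[OF this linear_comp[OF k(1) v(1)]] have "v (k (v m')) = \<zero>\<^bsub>M\<^esub>"
    using v(2) linear_on_closed[OF k(1)] by blast
  then show False using k by simp
qed

text \<open>Suppose f maps M into K and is nonzero at some x in L, and choose g from M into L with f
  g nonzero. Then f g h f g is nonzero for some h. The values of g h f g lie in K by full invariance
  and in L as values of g, so they are zero: a contradiction.\<close>

lemma subset_perp:
  assumes K: "fully_invariant R M K" and L: "submodule L R M" and I: "\<And>x. x \<in> K \<Longrightarrow> x \<in> L \<Longrightarrow> x = \<zero>\<^bsub>M\<^esub>"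
  shows "L \<subseteq> perp K"
proof
  fix x assume x: "x \<in> L"
  have "f x = \<zero>\<^bsub>M\<^esub>" if f: "linear R M M f" "f ` carrier M \<subseteq> K" for f
  proof (rule ccontr)
    assume fx: "f x \<noteq> \<zero>\<^bsub>M\<^esub>"
    obtain g m where g: "linear R M M g" "\<And>y. y \<in> carrier M \<Longrightarrow> g y \<in> L" "m \<in> carrier M" "f (g m) \<noteq> \<zero>\<^bsub>M\<^esub>"
      by (rule detect[OF self_in_sigma L left_module_axioms linear_on_subset[OF f(1) submodule_subset[OF L]] x fx]) blast
    obtain h m' where h: "linear R M M h" "m' \<in> carrier M" "f (g (h (f (g m')))) \<noteq> \<zero>\<^bsub>M\<^esub>"
      using endo_square[OF linear_comp[OF g(1) f(1)] g(3,4)] .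
    have c: "g m' \<in> carrier M" using linear_on_closed[OF g(1) h(2)] .
    have "f (g m') \<in> K" using f(2) c by blast
    then have "g (h (f (g m'))) \<in> K" by (rule fully_invariant_closed[OF K linear_comp[OF h(1) g(1)]])
    moreover have "g (h (f (g m'))) \<in> L" using g(2) linear_on_closed[OF h(1) linear_on_closed[OF f(1) c]] .
    ultimately have "g (h (f (g m'))) = \<zero>\<^bsub>M\<^esub>" by (rule I)
    then show False using h(3) MM.linear_on_zero[OF f(1) submodule_carrier] by simp
  qed
  then show "x \<in> perp K" using submodule_mem[OF L x] by (simp add: perp_def)
qed

section \<open>Prime submodules from uniform submodules\<close>

lemma submodule_prod_image:
  assumes K: "submodule K R M" and f: "linear R M M f" "\<And>y. y \<in> carrier M \<Longrightarrow> f y \<in> K"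
    and N: "submodule N R M" and x: "x \<in> N"
  shows "f x \<in> submodule_prod R M N K"
proof -
  interpret MK: two_modules R M "submodule_as_module M K"
    using left_module_submodule_as_module[OF left_module_axioms K] left_module_axioms by (simp add: two_modules_def)
  have "linear R M (submodule_as_module M K) f"
    unfolding linear_on_into_submodule_as_module[OF K left_module_axioms] using f by (simp add: image_subset_iff)
  then have h: "restrict f (carrier M) \<in> Hom R M (submodule_as_module M K)" by (rule MK.Hom_restrict)
  have "f x = restrict f (carrier M) x" using submodule_mem[OF N x] by simp
  then have "f x \<in> (\<Union>h\<in>Hom R M (submodule_as_module M K). h ` N)"
    by (intro UN_I[OF h] image_eqI[OF _ x])
  then show ?thesis unfolding submodule_prod_def by (rule subsetD[OF submodule_generated_incl])
qed

lemma submodule_prod_Int: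
  assumes N: "fully_invariant R M N" and K: "submodule K R M"
  shows "submodule_prod R M N K \<subseteq> N \<inter> K"
  unfolding submodule_prod_def
proof (rule submodule_generated_least[OF submodule_Int[OF fully_invariant_submodule[OF N] K]], safe)
  fix f x assume "f \<in> Hom R M (submodule_as_module M K)" and x: "x \<in> N"
  then have "linear R M (submodule_as_module M K) f" by (simp add: linear_Hom)
  then have "linear R M M f \<and> f ` carrier M \<subseteq> K"
    by (simp only: linear_on_into_submodule_as_module[OF K left_module_axioms])
  then have f: "linear R M M f" "f ` carrier M \<subseteq> K" by simp_all
  show "f x \<in> N" by (rule fully_invariant_closed[OF N f(1) x])
  show "f x \<in> K" using f(2) submodule_mem[OF fully_invariant_submodule[OF N] x] by blast
qed

text \<open>The product lies in the intersection, so a submodule containing the intersection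
  contains the product as well.\<close>

lemma prime_Int:
  assumes Q: "prime_in R M Q" and N: "fully_invariant R M N" and K: "fully_invariant R M K" and I: "N \<inter> K \<subseteq> Q"
  shows "N \<subseteq> Q \<or> K \<subseteq> Q"
  using Q N K order_trans[OF submodule_prod_Int[OF N fully_invariant_submodule[OF K]] I]
  unfolding prime_in_def by blast

lemma uniform_perp_disjoint:
  assumes U: "uniform_submodule R M U" shows "\<not> U \<subseteq> perp U"
proof -
  have Us: "submodule U R M" "U \<noteq> {\<zero>\<^bsub>M\<^esub>}" using U by (simp_all add: uniform_submodule_def)
  obtain x where "x \<in> U" "x \<noteq> \<zero>\<^bsub>M\<^esub>" using nonzero_submodule[OF Us] by blast
  then show ?thesis using Int_perp[OF Us(1)] by blast
qed

text \<open>If neither N nor K lies in \<open>perp U\<close>, both meet U nontrivially, and the two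
  intersections meet because U is uniform. Take a nonzero v from M into all three and square it
  twice, to get v k v l v k v nonzero. Here v l sends the value of v k v, an element of N, into the
  product, and v k is a map into U that does not kill the result. So the product is not contained in
  \<open>perp U\<close>.\<close>

lemma perp_prime:
  assumes U: "uniform_submodule R M U"
  shows "prime_in R M (perp U)"
  unfolding prime_in_def
proof (intro conjI allI impI)
  have Us: "submodule U R M" using U by (simp add: uniform_submodule_def)
  show "fully_invariant R M (perp U)" by (rule perp_fully_invariant)
  show "perp U \<noteq> carrier M" using uniform_perp_disjoint[OF U] submodule_subset[OF Us] by blast
  fix N K assume N: "fully_invariant R M N" and K: "fully_invariant R M K"
    and NK: "submodule_prod R M N K \<subseteq> perp U"
  note Ns = fully_invariant_submodule[OF N] and Ks = fully_invariant_submodule[OF K]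
  \<comment> \<open>Some map into U is nonzero at an element of L, and by full invariance its value
    there stays in L.\<close>
  have meet: "L \<inter> U \<noteq> {\<zero>\<^bsub>M\<^esub>}" if L: "fully_invariant R M L" "\<not> L \<subseteq> perp U" for L
  proof -
    obtain x f where x: "x \<in> L" and f: "linear R M M f" "f ` carrier M \<subseteq> U" "f x \<noteq> \<zero>\<^bsub>M\<^esub>"
      using L(2) submodule_mem[OF fully_invariant_submodule[OF L(1)]] unfolding perp_def by blast
    have "f x \<in> L" by (rule fully_invariant_closed[OF L(1) f(1) x])
    moreover have "f x \<in> U" using f(2) submodule_mem[OF fully_invariant_submodule[OF L(1)] x] by blast
    ultimately show ?thesis using f(3) by blast
  qed
  show "N \<subseteq> perp U \<or> K \<subseteq> perp U"
  proof (rule ccontr)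
    assume "\<not> ?thesis"
    then have "N \<inter> U \<noteq> {\<zero>\<^bsub>M\<^esub>}" "K \<inter> U \<noteq> {\<zero>\<^bsub>M\<^esub>}" using meet N K by blast+
    then have "(N \<inter> U) \<inter> (K \<inter> U) \<noteq> {\<zero>\<^bsub>M\<^esub>}"
      using U submodule_Int[OF Ns Us] submodule_Int[OF Ks Us] unfolding uniform_submodule_def by blast
    then obtain x where x: "x \<in> (N \<inter> U) \<inter> (K \<inter> U)" "x \<noteq> \<zero>\<^bsub>M\<^esub>"
      using nonzero_submodule[OF submodule_Int[OF submodule_Int[OF Ns Us] submodule_Int[OF Ks Us]]] by blast
    obtain v m where v: "linear R M M v" "\<And>y. y \<in> carrier M \<Longrightarrow> v y \<in> (N \<inter> U) \<inter> (K \<inter> U)" "m \<in> carrier M" "v m \<noteq> \<zero>\<^bsub>M\<^esub>"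
      by (rule detect_nonzero[OF submodule_Int[OF submodule_Int[OF Ns Us] submodule_Int[OF Ks Us]] x]) blast
    obtain k m1 where k: "linear R M M k" "m1 \<in> carrier M" "v (k (v m1)) \<noteq> \<zero>\<^bsub>M\<^esub>"
      using endo_square[OF v(1,3,4)] .
    obtain l m2 where l: "linear R M M l" "m2 \<in> carrier M" "v (k (v (l (v (k (v m2)))))) \<noteq> \<zero>\<^bsub>M\<^esub>"
      using endo_square[OF linear_comp[OF linear_comp[OF v(1) k(1)] v(1)] k(2,3)] .
    let ?y = "v (k (v m2))"
    have "?y \<in> N" using v(2)[OF linear_on_closed[OF k(1) linear_on_closed[OF v(1) l(2)]]] by blast
    then have "v (l ?y) \<in> submodule_prod R M N K"
      using submodule_prod_image[OF Ks linear_comp[OF l(1) v(1)] _ Ns] v(2) linear_on_closed[OF l(1)] by blast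
    then have "v (l ?y) \<in> perp U" using NK by blast
    from perpD[OF this linear_comp[OF k(1) v(1)]] have "v (k (v (l ?y))) = \<zero>\<^bsub>M\<^esub>"
      using v(2) linear_on_closed[OF k(1)] by blast
    then show False using l(3) by simp
  qed
qed

lemma uniform_subset_perp_perp:
  assumes U: "uniform_submodule R M U" shows "U \<subseteq> perp (perp U)"
proof -
  have Us: "submodule U R M" using U by (simp add: uniform_submodule_def)
  show ?thesis by (rule subset_perp[OF perp_fully_invariant Us]) (rule Int_perp[OF Us])
qed

text \<open>A prime Q below \<open>perp U\<close> contains the zero intersection of
  \<open>perp U\<close> with its own \<open>perp\<close>, hence one of the two. It cannot be the
  second, which contains U, since U is not inside \<open>perp U\<close>.\<close>

lemma perp_minimal_prime:
  assumes U: "uniform_submodule R M U"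
  shows "perp U \<in> minimal_primes_in R M"
  unfolding minimal_primes_in_def
proof (intro CollectI conjI allI impI perp_prime[OF U])
  fix Q assume Q: "prime_in R M Q" "Q \<subseteq> perp U"
  have "perp U \<inter> perp (perp U) \<subseteq> {\<zero>\<^bsub>M\<^esub>}" using Int_perp[OF submodule_perp] by blast
  also have "\<dots> \<subseteq> Q" using submodule_zero[of Q] Q(1) by (simp add: prime_in_def fully_invariant_def)
  finally have "perp U \<subseteq> Q \<or> perp (perp U) \<subseteq> Q"
    by (rule prime_Int[OF Q(1) perp_fully_invariant perp_fully_invariant])
  moreover have "\<not> perp (perp U) \<subseteq> Q"
    using uniform_subset_perp_perp[OF U] uniform_perp_disjoint[OF U] Q(2) by blast
  ultimately show "Q = perp U" using Q(2) by blast
qed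

end

section \<open>The minimal primes of an essential sum of uniform submodules\<close>

locale uniform_decomposition = semiprime_goldie R M
  for R :: "('a, 'r) ring_scheme" and M :: "('a, 'm) module" +
  fixes d :: nat and U :: "nat \<Rightarrow> 'm set"
  assumes uniform: "\<And>i. i < d \<Longrightarrow> uniform_submodule R M (U i)"
    and independent: "independent_submodules R M {..<d} U"
    and essential: "essential_submodule R M (submodule_generated R M (\<Union>i<d. U i))"
begin

lemma submodule_U: "i < d \<Longrightarrow> submodule (U i) R M"
  using uniform by (simp add: uniform_submodule_def)

lemma Union_U_subset: "J \<subseteq> {..<d} \<Longrightarrow> (\<Union>i\<in>J. U i) \<subseteq> carrier M"
  using submodule_subset[OF submodule_U] by (intro UN_least) auto

definition span_U where "span_U J = submodule_generated R M (\<Union>i\<in>J. U i)"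

lemma submodule_span_U: "J \<subseteq> {..<d} \<Longrightarrow> submodule (span_U J) R M"
  unfolding span_U_def by (rule submodule_submodule_generated[OF Union_U_subset])

lemma U_subset_span: "i \<in> J \<Longrightarrow> U i \<subseteq> span_U J"
  unfolding span_U_def using submodule_generated_incl by blast

lemma span_U_least: "submodule L R M \<Longrightarrow> (\<And>i. i \<in> J \<Longrightarrow> U i \<subseteq> L) \<Longrightarrow> span_U J \<subseteq> L"
  unfolding span_U_def by (rule submodule_generated_least, assumption, rule UN_least)

lemma span_U_mono: "I \<subseteq> J \<Longrightarrow> span_U I \<subseteq> span_U J"
  unfolding span_U_def by (rule submodule_generated_mono) blast

lemma span_U_empty: "span_U {} = {\<zero>\<^bsub>M\<^esub>}"
  unfolding span_U_def by (simp add: submodule_generated_empty)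

lemma span_U_insert: "i < d \<Longrightarrow> J \<subseteq> {..<d} \<Longrightarrow> span_U (insert i J) = sum_set (U i) (span_U J)"
  unfolding span_U_def using submodule_generated_Un[OF submodule_U Union_U_subset] by simp

lemma U_Int_span: "i < d \<Longrightarrow> J \<subseteq> {..<d} \<Longrightarrow> i \<notin> J \<Longrightarrow> x \<in> U i \<Longrightarrow> x \<in> span_U J \<Longrightarrow> x = \<zero>\<^bsub>M\<^esub>"
  using independent span_U_mono[of J "{..<d} - {i}"] unfolding independent_submodules_def span_U_def by blast

lemma meets_span: "submodule L R M \<Longrightarrow> x \<in> L \<Longrightarrow> x \<noteq> \<zero>\<^bsub>M\<^esub> \<Longrightarrow> \<exists>y\<in>L. y \<in> span_U {..<d} \<and> y \<noteq> \<zero>\<^bsub>M\<^esub>"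
  using essential submodule_zero[of L] submodule_zero[OF submodule_span_U, of "{..<d}"]
  unfolding essential_submodule_def span_U_def by blast

text \<open>By essentiality L may be taken inside the sum of the \<open>U i\<close>; then induct on
  the number k of members involved. Either L meets the sum of the preceding members, or the
  projection to the last one is injective on L, and L is uniform as a copy of a submodule of a
  uniform module.\<close>

lemma exists_uniform:
  assumes L: "submodule L R M" and x: "x \<in> L" "x \<noteq> \<zero>\<^bsub>M\<^esub>"
  shows "\<exists>V. uniform_submodule R M V \<and> V \<subseteq> L"
proof -
  have "\<exists>V. uniform_submodule R M V \<and> V \<subseteq> L"
    if "k \<le> d" "submodule L R M" "x \<in> L" "x \<noteq> \<zero>\<^bsub>M\<^esub>" "L \<subseteq> span_U {..<k}" for k L x
    using that
  proof (induction k arbitrary: L x)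
    case 0
    then show ?case by (auto simp: span_U_empty)
  next
    case (Suc k)
    have k: "k < d" "{..<k} \<subseteq> {..<d}" using Suc by auto
    note Sk = submodule_span_U[OF k(2)] and Uk = submodule_U[OF k(1)]
    show ?case
    proof (cases "\<exists>y\<in>L. y \<in> span_U {..<k} \<and> y \<noteq> \<zero>\<^bsub>M\<^esub>")
      case True
      then obtain y where "y \<in> L \<inter> span_U {..<k}" "y \<noteq> \<zero>\<^bsub>M\<^esub>" by blast
      from Suc.IH[OF _ submodule_Int[OF Suc.prems(2) Sk] this] k show ?thesis by auto
    next
      case False
      have LS: "L \<subseteq> sum_set (U k) (span_U {..<k})"
        using Suc.prems(5) span_U_insert[OF k] by (simp add: lessThan_Suc)
      have idl: "linear_on R M (U k) M (\<lambda>x. x)" using submodule_mem[OF Uk] by (simp add: linear_on_def Pi_def)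
      obtain \<pi> where \<pi>: "linear_on R M (sum_set (U k) (span_U {..<k})) M \<pi>"
        "\<And>u v. u \<in> U k \<Longrightarrow> v \<in> span_U {..<k} \<Longrightarrow> \<pi> (u \<oplus>\<^bsub>M\<^esub> v) = u \<oplus>\<^bsub>M\<^esub> \<zero>\<^bsub>M\<^esub>"
        using MM.linear_on_glue[OF Uk Sk _ idl MM.linear_zero] U_Int_span[OF k] by (metis lessThan_iff less_irrefl)
      have \<pi>L: "linear_on R M L M \<pi>" by (rule linear_on_subset[OF \<pi>(1) LS])
      have \<pi>U: "\<pi> x \<in> U k \<and> (\<pi> x = \<zero>\<^bsub>M\<^esub> \<longrightarrow> x = \<zero>\<^bsub>M\<^esub>)" if x: "x \<in> L" for x
      proof -
        obtain u v where uv: "u \<in> U k" "v \<in> span_U {..<k}" "x = u \<oplus>\<^bsub>M\<^esub> v" using LS x by (meson subsetD sum_setE)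
        have "\<pi> x = u" using \<pi>(2)[OF uv(1,2)] uv submodule_mem[OF Uk] by simp
        moreover have "x = \<zero>\<^bsub>M\<^esub>" if "u = \<zero>\<^bsub>M\<^esub>"
        proof -
          have "x = v" using uv that submodule_mem[OF Sk] by simp
          then show ?thesis using False x uv(2) by blast
        qed
        ultimately show ?thesis using uv(1) by blast
      qed
      have inj: "inj_on \<pi> L" unfolding MM.inj_on_iff_kernel[OF \<pi>L Suc.prems(2)] using \<pi>U by blast
      have "uniform_submodule R M L" unfolding uniform_submodule_def
      proof (intro conjI allI impI)
        fix A B assume A: "submodule A R M" "A \<subseteq> L" "A \<noteq> {\<zero>\<^bsub>M\<^esub>}" and B: "submodule B R M" "B \<subseteq> L" "B \<noteq> {\<zero>\<^bsub>M\<^esub>}"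
        have img: "submodule (\<pi> ` C) R M \<and> \<pi> ` C \<subseteq> U k \<and> \<pi> ` C \<noteq> {\<zero>\<^bsub>M\<^esub>}"
          if C: "submodule C R M" "C \<subseteq> L" "C \<noteq> {\<zero>\<^bsub>M\<^esub>}" for C
        proof -
          obtain x where x: "x \<in> C" "x \<noteq> \<zero>\<^bsub>M\<^esub>" using nonzero_submodule[OF C(1,3)] by blast
          then have "\<pi> x \<noteq> \<zero>\<^bsub>M\<^esub>" using \<pi>U C(2) by blast
          then have "\<pi> ` C \<noteq> {\<zero>\<^bsub>M\<^esub>}" using x(1) by blast
          moreover have "\<pi> ` C \<subseteq> U k" using \<pi>U C(2) by blast
          ultimately show ?thesis using MM.submodule_image[OF linear_on_subset[OF \<pi>L C(2)] C(1)] by simp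
        qed
        have "\<pi> ` A \<inter> \<pi> ` B \<noteq> {\<zero>\<^bsub>M\<^esub>}"
          using uniform[OF k(1)] img[OF A] img[OF B] unfolding uniform_submodule_def by simp
        moreover have "\<pi> ` A \<inter> \<pi> ` B = \<pi> ` (A \<inter> B)" by (rule inj_on_image_Int[OF inj A(2) B(2), symmetric])
        moreover have "\<pi> ` {\<zero>\<^bsub>M\<^esub>} = {\<zero>\<^bsub>M\<^esub>}" using MM.linear_on_zero[OF \<pi>L Suc.prems(2)] by simp
        ultimately show "A \<inter> B \<noteq> {\<zero>\<^bsub>M\<^esub>}" by metis
      qed (use Suc.prems in blast)+
      then show ?thesis by blast
    qed
  qed
  from this[OF order_refl submodule_Int[OF L submodule_span_U]]
  show ?thesis using meets_span[OF L x] by (meson IntI Int_iff order_refl inf_le2 subset_trans inf_le1)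
qed

text \<open>Let X be the intersection of all \<open>perp (U i)\<close>. Each \<open>U i\<close>
  meets X trivially and so lies in \<open>perp X\<close>, which therefore contains their essential
  sum. A nonzero X would meet that sum, hence \<open>perp X\<close>, nontrivially.\<close>

lemma Inter_perp_zero:
  assumes L: "submodule L R M" and LP: "\<And>i. i < d \<Longrightarrow> L \<subseteq> perp (U i)" and x: "x \<in> L"
  shows "x = \<zero>\<^bsub>M\<^esub>"
proof -
  define X where "X = carrier M \<inter> (\<Inter>i<d. perp (U i))"
  have X: "fully_invariant R M X" unfolding X_def by (rule fully_invariant_Inter_perp)
  note Xs = fully_invariant_submodule[OF X]
  have "U i \<subseteq> perp X" if i: "i < d" for i
    by (rule subset_perp[OF X submodule_U[OF i]]) (use Int_perp[OF submodule_U[OF i]] i in \<open>auto simp: X_def\<close>)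
  then have sp: "span_U {..<d} \<subseteq> perp X" by (intro span_U_least submodule_perp) simp
  show ?thesis
  proof (rule ccontr)
    assume "x \<noteq> \<zero>\<^bsub>M\<^esub>"
    moreover have "x \<in> X" using LP x submodule_mem[OF L x] by (auto simp: X_def)
    ultimately obtain y where "y \<in> X" "y \<in> span_U {..<d}" "y \<noteq> \<zero>\<^bsub>M\<^esub>" using meets_span[OF Xs] by blast
    then show False using Int_perp[OF Xs] sp by blast
  qed
qed

text \<open>The finitely many \<open>perp (U i)\<close> intersect in zero, which lies in Q. So
  primeness puts one of them below Q, and minimality of Q makes the two equal.\<close>

lemma minimal_prime_eq_perp:
  assumes Q: "Q \<in> minimal_primes_in R M"
  obtains i where "i < d" "Q = perp (U i)"
proof -
  have Qp: "prime_in R M Q" and Qm: "\<And>P. prime_in R M P \<Longrightarrow> P \<subseteq> Q \<Longrightarrow> P = Q"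
    using Q by (auto simp: minimal_primes_in_def)
  have Qs: "submodule Q R M" and Qne: "Q \<noteq> carrier M"
    using Qp by (auto simp: prime_in_def fully_invariant_def)
  \<comment> \<open>For k = 0 this is M itself, which is not contained in a prime; that starts the
    induction.\<close>
  define X where "X k = carrier M \<inter> (\<Inter>i<k. perp (U i))" for k :: nat
  have X: "fully_invariant R M (X k)" for k unfolding X_def by (rule fully_invariant_Inter_perp)
  have "X k \<subseteq> Q \<Longrightarrow> \<exists>i<k. perp (U i) \<subseteq> Q" for k
  proof (induction k)
    case 0
    then show ?case using Qne submodule_subset[OF Qs] by (auto simp: X_def)
  next
    case (Suc k)
    have "X (Suc k) = X k \<inter> perp (U k)" by (auto simp: X_def lessThan_Suc)
    then have "X k \<subseteq> Q \<or> perp (U k) \<subseteq> Q" using prime_Int[OF Qp X perp_fully_invariant] Suc.prems by simp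
    then show ?case using Suc.IH less_Suc_eq by blast
  qed
  moreover have "X d \<subseteq> Q"
  proof
    fix x assume "x \<in> X d"
    then have "x = \<zero>\<^bsub>M\<^esub>" by (rule Inter_perp_zero[OF fully_invariant_submodule[OF X], rotated]) (auto simp: X_def)
    then show "x \<in> Q" using submodule_zero[OF Qs] by simp
  qed
  ultimately obtain i where "i < d" "perp (U i) \<subseteq> Q" by blast
  then show ?thesis using that Qm[OF perp_prime[OF uniform]] by metis
qed

text \<open>P is itself a \<open>perp\<close>, and taking \<open>perp\<close> three times gives the
  same as taking it once.\<close>

lemma perp_perp_minimal_prime:
  assumes P: "P \<in> minimal_primes_in R M" shows "perp (perp P) = P"
proof -
  obtain i where i: "i < d" "P = perp (U i)" using minimal_prime_eq_perp[OF P] .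
  show ?thesis
  proof
    show "perp (perp P) \<subseteq> P"
      using perp_antimono[OF uniform_subset_perp_perp[OF uniform[OF i(1)]]] i(2) by simp
    show "P \<subseteq> perp (perp P)"
      unfolding i(2) by (rule subset_perp[OF perp_fully_invariant submodule_perp]) (rule Int_perp[OF submodule_perp])
  qed
qed

lemma minimal_prime_fully_invariant: "P \<in> minimal_primes_in R M \<Longrightarrow> fully_invariant R M P"
  by (simp add: minimal_primes_in_def prime_in_def)

lemmas minimal_prime_submodule = minimal_prime_fully_invariant[THEN fully_invariant_submodule]

text \<open>The intersection of \<open>perp P\<close> and \<open>perp Q\<close> meets P trivially.
  As Q is prime and does not contain P, this intersection lies in Q; but it also lies in
  \<open>perp Q\<close>.\<close>

lemma perp_Int_perp:
  assumes P: "P \<in> minimal_primes_in R M" and Q: "Q \<in> minimal_primes_in R M" and ne: "P \<noteq> Q"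
    and x: "x \<in> perp P" "x \<in> perp Q"
  shows "x = \<zero>\<^bsub>M\<^esub>"
proof -
  have V: "fully_invariant R M (perp P \<inter> perp Q)"
    using perp_fully_invariant[of P] perp_fully_invariant[of Q] submodule_Int[OF submodule_perp submodule_perp]
    unfolding fully_invariant_def by blast
  have Qp: "prime_in R M Q" using Q by (simp add: minimal_primes_in_def)
  have "(perp P \<inter> perp Q) \<inter> P \<subseteq> {\<zero>\<^bsub>M\<^esub>}" using Int_perp[OF minimal_prime_submodule[OF P]] by blast
  also have "\<dots> \<subseteq> Q" using submodule_zero[OF minimal_prime_submodule[OF Q]] by blast
  finally have "perp P \<inter> perp Q \<subseteq> Q \<or> P \<subseteq> Q"
    by (rule prime_Int[OF Qp V minimal_prime_fully_invariant[OF P]])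
  moreover have "\<not> P \<subseteq> Q" using P Q ne by (auto simp: minimal_primes_in_def)
  ultimately show ?thesis using x Int_perp[OF minimal_prime_submodule[OF Q]] by blast
qed

text \<open>If L met no \<open>perp P\<close>, it would lie in P, the \<open>perp\<close> of
  \<open>perp P\<close>, for every minimal prime P. In particular it would lie in every
  \<open>perp (U i)\<close>, and these intersect in zero.\<close>

lemma meets_perp:
  assumes L: "submodule L R M" and x: "x \<in> L" "x \<noteq> \<zero>\<^bsub>M\<^esub>"
  obtains P y where "P \<in> minimal_primes_in R M" "y \<in> L" "y \<in> perp P" "y \<noteq> \<zero>\<^bsub>M\<^esub>"
proof (rule ccontr)
  note found = that
  assume nt: "\<not> thesis"
  have *: "y = \<zero>\<^bsub>M\<^esub>" if "P \<in> minimal_primes_in R M" "y \<in> L" "y \<in> perp P" for P y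
    using found[OF that] nt by blast
  have "L \<subseteq> perp (U i)" if i: "i < d" for i
  proof -
    note m = perp_minimal_prime[OF uniform[OF i]]
    have "L \<subseteq> perp (perp (perp (U i)))"
      by (rule subset_perp[OF perp_fully_invariant L]) (rule *[OF m])
    then show ?thesis by (simp add: perp_perp_minimal_prime[OF m])
  qed
  then show False using Inter_perp_zero[OF L _ x(1)] x(2) by blast
qed

lemma meets_perp_minimal_prime:
  assumes P: "P \<in> minimal_primes_in R M" and L: "submodule L R M" and nP: "\<not> L \<subseteq> P"
  obtains y where "y \<in> L" "y \<in> perp P" "y \<noteq> \<zero>\<^bsub>M\<^esub>"
  using subset_perp[OF perp_fully_invariant[of P] L] nP perp_perp_minimal_prime[OF P] by blast

text \<open>The block of uniform submodules that belong to P; it yields the idempotents of the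
  simple ring attached to P.\<close>

definition index_set where "index_set P = {i. i < d \<and> perp (U i) = P}"

lemma index_set_subset: "index_set P \<subseteq> {..<d}" by (auto simp: index_set_def)

lemma U_subset_perp: "i \<in> index_set P \<Longrightarrow> U i \<subseteq> perp P"
  using uniform_subset_perp_perp[OF uniform] by (auto simp: index_set_def)

lemma span_index_subset_perp: "span_U (index_set P) \<subseteq> perp P"
  by (rule span_U_least[OF submodule_perp U_subset_perp])

text \<open>The members of U outside the block of P lie in P. An element y of L in the full sum is
  thus w + p with w in the span of the block and p in P. Since y and w lie in \<open>perp P\<close>,
  so does p, and p is zero.\<close>

lemma perp_meets_span:
  assumes P: "P \<in> minimal_primes_in R M" and L: "submodule L R M" "L \<subseteq> perp P" and x: "x \<in> L" "x \<noteq> \<zero>\<^bsub>M\<^esub>"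
  obtains y where "y \<in> L" "y \<in> span_U (index_set P)" "y \<noteq> \<zero>\<^bsub>M\<^esub>"
proof -
  obtain y where y: "y \<in> L" "y \<in> span_U {..<d}" "y \<noteq> \<zero>\<^bsub>M\<^esub>" using meets_span[OF L(1) x] by blast
  note S = submodule_span_U[OF index_set_subset, of P] and Ps = minimal_prime_submodule[OF P]
  have "U i \<subseteq> sum_set (span_U (index_set P)) P" if i: "i < d" for i
  proof (cases "i \<in> index_set P")
    case True
    then show ?thesis using U_subset_span sum_set_left[OF S Ps] by blast
  next
    case False
    \<comment> \<open>Outside the block, \<open>U i\<close> sits in the \<open>perp\<close> of
      another minimal prime, which meets \<open>perp P\<close> trivially.\<close>
    have "U i \<subseteq> perp (perp P)"
    proof (rule subset_perp[OF perp_fully_invariant submodule_U[OF i]])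
      fix z assume "z \<in> perp P" "z \<in> U i"
      then show "z = \<zero>\<^bsub>M\<^esub>"
        using perp_Int_perp[OF P perp_minimal_prime[OF uniform[OF i]]] uniform_subset_perp_perp[OF uniform[OF i]] False i
        unfolding index_set_def by blast
    qed
    then show ?thesis using perp_perp_minimal_prime[OF P] sum_set_right[OF S Ps] by blast
  qed
  then have "span_U {..<d} \<subseteq> sum_set (span_U (index_set P)) P"
    by (intro span_U_least submodule_sum_set S Ps) simp
  then obtain w p where wp: "w \<in> span_U (index_set P)" "p \<in> P" "y = w \<oplus>\<^bsub>M\<^esub> p" using y(2) by (meson subsetD sum_setE)
  have c: "w \<in> carrier M" "p \<in> carrier M" "y \<in> carrier M"
    using submodule_mem[OF S wp(1)] submodule_mem[OF Ps wp(2)] submodule_mem[OF L(1) y(1)] .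
  have "y \<ominus>\<^bsub>M\<^esub> w = p"
    using wp(3) c by (simp add: a_minus_def M.add.m_ac M.r_neg)
  moreover have "y \<ominus>\<^bsub>M\<^esub> w \<in> perp P"
    using y(1) L(2) wp(1) span_index_subset_perp by (intro submodule_minus[OF submodule_perp]) blast+
  ultimately have "p = \<zero>\<^bsub>M\<^esub>" using Int_perp[OF Ps wp(2)] by simp
  then have "y = w" using wp(3) c by simp
  then show ?thesis using that y wp(1) by blast
qed

end

section \<open>Rings with a complete system of primitive idempotents\<close>

context ring
begin

section \<open>Right ideals and descending chains\<close>

definition stable_below where
  "stable_below A \<longleftrightarrow> (\<forall>I :: nat \<Rightarrow> 'a set. (\<forall>k. right_ideal (I k) R \<and> I (Suc k) \<subseteq> I k \<and> I k \<subseteq> A) \<longrightarrow> (\<exists>k. \<forall>l\<ge>k. I l = I k))"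

lemma right_ideal_subset: "right_ideal I R \<Longrightarrow> I \<subseteq> carrier R"
  by (simp add: right_ideal_def additive_subgroup.a_subset)

lemma right_ideal_zero: "right_ideal I R \<Longrightarrow> \<zero> \<in> I"
  by (simp add: right_ideal_def additive_subgroup.zero_closed)

lemma right_ideal_add: "right_ideal I R \<Longrightarrow> x \<in> I \<Longrightarrow> y \<in> I \<Longrightarrow> x \<oplus> y \<in> I"
  by (simp add: right_ideal_def additive_subgroup.a_closed)

lemma right_ideal_neg: "right_ideal I R \<Longrightarrow> x \<in> I \<Longrightarrow> \<ominus> x \<in> I"
  by (simp add: right_ideal_def additive_subgroup.a_inv_closed abelian_group_axioms)

lemma right_ideal_mult: "right_ideal I R \<Longrightarrow> x \<in> I \<Longrightarrow> r \<in> carrier R \<Longrightarrow> x \<otimes> r \<in> I"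
  by (simp add: right_ideal_def)

lemma right_idealI:
  assumes "I \<subseteq> carrier R" "\<zero> \<in> I" "\<And>x y. x \<in> I \<Longrightarrow> y \<in> I \<Longrightarrow> x \<oplus> y \<in> I"
    "\<And>x r. x \<in> I \<Longrightarrow> r \<in> carrier R \<Longrightarrow> x \<otimes> r \<in> I"
  shows "right_ideal I R"
proof -
  have "\<ominus> x \<in> I" if "x \<in> I" for x
  proof -
    have "x \<otimes> (\<ominus> \<one>) \<in> I" using assms(4) that by simp
    then show ?thesis using assms(1) that by (simp add: r_minus subset_iff)
  qed
  then have "subgroup I (add_monoid R)"
    using assms by (intro subgroup.intro) (auto simp: a_inv_def)
  then show ?thesis using assms by (simp add: right_ideal_def additive_subgroup_def)
qed

lemma add_minus_cancel: "p \<in> carrier R \<Longrightarrow> q \<in> carrier R \<Longrightarrow> (p \<ominus> q) \<oplus> q = p"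
  by (simp add: a_minus_def a_assoc l_neg)

lemma decreasing_chain: "(\<And>k. I (Suc k) \<subseteq> I k) \<Longrightarrow> l \<le> m \<Longrightarrow> I m \<subseteq> I l" for I :: "nat \<Rightarrow> 's set"
  by (rule lift_Suc_antimono_le)

end

text \<open>For a finite orthogonal family of idempotents, \<open>e_faithful\<close> says that they
  add up to one, and \<open>e_simple\<close> that each right ideal \<open>e i Q\<close> is minimal.
  In this form both conditions can be checked on maps, without forming sums over J.\<close>

locale idempotent_system = ring Q for Q (structure) +
  fixes J :: "'i set" and e :: "'i \<Rightarrow> 'a"
  assumes finite_J: "finite J"
    and e_closed: "\<And>i. i \<in> J \<Longrightarrow> e i \<in> carrier Q"
    and e_faithful: "\<And>q. q \<in> carrier Q \<Longrightarrow> (\<And>i. i \<in> J \<Longrightarrow> e i \<otimes> q = \<zero>) \<Longrightarrow> q = \<zero>"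
    and e_idem: "\<And>i. i \<in> J \<Longrightarrow> e i \<otimes> e i = e i"
    and e_orth: "\<And>i j. i \<in> J \<Longrightarrow> j \<in> J \<Longrightarrow> i \<noteq> j \<Longrightarrow> e i \<otimes> e j = \<zero>"
    and e_simple: "\<And>i q. i \<in> J \<Longrightarrow> q \<in> carrier Q \<Longrightarrow> e i \<otimes> q \<noteq> \<zero> \<Longrightarrow> \<exists>r\<in>carrier Q. e i \<otimes> q \<otimes> r = e i"
begin

text \<open>The right ideal generated by the idempotents with index in T. It grows from zero to the
  whole ring as T grows from the empty set to J.\<close>

definition corner where "corner T = {q \<in> carrier Q. \<forall>i\<in>J - T. e i \<otimes> q = \<zero>}"

lemma corner_J: "corner J = carrier Q" by (auto simp: corner_def)

lemma corner_right_ideal: "right_ideal (corner T) Q"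
  by (rule right_idealI) (auto simp: corner_def e_closed r_distr m_assoc[symmetric])

lemma corner_minus: "p \<in> corner T \<Longrightarrow> q \<in> corner T \<Longrightarrow> p \<ominus> q \<in> corner T"
  unfolding a_minus_def using corner_right_ideal right_ideal_add right_ideal_neg by blast

lemma corner_insert:
  assumes k: "k \<in> J" and p: "p \<in> corner (insert k T)" and z: "e k \<otimes> p = \<zero>"
  shows "p \<in> corner T"
  using p z by (auto simp: corner_def)

text \<open>Adding k to T adds one minimal right ideal \<open>e k Q\<close> to the corner. If the
  chain enters \<open>corner T\<close>, the induction hypothesis applies. Otherwise every ideal of
  the chain maps onto \<open>e k Q\<close> under left multiplication by \<open>e k\<close>, so
  comparable members with the same intersection with \<open>corner T\<close> are equal, and these
  intersections become stationary.\<close>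

lemma stable_below_corner: "T \<subseteq> J \<Longrightarrow> stable_below (corner T)"
proof (induction T rule: infinite_finite_induct)
  case (infinite T)
  then show ?case using finite_J finite_subset by blast
next
  case empty
  have "corner {} \<subseteq> {\<zero>}" using e_faithful by (auto simp: corner_def)
  show ?case unfolding stable_below_def
  proof (intro allI impI)
    fix I :: "nat \<Rightarrow> 'a set" assume I: "\<forall>k. right_ideal (I k) Q \<and> I (Suc k) \<subseteq> I k \<and> I k \<subseteq> corner {}"
    have "I k = {\<zero>}" for k
      using I \<open>corner {} \<subseteq> {\<zero>}\<close> right_ideal_zero[of "I k"] by blast
    then show "\<exists>k. \<forall>l\<ge>k. I l = I k" by simp
  qed
next
  case (insert k T)
  then have k: "k \<in> J" and st: "stable_below (corner T)" by auto
  show ?case unfolding stable_below_def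
  proof (intro allI impI)
    fix I :: "nat \<Rightarrow> 'a set" assume I: "\<forall>m. right_ideal (I m) Q \<and> I (Suc m) \<subseteq> I m \<and> I m \<subseteq> corner (insert k T)"
    have Ir: "right_ideal (I m) Q" and Is: "I (Suc m) \<subseteq> I m" and IT: "I m \<subseteq> corner (insert k T)" for m
      using I by blast+
    show "\<exists>m. \<forall>l\<ge>m. I l = I m"
    proof (cases "\<exists>m. I m \<subseteq> corner T")
      case True
      then obtain m where m: "I m \<subseteq> corner T" ..
      have dec: "I (n + m) \<subseteq> I m" for n by (rule decreasing_chain) (rule Is, simp)
      have "I (n + m) \<subseteq> corner T" for n using dec m by (rule order_trans)
      then have "\<exists>n. \<forall>l\<ge>n. I (l + m) = I (n + m)"
        using st[unfolded stable_below_def, rule_format, of "\<lambda>n. I (n + m)"] Ir Is by simp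
      then obtain n where n: "\<And>l. l \<ge> n \<Longrightarrow> I (l + m) = I (n + m)" by blast
      have "I l = I (n + m)" if "l \<ge> n + m" for l
        using n[of "l - m"] that by simp
      then show ?thesis by blast
    next
      case False
      have "right_ideal (I n \<inter> corner T) Q" for n
      proof (rule right_idealI)
        show "I n \<inter> corner T \<subseteq> carrier Q" using right_ideal_subset[OF Ir] by blast
      qed (use right_ideal_zero[OF Ir] right_ideal_zero[OF corner_right_ideal] right_ideal_add[OF Ir]
           right_ideal_add[OF corner_right_ideal] right_ideal_mult[OF Ir] right_ideal_mult[OF corner_right_ideal] in auto)
      then have "\<exists>m. \<forall>l\<ge>m. I l \<inter> corner T = I m \<inter> corner T"
        using st[unfolded stable_below_def, rule_format, of "\<lambda>n. I n \<inter> corner T"] Is by (simp add: le_infI1)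
      then obtain m where m: "\<And>l. l \<ge> m \<Longrightarrow> I l \<inter> corner T = I m \<inter> corner T" by blast
      have "I l = I m" if l: "l \<ge> m" for l
      proof
        show lm: "I l \<subseteq> I m" by (rule decreasing_chain) (rule Is, rule l)
        show "I m \<subseteq> I l"
        proof
          fix p assume p: "p \<in> I m"
          have pc: "p \<in> carrier Q" using right_ideal_subset[OF Ir] p by blast
          obtain q where q: "q \<in> I l" "q \<notin> corner T" using False by blast
          have qc: "q \<in> carrier Q" using right_ideal_subset[OF Ir] q by blast
          have "e k \<otimes> q \<noteq> \<zero>" using corner_insert[OF k] q IT by blast
          then obtain r where r: "r \<in> carrier Q" "e k \<otimes> q \<otimes> r = e k" using e_simple[OF k qc] by blast
          \<comment> \<open>An element of the smaller ideal with the same \<open>e k\<close>-part as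
            p, so that the difference falls into \<open>corner T\<close>.\<close>
          let ?s = "q \<otimes> (r \<otimes> p)"
          have s: "?s \<in> I l" by (rule right_ideal_mult[OF Ir q(1)]) (simp add: r pc)
          have sc: "?s \<in> carrier Q" by (simp add: r pc qc)
          have "e k \<otimes> ?s = e k \<otimes> q \<otimes> r \<otimes> p" by (simp add: e_closed k r(1) pc qc m_assoc)
          then have es: "e k \<otimes> ?s = e k \<otimes> p" unfolding r(2) .
          have "e k \<otimes> (p \<ominus> ?s) = e k \<otimes> p \<oplus> \<ominus> (e k \<otimes> ?s)"
            using e_closed[OF k] pc sc unfolding a_minus_def by (simp only: r_distr r_minus a_inv_closed)
          then have "e k \<otimes> (p \<ominus> ?s) = \<zero>" unfolding es using e_closed[OF k] pc by (simp add: r_neg)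
          moreover have "p \<ominus> ?s \<in> corner (insert k T)"
            by (rule corner_minus) (use IT p s in blast)+
          ultimately have "p \<ominus> ?s \<in> corner T" using corner_insert[OF k] by blast
          moreover have "p \<ominus> ?s \<in> I m"
            unfolding a_minus_def using p s lm by (intro right_ideal_add[OF Ir] right_ideal_neg[OF Ir]) blast+
          ultimately have "p \<ominus> ?s \<in> I l" using m[OF l] by blast
          from right_ideal_add[OF Ir this s] show "p \<in> I l" by (simp add: add_minus_cancel pc sc)
        qed
      qed
      then show ?thesis by blast
    qed
  qed
qed

theorem right_artinian: "right_artinian Q"
  unfolding right_artinian_def
proof (intro conjI ring_axioms allI impI)
  fix I :: "nat \<Rightarrow> 'a set" assume I: "\<forall>k. right_ideal (I k) Q \<and> I (Suc k) \<subseteq> I k"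
  then have "\<forall>k. right_ideal (I k) Q \<and> I (Suc k) \<subseteq> I k \<and> I k \<subseteq> corner J"
    using right_ideal_subset corner_J by blast
  then show "\<exists>k. \<forall>l\<ge>k. I l = I k" using stable_below_corner[of J] unfolding stable_below_def by blast
qed

text \<open>A nonzero ideal contains some \<open>e i\<close>, because \<open>e i Q\<close> is
  minimal; the links carry this over to every \<open>e j\<close>.\<close>

theorem simple_ring:
  assumes ne: "\<one> \<noteq> \<zero>"
    and linked: "\<And>i j. i \<in> J \<Longrightarrow> j \<in> J \<Longrightarrow> \<exists>q\<in>carrier Q. e i \<otimes> q \<otimes> e j \<noteq> \<zero>"
  shows "simple_ring Q"
  unfolding simple_ring_def
proof (intro conjI ring_axioms ne allI impI)
  fix I assume I: "ideal I Q"
  interpret I: ideal I Q by fact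
  show "I = {\<zero>} \<or> I = carrier Q"
  proof (cases "I = {\<zero>}")
    case False
    then obtain f where f: "f \<in> I" "f \<noteq> \<zero>" using I.zero_closed by blast
    have fc: "f \<in> carrier Q" using f(1) I.a_subset by blast
    obtain i where i: "i \<in> J" "e i \<otimes> f \<noteq> \<zero>" using e_faithful[OF fc] f(2) by blast
    obtain r where r: "r \<in> carrier Q" "e i \<otimes> f \<otimes> r = e i" using e_simple[OF i(1) fc i(2)] by blast
    have "e i \<otimes> f \<otimes> r \<in> I" by (intro I.I_r_closed I.I_l_closed f r e_closed i)
    then have ei: "e i \<in> I" unfolding r(2) .
    have ej: "e j \<in> I" if j: "j \<in> J" for j
    proof -
      obtain q where q: "q \<in> carrier Q" "e j \<otimes> q \<otimes> e i \<noteq> \<zero>" using linked[OF j i(1)] by blast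
      have qe: "q \<otimes> e i \<in> carrier Q" by (simp add: q e_closed i)
      have "e j \<otimes> (q \<otimes> e i) \<noteq> \<zero>" using q by (simp add: m_assoc e_closed i j)
      then obtain s where s: "s \<in> carrier Q" "e j \<otimes> (q \<otimes> e i) \<otimes> s = e j" using e_simple[OF j qe] by blast
      have "e j \<otimes> (q \<otimes> e i) \<otimes> s \<in> I" by (intro I.I_r_closed I.I_l_closed ei s q e_closed j)
      then show ?thesis unfolding s(2) .
    qed
    \<comment> \<open>An element of \<open>corner (insert k T)\<close> is its
      \<open>e k\<close>-part, which lies in I, plus an element of \<open>corner T\<close>. This
      takes the place of writing one as the sum of the idempotents.\<close>
    have "T \<subseteq> J \<Longrightarrow> corner T \<subseteq> I" for T
    proof (induction T rule: infinite_finite_induct)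
      case (infinite T)
      then show ?case using finite_J finite_subset by blast
    next
      case empty
      show ?case
      proof
        fix p assume "p \<in> corner {}"
        then have "p \<in> carrier Q" "\<And>i. i \<in> J \<Longrightarrow> e i \<otimes> p = \<zero>" by (auto simp: corner_def)
        then have "p = \<zero>" by (rule e_faithful)
        then show "p \<in> I" using I.zero_closed by simp
      qed
    next
      case (insert k T)
      then have k: "k \<in> J" by auto
      show ?case
      proof
        fix p assume p: "p \<in> corner (insert k T)"
        then have pc: "p \<in> carrier Q" by (simp add: corner_def)
        have ep: "e k \<otimes> p \<in> I" by (rule I.I_r_closed[OF ej[OF k] pc])
        have epc: "e k \<otimes> p \<in> carrier Q" by (simp add: e_closed k pc)
        have "e i \<otimes> (e k \<otimes> p) = \<zero>" if "i \<in> J - insert k T" for i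
        proof -
          have i: "i \<in> J" "i \<noteq> k" using that by auto
          have "e i \<otimes> (e k \<otimes> p) = (e i \<otimes> e k) \<otimes> p"
            by (rule m_assoc[symmetric]) (rule e_closed[OF i(1)], rule e_closed[OF k], rule pc)
          then show ?thesis using e_orth[OF i(1) k i(2)] pc by simp
        qed
        then have "e k \<otimes> p \<in> corner (insert k T)" unfolding corner_def using epc by blast
        then have "p \<ominus> e k \<otimes> p \<in> corner (insert k T)" by (rule corner_minus[OF p])
        moreover have "e k \<otimes> (p \<ominus> e k \<otimes> p) = \<zero>"
        proof -
          have "e k \<otimes> (e k \<otimes> p) = (e k \<otimes> e k) \<otimes> p"
            by (rule m_assoc[symmetric]) (rule e_closed[OF k], rule e_closed[OF k], rule pc)
          then have "e k \<otimes> (e k \<otimes> p) = e k \<otimes> p" by (simp add: e_idem[OF k])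
          then show ?thesis unfolding a_minus_def using e_closed[OF k] pc epc by (simp add: r_distr r_minus r_neg)
        qed
        ultimately have "p \<ominus> e k \<otimes> p \<in> corner T" using corner_insert[OF k] by blast
        then have "p \<ominus> e k \<otimes> p \<in> I" using insert by blast
        from I.a_closed[OF this ep] show "p \<in> I" by (simp add: add_minus_cancel pc epc)
      qed
    qed
    then have "carrier Q \<subseteq> I" using corner_J by blast
    then show ?thesis using I.a_subset by blast
  qed simp
qed

end

text \<open>The right ideals generated by the powers of f become stationary, so f^k = f^(k+1) q for
  some k and q. Cancelling powers of f on the left gives f q = 1, and then f q f = f gives q f =
  1.\<close>

lemma (in ring) left_cancellable_unit:
  assumes art: "right_artinian R" and f: "f \<in> carrier R"
    and can: "\<And>x. x \<in> carrier R \<Longrightarrow> f \<otimes> x = \<zero> \<Longrightarrow> x = \<zero>"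
  shows "f \<in> Units R"
proof -
  have can': "x = y" if "x \<in> carrier R" "y \<in> carrier R" "f \<otimes> x = f \<otimes> y" for x y
  proof -
    have "f \<otimes> (x \<ominus> y) = \<zero>" using that f by (simp add: a_minus_def r_distr r_minus r_neg)
    then have "x \<ominus> y = \<zero>" using can that by simp
    then show ?thesis using add_minus_cancel[OF that(1,2)] that(2) by simp
  qed
  define I where "I n = (\<lambda>x. f [^] n \<otimes> x) ` carrier R" for n :: nat
  have fn: "f [^] n \<in> carrier R" for n :: nat using f by simp
  have "right_ideal (I n) R" for n
  proof (rule right_idealI)
    show "\<zero> \<in> I n" unfolding I_def using fn[of n] by (auto intro!: image_eqI[of _ _ \<zero>])
    show "x \<oplus> y \<in> I n" if "x \<in> I n" "y \<in> I n" for x y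
      using that fn[of n] unfolding I_def by (auto simp: r_distr[symmetric])
    show "x \<otimes> r \<in> I n" if "x \<in> I n" "r \<in> carrier R" for x r
      using that fn[of n] unfolding I_def by (auto simp: m_assoc)
  qed (use fn in \<open>auto simp: I_def\<close>)
  moreover have "I (Suc n) \<subseteq> I n" for n
    unfolding I_def using f fn[of n] by (auto simp: m_assoc)
  ultimately obtain k where k: "\<forall>l\<ge>k. I l = I k" using art unfolding right_artinian_def by blast
  have "f [^] k \<in> I k" unfolding I_def using fn[of k] by (auto intro!: image_eqI[of _ _ \<one>])
  also have "I k = I (Suc k)" by (rule k[rule_format, symmetric]) simp
  finally obtain q where q: "q \<in> carrier R" "f [^] k = f [^] Suc k \<otimes> q" unfolding I_def by blast
  have "x = y" if "x \<in> carrier R" "y \<in> carrier R" "f [^] n \<otimes> x = f [^] n \<otimes> y" for n :: nat and x y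
    using that
  proof (induction n arbitrary: x y)
    case (Suc n)
    have "f \<otimes> x = f \<otimes> y" by (rule Suc.IH) (use Suc.prems f fn[of n] in \<open>auto simp: m_assoc\<close>)
    then show ?case by (rule can'[OF Suc.prems(1,2)])
  qed simp
  note power_cancel = this
  have fqc: "f \<otimes> q \<in> carrier R" using f q(1) by simp
  have "f [^] k \<otimes> \<one> = f [^] k \<otimes> (f \<otimes> q)" using q f fn[of k] by (simp add: m_assoc)
  from power_cancel[OF one_closed fqc this] have fq: "f \<otimes> q = \<one>" by simp
  have "f \<otimes> (q \<otimes> f) = f \<otimes> \<one>" using fq f q by (simp add: m_assoc[symmetric])
  then have "q \<otimes> f = \<one>" by (rule can'[rotated -1]) (use f q in auto)
  then show ?thesis using fq f q(1) by (auto simp: Units_def)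
qed

lemma (in ring) minimal_right_ideal:
  assumes art: "right_artinian R" and ne: "a \<in> A" and ri: "\<And>x. x \<in> A \<Longrightarrow> right_ideal (F x) R"
  obtains x where "x \<in> A" "\<And>y. y \<in> A \<Longrightarrow> \<not> F y \<subset> F x"
proof (rule ccontr)
  note found = that
  assume nt: "\<not> thesis"
  then have step: "\<exists>y. y \<in> A \<and> F y \<subset> F x" if "x \<in> A" for x using found[OF that] nt by blast
  have "\<exists>f. \<forall>n. f n \<in> A \<and> F (f (Suc n)) \<subset> F (f n)"
    by (rule dependent_nat_choice) (use ne step in blast)+
  then obtain f where f: "\<And>n. f n \<in> A" "\<And>n. F (f (Suc n)) \<subset> F (f n)" by blast
  have "\<forall>n. right_ideal (F (f n)) R \<and> F (f (Suc n)) \<subseteq> F (f n)" using f ri by blast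
  then have "\<exists>k. \<forall>l\<ge>k. F (f l) = F (f k)"
    using art[unfolded right_artinian_def, THEN conjunct2, rule_format, of "\<lambda>n. F (f n)"] by blast
  then obtain k where k: "\<forall>l\<ge>k. F (f l) = F (f k)" ..
  have "F (f (Suc k)) = F (f k)" by (rule k[rule_format]) simp
  then show False using f(2)[of k] by simp
qed

section \<open>The hull of \<open>M/P\<close> for a minimal prime \<open>P\<close>\<close>

locale prime_hull = uniform_decomposition R M d U
  for R :: "('a, 'r) ring_scheme" and M :: "('a, 'm) module" and d U +
  fixes P :: "'m set" and E :: "('a, 'e) module" and k :: "'m set \<Rightarrow> 'e"
  assumes P: "P \<in> minimal_primes_in R M"
    and hull: "injective_hull_in_sigma R M (quotient_module M P) E k"
begin

lemma submodule_P: "submodule P R M" by (rule minimal_prime_submodule[OF P])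

lemma injective_E: "injective_in_sigma R M E"
  using hull by (simp add: injective_hull_in_sigma_def)

lemma sigma_E: "in_sigma R M E"
  using injective_E by (simp add: injective_in_sigma_def)

sublocale E: left_module R E
  using sigma_E by (simp add: in_sigma_def)

sublocale Q: left_module R "quotient_module M P"
  by (rule left_module_quotient[OF submodule_P])

sublocale ME: two_modules R M E by unfold_locales
sublocale EE: two_modules R E E by unfold_locales
sublocale QE: two_modules R "quotient_module M P" E by unfold_locales

text \<open>The composite of M -> M/P and the embedding into the hull, with kernel P. On
  \<open>perp P\<close>, which meets P trivially, it is injective; this makes \<open>perp P\<close>
  a submodule of E.\<close>

definition \<kappa> where "\<kappa> x = k (P +>\<^bsub>M\<^esub> x)"

abbreviation N where "N \<equiv> perp P"

lemma k_Hom: "k \<in> Hom R (quotient_module M P) E" and k_inj: "inj_on k (carrier (quotient_module M P))"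
  using hull by (simp_all add: injective_hull_in_sigma_def)

lemma \<kappa>_linear: "linear R M E \<kappa>"
  unfolding \<kappa>_def by (rule linear_comp[OF linear_coset[OF submodule_P] linear_Hom[OF k_Hom]])

lemma \<kappa>_closed: "x \<in> carrier M \<Longrightarrow> \<kappa> x \<in> carrier E"
  by (rule linear_on_closed[OF \<kappa>_linear])

lemma \<kappa>_zero: "\<kappa> \<zero>\<^bsub>M\<^esub> = \<zero>\<^bsub>E\<^esub>"
  by (rule ME.linear_on_zero[OF \<kappa>_linear submodule_carrier])

lemma \<kappa>_kernel:
  assumes x: "x \<in> carrier M" shows "\<kappa> x = \<zero>\<^bsub>E\<^esub> \<longleftrightarrow> x \<in> P"
proof -
  have "\<kappa> x = \<zero>\<^bsub>E\<^esub> \<longleftrightarrow> P +>\<^bsub>M\<^esub> x = \<zero>\<^bsub>quotient_module M P\<^esub>"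
    using QE.inj_on_iff_kernel[OF linear_Hom[OF k_Hom] Q.submodule_carrier] k_inj coset_closed[OF submodule_P x]
      QE.linear_on_zero[OF linear_Hom[OF k_Hom] Q.submodule_carrier] unfolding \<kappa>_def by auto
  then show ?thesis by (simp add: coset_eq_zero_iff[OF submodule_P x])
qed

lemma N_carrier: "x \<in> N \<Longrightarrow> x \<in> carrier M"
  by (rule submodule_mem[OF submodule_perp])

lemma \<kappa>_kernel_N: "x \<in> N \<Longrightarrow> \<kappa> x = \<zero>\<^bsub>E\<^esub> \<Longrightarrow> x = \<zero>\<^bsub>M\<^esub>"
  using \<kappa>_kernel[OF N_carrier] Int_perp[OF submodule_P] by blast

lemma \<kappa>_linear_on: "L \<subseteq> carrier M \<Longrightarrow> linear_on R M L E \<kappa>"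
  by (rule linear_on_subset[OF \<kappa>_linear])

lemma \<kappa>_inj: "inj_on \<kappa> N"
  using ME.inj_on_iff_kernel[OF \<kappa>_linear_on[OF submodule_subset[OF submodule_perp]] submodule_perp] \<kappa>_kernel_N by blast

lemma meets_image:
  assumes L: "submodule L R E" "L \<noteq> {\<zero>\<^bsub>E\<^esub>}"
  shows "\<exists>x\<in>carrier M. \<kappa> x \<in> L \<and> \<kappa> x \<noteq> \<zero>\<^bsub>E\<^esub>"
proof -
  have "k ` carrier (quotient_module M P) \<inter> L \<noteq> {\<zero>\<^bsub>E\<^esub>}"
    using hull L unfolding injective_hull_in_sigma_def essential_submodule_def by blast
  moreover have "submodule (k ` carrier (quotient_module M P) \<inter> L) R E"
    by (rule E.submodule_Int[OF QE.submodule_image[OF linear_Hom[OF k_Hom] Q.submodule_carrier] L(1)])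
  ultimately obtain z where z: "z \<in> k ` carrier (quotient_module M P)" "z \<in> L" "z \<noteq> \<zero>\<^bsub>E\<^esub>"
    using E.nonzero_submodule by blast
  obtain X where X: "X \<in> carrier (quotient_module M P)" "z = k X" using z(1) by blast
  obtain x where "x \<in> carrier M" "X = P +>\<^bsub>M\<^esub> x" using X(1) unfolding coset_mem_quotient[OF submodule_P] by (elim bexE)
  then show ?thesis using z X unfolding \<kappa>_def by blast
qed

text \<open>The preimage of L in M is not contained in P, which is the \<open>perp\<close> of N, so
  it meets N. Thus not only M/P but already N is essential in E.\<close>

lemma meets_perp_image:
  assumes L: "submodule L R E" "L \<noteq> {\<zero>\<^bsub>E\<^esub>}"
  shows "\<exists>x\<in>N. x \<noteq> \<zero>\<^bsub>M\<^esub> \<and> \<kappa> x \<in> L"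
proof -
  define L0 where "L0 = {x\<in>carrier M. \<kappa> x \<in> L}"
  have L0: "submodule L0 R M" unfolding L0_def by (rule ME.submodule_preimage[OF \<kappa>_linear submodule_carrier L(1)])
  obtain x where "x \<in> carrier M" "\<kappa> x \<in> L" "\<kappa> x \<noteq> \<zero>\<^bsub>E\<^esub>" using meets_image[OF L] by blast
  then have "\<not> L0 \<subseteq> P" using \<kappa>_kernel[of x] unfolding L0_def by blast
  then obtain y where "y \<in> L0" "y \<in> N" "y \<noteq> \<zero>\<^bsub>M\<^esub>" by (rule meets_perp_minimal_prime[OF P L0])
  then show ?thesis unfolding L0_def by blast
qed

lemma ess_embedded_E: "ess_embedded N E \<kappa>"
  unfolding ess_embedded_def
  using E.left_module_axioms submodule_perp \<kappa>_linear_on[OF submodule_subset[OF submodule_perp]] \<kappa>_inj meets_perp_image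
  by blast

lemma meets_span_image:
  assumes L: "submodule L R E" "L \<noteq> {\<zero>\<^bsub>E\<^esub>}"
  obtains y where "y \<in> span_U (index_set P)" "y \<noteq> \<zero>\<^bsub>M\<^esub>" "\<kappa> y \<in> L"
proof -
  define L0 where "L0 = {x\<in>N. \<kappa> x \<in> L}"
  have L0: "submodule L0 R M" unfolding L0_def
    by (rule ME.submodule_preimage[OF \<kappa>_linear_on[OF submodule_subset[OF submodule_perp]] submodule_perp L(1)])
  obtain x where "x \<in> L0" "x \<noteq> \<zero>\<^bsub>M\<^esub>" using meets_perp_image[OF L] unfolding L0_def by blast
  moreover have "L0 \<subseteq> N" unfolding L0_def by blast
  ultimately obtain y where "y \<in> L0" "y \<in> span_U (index_set P)" "y \<noteq> \<zero>\<^bsub>M\<^esub>"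
    using perp_meets_span[OF P L0] by metis
  then show ?thesis using that unfolding L0_def by blast
qed

text \<open>N sits in E through \<open>\<kappa>\<close>, so a partial map on N with injective target
  is a partial map on E and extends.\<close>

lemma extend_along_\<kappa>:
  assumes Y: "injective_in_sigma R M Y" and D: "submodule D R M" "D \<subseteq> N" and h: "linear_on R M D Y h"
  obtains q where "linear R E Y q" "\<And>x. x \<in> D \<Longrightarrow> q (\<kappa> x) = h x"
proof -
  have Ym: "left_module R Y" using Y by (simp add: injective_in_sigma_def in_sigma_def)
  interpret MY: two_modules R M Y using Ym left_module_axioms by (simp add: two_modules_def)
  have \<kappa>D: "linear_on R M D E \<kappa>" by (rule \<kappa>_linear_on[OF submodule_subset[OF D(1)]])
  have inj: "inj_on \<kappa> D" by (rule inj_on_subset[OF \<kappa>_inj D(2)])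
  have l: "linear_on R E (\<kappa> ` D) Y (\<lambda>z. h (inv_into D \<kappa> z))"
    by (rule linear_on_comp[OF ME.linear_on_inv_into[OF \<kappa>D D(1) inj] h]) (auto simp: inv_into_into)
  obtain q where q: "linear R E Y q" "\<And>z. z \<in> \<kappa> ` D \<Longrightarrow> q z = h (inv_into D \<kappa> z)"
    using injective_extend[OF Y sigma_E ME.submodule_image[OF \<kappa>D D(1)] l] by blast
  show ?thesis by (rule that[OF q(1)]) (simp add: q(2) inv_into_f_f[OF inj])
qed

text \<open>The image of the span of the block meets every nonzero submodule of E, so
  \<open>ess_embedded_eq\<close> applies. Identities between maps out of E are checked on the
  \<open>U i\<close> of the block from here on.\<close>

lemma linear_eqI:
  assumes Y: "ess_embedded N' Y \<mu>" and f: "linear R E Y f" and g: "linear R E Y g"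
    and eq: "\<And>i u. i \<in> index_set P \<Longrightarrow> u \<in> U i \<Longrightarrow> f (\<kappa> u) = g (\<kappa> u)" and x: "x \<in> carrier E"
  shows "f x = g x"
proof -
  have Ym: "left_module R Y" using Y by (simp add: ess_embedded_def)
  interpret MY: two_modules R M Y using Ym left_module_axioms by (simp add: two_modules_def)
  define L where "L = {x \<in> carrier M. f (\<kappa> x) \<ominus>\<^bsub>Y\<^esub> g (\<kappa> x) = \<zero>\<^bsub>Y\<^esub>}"
  have f\<kappa>: "linear R M Y (\<lambda>x. f (\<kappa> x))" and g\<kappa>: "linear R M Y (\<lambda>x. g (\<kappa> x))"
    by (rule linear_comp[OF \<kappa>_linear f], rule linear_comp[OF \<kappa>_linear g])
  have L: "submodule L R M" unfolding L_def
    by (rule MY.submodule_kernel[OF MY.linear_on_diff[OF f\<kappa> g\<kappa>] submodule_carrier])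
  have iff: "x \<in> L \<longleftrightarrow> x \<in> carrier M \<and> f (\<kappa> x) = g (\<kappa> x)" for x
    unfolding L_def using MY.Y.minus_zero_eq linear_on_closed[OF f\<kappa>] linear_on_closed[OF g\<kappa>] by auto
  have sp: "span_U (index_set P) \<subseteq> L"
  proof (rule span_U_least[OF L])
    fix i assume i: "i \<in> index_set P"
    show "U i \<subseteq> L" using eq[OF i] U_subset_perp[OF i] N_carrier unfolding iff subset_iff by blast
  qed
  show ?thesis
  proof (rule ess_embedded_eq[OF Y sigma_E E.submodule_carrier f g _ x])
    fix K assume K: "submodule K R E" "K \<noteq> {\<zero>\<^bsub>E\<^esub>}"
    obtain y where y: "y \<in> span_U (index_set P)" "y \<noteq> \<zero>\<^bsub>M\<^esub>" "\<kappa> y \<in> K" by (rule meets_span_image[OF K])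
    have "\<kappa> y \<noteq> \<zero>\<^bsub>E\<^esub>" using \<kappa>_kernel_N y span_index_subset_perp by blast
    moreover have "f (\<kappa> y) = g (\<kappa> y)" using sp y(1) iff by blast
    ultimately show "\<exists>x\<in>K. x \<noteq> \<zero>\<^bsub>E\<^esub> \<and> f x = g x" using y(3) by blast
  qed
qed

section \<open>Projections of the hull onto the uniform submodules\<close>

lemma finite_index: "finite (index_set P)"
  using index_set_subset finite_subset by blast

lemma index_less: "i \<in> index_set P \<Longrightarrow> i < d"
  by (simp add: index_set_def)

lemma U_carrier: "i \<in> index_set P \<Longrightarrow> u \<in> U i \<Longrightarrow> u \<in> carrier M"
  using U_subset_perp N_carrier by blast

definition is_projection where
  "is_projection i p \<longleftrightarrow> linear R E E p \<and> (\<forall>u\<in>U i. p (\<kappa> u) = \<kappa> u) \<and>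
     (\<forall>v\<in>span_U (index_set P - {i}). p (\<kappa> v) = \<zero>\<^bsub>E\<^esub>)"

text \<open>By independence the map \<open>\<kappa>\<close> on \<open>U i\<close> and the zero map
  on the span of the others agree where both are defined; they are glued and extended by injectivity
  of E.\<close>

lemma exists_projection:
  assumes i: "i \<in> index_set P" shows "\<exists>p. is_projection i p"
proof -
  let ?V = "span_U (index_set P - {i})"
  have sub: "index_set P - {i} \<subseteq> {..<d}" using index_set_subset by blast
  note Ui = submodule_U[OF index_less[OF i]] and V = submodule_span_U[OF sub]
  have agree: "\<kappa> x = \<zero>\<^bsub>E\<^esub>" if "x \<in> U i" "x \<in> ?V" for x
    using U_Int_span[OF index_less[OF i] sub _ that] \<kappa>_zero by simp
  obtain h where h: "linear_on R M (sum_set (U i) ?V) E h"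
    "\<And>u v. u \<in> U i \<Longrightarrow> v \<in> ?V \<Longrightarrow> h (u \<oplus>\<^bsub>M\<^esub> v) = \<kappa> u \<oplus>\<^bsub>E\<^esub> \<zero>\<^bsub>E\<^esub>"
    by (rule ME.linear_on_glue[OF Ui V agree \<kappa>_linear_on[OF submodule_subset[OF Ui]] ME.linear_zero]) blast+
  have VN: "?V \<subseteq> N" using span_U_mono[of "index_set P - {i}" "index_set P"] span_index_subset_perp by blast
  have sN: "sum_set (U i) ?V \<subseteq> N"
    by (rule sum_set_least[OF submodule_perp U_subset_perp[OF i] VN])
  obtain p where p: "linear R E E p" "\<And>x. x \<in> sum_set (U i) ?V \<Longrightarrow> p (\<kappa> x) = h x"
    by (rule extend_along_\<kappa>[OF injective_E submodule_sum_set[OF Ui V] sN h(1)]) blast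
  have "p (\<kappa> u) = \<kappa> u" if u: "u \<in> U i" for u
  proof -
    have c: "u \<in> carrier M" by (rule U_carrier[OF i u])
    have z: "\<zero>\<^bsub>M\<^esub> \<in> ?V" by (rule submodule_zero[OF V])
    have "p (\<kappa> (u \<oplus>\<^bsub>M\<^esub> \<zero>\<^bsub>M\<^esub>)) = \<kappa> u \<oplus>\<^bsub>E\<^esub> \<zero>\<^bsub>E\<^esub>"
      using p(2)[OF sum_setI[OF u z]] h(2)[OF u z] by simp
    then show ?thesis using c \<kappa>_closed[OF c] by simp
  qed
  moreover have "p (\<kappa> v) = \<zero>\<^bsub>E\<^esub>" if v: "v \<in> ?V" for v
  proof -
    have c: "v \<in> carrier M" by (rule submodule_mem[OF V v])
    have z: "\<zero>\<^bsub>M\<^esub> \<in> U i" by (rule submodule_zero[OF Ui])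
    have "p (\<kappa> (\<zero>\<^bsub>M\<^esub> \<oplus>\<^bsub>M\<^esub> v)) = \<kappa> \<zero>\<^bsub>M\<^esub> \<oplus>\<^bsub>E\<^esub> \<zero>\<^bsub>E\<^esub>"
      using p(2)[OF sum_setI[OF z v]] h(2)[OF z v] by simp
    then show ?thesis using c \<kappa>_closed[OF c] \<kappa>_zero by simp
  qed
  ultimately show ?thesis using p(1) unfolding is_projection_def by blast
qed

text \<open>The choice is immaterial: by \<open>linear_eqI\<close> the prescribed values determine a
  projection on the whole of E.\<close>

definition \<epsilon> where "\<epsilon> i = (SOME p. is_projection i p)"

lemma \<epsilon>_projection: "i \<in> index_set P \<Longrightarrow> is_projection i (\<epsilon> i)"
  unfolding \<epsilon>_def by (rule someI_ex[OF exists_projection])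

lemma \<epsilon>_linear: "i \<in> index_set P \<Longrightarrow> linear R E E (\<epsilon> i)"
  and \<epsilon>_U: "i \<in> index_set P \<Longrightarrow> u \<in> U i \<Longrightarrow> \<epsilon> i (\<kappa> u) = \<kappa> u"
  and \<epsilon>_span: "i \<in> index_set P \<Longrightarrow> T \<subseteq> index_set P \<Longrightarrow> i \<notin> T \<Longrightarrow> v \<in> span_U T \<Longrightarrow> \<epsilon> i (\<kappa> v) = \<zero>\<^bsub>E\<^esub>"
  using \<epsilon>_projection span_U_mono[of T "index_set P - {i}"] unfolding is_projection_def by blast+

lemma \<epsilon>_zero: "i \<in> index_set P \<Longrightarrow> \<epsilon> i \<zero>\<^bsub>E\<^esub> = \<zero>\<^bsub>E\<^esub>"
  by (rule EE.linear_on_zero[OF \<epsilon>_linear E.submodule_carrier])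

lemma \<epsilon>_U_other:
  assumes "i \<in> index_set P" "j \<in> index_set P" "i \<noteq> j" "u \<in> U j"
  shows "\<epsilon> i (\<kappa> u) = \<zero>\<^bsub>E\<^esub>"
  by (rule \<epsilon>_span[OF assms(1), of "{j}"]) (use assms U_subset_span[of j "{j}"] in auto)

text \<open>The map \<open>\<epsilon> t\<close> extracts the summand in \<open>U t\<close>. If it
  vanishes, the element lies in the span of the remaining members, and induction applies.\<close>

lemma components_zero:
  assumes "T \<subseteq> index_set P" "w \<in> span_U T" "\<And>i. i \<in> T \<Longrightarrow> \<epsilon> i (\<kappa> w) = \<zero>\<^bsub>E\<^esub>"
  shows "w = \<zero>\<^bsub>M\<^esub>"
proof -
  have "finite T" using assms(1) finite_index finite_subset by blast
  then show ?thesis using assms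
  proof (induction T arbitrary: w)
    case empty
    then show ?case by (simp add: span_U_empty)
  next
    case (insert t T)
    have t: "t \<in> index_set P" and T: "T \<subseteq> index_set P" using insert.prems(1) by auto
    have Td: "T \<subseteq> {..<d}" using T index_set_subset by blast
    obtain u v where uv: "u \<in> U t" "v \<in> span_U T" "w = u \<oplus>\<^bsub>M\<^esub> v"
      using insert.prems(2) unfolding span_U_insert[OF index_less[OF t] Td] by (rule sum_setE)
    have c: "u \<in> carrier M" "v \<in> carrier M"
      using U_carrier[OF t uv(1)] submodule_mem[OF submodule_span_U[OF Td] uv(2)] .
    have "\<epsilon> t (\<kappa> w) = \<epsilon> t (\<kappa> u) \<oplus>\<^bsub>E\<^esub> \<epsilon> t (\<kappa> v)"
      unfolding uv(3) linear_on_add[OF \<kappa>_linear c]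
      by (rule linear_on_add[OF \<epsilon>_linear[OF t] \<kappa>_closed[OF c(1)] \<kappa>_closed[OF c(2)]])
    then have "\<kappa> u = \<zero>\<^bsub>E\<^esub>"
      using insert.prems(3)[of t] \<epsilon>_U[OF t uv(1)] \<epsilon>_span[OF t T insert.hyps(2) uv(2)] \<kappa>_closed[OF c(1)] by simp
    then have "u = \<zero>\<^bsub>M\<^esub>" using \<kappa>_kernel_N U_subset_perp[OF t] uv(1) by blast
    then have "w = v" using uv(3) c by simp
    then show ?case using insert.IH[OF T] uv(2) insert.prems(3) by simp
  qed
qed

text \<open>A nonzero image of q would contain \<open>\<kappa> y\<close> for a nonzero y in the span
  of the block, and such a y has a nonzero component.\<close>

lemma faithful:
  assumes q: "linear R E E q" and z: "\<And>i x. i \<in> index_set P \<Longrightarrow> x \<in> carrier E \<Longrightarrow> \<epsilon> i (q x) = \<zero>\<^bsub>E\<^esub>"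
    and x: "x \<in> carrier E"
  shows "q x = \<zero>\<^bsub>E\<^esub>"
proof (rule ccontr)
  assume "q x \<noteq> \<zero>\<^bsub>E\<^esub>"
  then have "q ` carrier E \<noteq> {\<zero>\<^bsub>E\<^esub>}" using x by blast
  then obtain y where y: "y \<in> span_U (index_set P)" "y \<noteq> \<zero>\<^bsub>M\<^esub>" "\<kappa> y \<in> q ` carrier E"
    by (rule meets_span_image[OF EE.submodule_image[OF q E.submodule_carrier]])
  have "\<epsilon> i (\<kappa> y) = \<zero>\<^bsub>E\<^esub>" if "i \<in> index_set P" for i using z[OF that] y(3) by auto
  then show False using components_zero[OF order_refl y(1)] y(2) by blast
qed

text \<open>Write y as u + v with u in \<open>U i\<close> and v in the span of the others. Then
  \<open>\<epsilon> i\<close> sends \<open>\<kappa> y\<close> to \<open>\<kappa> u\<close>, and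
  \<open>\<kappa>\<close> is injective on N.\<close>

lemma span_fixed:
  assumes i: "i \<in> index_set P" and y: "y \<in> span_U (index_set P)" and fx: "\<epsilon> i (\<kappa> y) = \<kappa> y"
  shows "y \<in> U i"
proof -
  let ?V = "span_U (index_set P - {i})"
  have sub: "index_set P - {i} \<subseteq> {..<d}" using index_set_subset by blast
  have "insert i (index_set P - {i}) = index_set P" using i by blast
  then obtain u v where uv: "u \<in> U i" "v \<in> ?V" "y = u \<oplus>\<^bsub>M\<^esub> v"
    using y span_U_insert[OF index_less[OF i] sub] by (auto elim: sum_setE)
  have c: "u \<in> carrier M" "v \<in> carrier M"
    using U_carrier[OF i uv(1)] submodule_mem[OF submodule_span_U[OF sub] uv(2)] .
  have "\<epsilon> i (\<kappa> v) = \<zero>\<^bsub>E\<^esub>" by (rule \<epsilon>_span[OF i _ _ uv(2)]) auto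
  moreover have "\<epsilon> i (\<kappa> y) = \<epsilon> i (\<kappa> u) \<oplus>\<^bsub>E\<^esub> \<epsilon> i (\<kappa> v)"
    unfolding uv(3) linear_on_add[OF \<kappa>_linear c]
    by (rule linear_on_add[OF \<epsilon>_linear[OF i] \<kappa>_closed[OF c(1)] \<kappa>_closed[OF c(2)]])
  ultimately have "\<kappa> y = \<kappa> u" using fx \<epsilon>_U[OF i uv(1)] \<kappa>_closed[OF c(1)] by simp
  then have "y = u" using inj_onD[OF \<kappa>_inj] y span_index_subset_perp U_subset_perp[OF i] uv(1) by blast
  then show ?thesis using uv(1) by simp
qed

lemma \<epsilon>_idem:
  assumes i: "i \<in> index_set P" and x: "x \<in> carrier E" shows "\<epsilon> i (\<epsilon> i x) = \<epsilon> i x"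
proof (rule linear_eqI[OF ess_embedded_E linear_comp[OF \<epsilon>_linear[OF i] \<epsilon>_linear[OF i]] \<epsilon>_linear[OF i] _ x])
  fix j u assume j: "j \<in> index_set P" "u \<in> U j"
  show "\<epsilon> i (\<epsilon> i (\<kappa> u)) = \<epsilon> i (\<kappa> u)"
    using \<epsilon>_U[OF i] \<epsilon>_U_other[OF i j(1) _ j(2)] \<epsilon>_zero[OF i] j(2) by (cases "i = j") auto
qed

lemma \<epsilon>_orth:
  assumes i: "i \<in> index_set P" and l: "l \<in> index_set P" and ne: "i \<noteq> l" and x: "x \<in> carrier E"
  shows "\<epsilon> i (\<epsilon> l x) = \<zero>\<^bsub>E\<^esub>"
proof (rule linear_eqI[OF ess_embedded_E linear_comp[OF \<epsilon>_linear[OF l] \<epsilon>_linear[OF i]] EE.linear_zero _ x])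
  fix j u assume j: "j \<in> index_set P" "u \<in> U j"
  show "\<epsilon> i (\<epsilon> l (\<kappa> u)) = \<zero>\<^bsub>E\<^esub>"
    using \<epsilon>_U[OF l] \<epsilon>_U_other[OF l j(1) _ j(2)] \<epsilon>_U_other[OF i j(1) _ j(2)] \<epsilon>_zero[OF i] j(2) ne
    by (cases "l = j") auto
qed

text \<open>The composite g of q and \<open>\<epsilon> i\<close> is nonzero on some
  \<open>U l\<close>, hence injective there, and its image meets the image of \<open>U i\<close>. On
  this meeting part g can be inverted. The extension r0 of the inverse satisfies g r0 = identity at
  one nonzero element of \<open>U i\<close>, hence on all of it by
  \<open>uniform_eq\<close>.\<close>

lemma \<epsilon>_simple:
  assumes i: "i \<in> index_set P" and q: "linear R E E q" and x: "x \<in> carrier E" "\<epsilon> i (q x) \<noteq> \<zero>\<^bsub>E\<^esub>"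
  obtains r where "linear R E E r" "\<And>y. y \<in> carrier E \<Longrightarrow> \<epsilon> i (q (r y)) = \<epsilon> i y"
proof -
  define g where "g y = \<epsilon> i (q y)" for y
  have g: "linear R E E g" unfolding g_def by (rule linear_comp[OF q \<epsilon>_linear[OF i]])
  have "\<exists>l\<in>index_set P. \<exists>u\<in>U l. g (\<kappa> u) \<noteq> \<zero>\<^bsub>E\<^esub>"
    using linear_eqI[OF ess_embedded_E g EE.linear_zero _ x(1)] x(2) unfolding g_def by blast
  then obtain l u0 where l: "l \<in> index_set P" and u0: "u0 \<in> U l" "g (\<kappa> u0) \<noteq> \<zero>\<^bsub>E\<^esub>" by blast
  note Ul = submodule_U[OF index_less[OF l]] and Ui = submodule_U[OF index_less[OF i]]
  have g\<kappa>: "linear_on R M (U l) E (\<lambda>u. g (\<kappa> u))"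
    by (rule linear_comp[OF \<kappa>_linear_on[OF submodule_subset[OF Ul]] g])
  have inj: "inj_on (\<lambda>u. g (\<kappa> u)) (U l)"
    unfolding ME.inj_on_iff_kernel[OF g\<kappa> Ul]
    using uniform_injective[OF ess_embedded_E self_in_sigma uniform[OF index_less[OF l]] g\<kappa> u0] by blast
  let ?G = "(\<lambda>u. g (\<kappa> u)) ` U l"
  have G: "submodule ?G R E" by (rule ME.submodule_image[OF g\<kappa> Ul])
  have "?G \<noteq> {\<zero>\<^bsub>E\<^esub>}" using u0 by blast
  from meets_span_image[OF G this] obtain y
    where y: "y \<in> span_U (index_set P)" "y \<noteq> \<zero>\<^bsub>M\<^esub>" "\<kappa> y \<in> ?G" by metis
  have fixG: "\<epsilon> i z = z" if z: "z \<in> ?G" for z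
  proof -
    obtain u where u: "u \<in> U l" "z = g (\<kappa> u)" using z by blast
    show ?thesis unfolding u(2) g_def
      by (rule \<epsilon>_idem[OF i linear_on_closed[OF q \<kappa>_closed[OF U_carrier[OF l u(1)]]]])
  qed
  have yU: "y \<in> U i" by (rule span_fixed[OF i y(1) fixG[OF y(3)]])
  \<comment> \<open>The part of \<open>U i\<close> that g reaches from \<open>U l\<close>; here the
    inverse of g is defined.\<close>
  define W where "W = {w \<in> U i. \<kappa> w \<in> ?G}"
  have W: "submodule W R M" unfolding W_def
    by (rule ME.submodule_preimage[OF \<kappa>_linear_on[OF submodule_subset[OF Ui]] Ui G])
  have WU: "W \<subseteq> U i" by (auto simp: W_def)
  have inv: "linear_on R E ?G M (inv_into (U l) (\<lambda>u. g (\<kappa> u)))"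
    by (rule ME.linear_on_inv_into[OF g\<kappa> Ul inj])
  have h: "linear_on R M W E (\<lambda>w. \<kappa> (inv_into (U l) (\<lambda>u. g (\<kappa> u)) (\<kappa> w)))"
    by (rule linear_comp[OF linear_on_comp[OF \<kappa>_linear_on[OF submodule_subset[OF W]] inv] \<kappa>_linear]) (auto simp: W_def)
  have WN: "W \<subseteq> N" using WU U_subset_perp[OF i] by blast
  obtain r0 where r0: "linear R E E r0" "\<And>w. w \<in> W \<Longrightarrow> r0 (\<kappa> w) = \<kappa> (inv_into (U l) (\<lambda>u. g (\<kappa> u)) (\<kappa> w))"
    by (rule extend_along_\<kappa>[OF injective_E W WN h]) blast
  have gr: "linear R E E (\<lambda>z. g (r0 z))" by (rule linear_comp[OF r0(1) g])
  have yW: "y \<in> W" using yU y(3) by (simp add: W_def)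
  have gry: "g (r0 (\<kappa> y)) = \<kappa> y"
    unfolding r0(2)[OF yW] using f_inv_into_f[OF y(3)] .
  have id: "g (r0 (\<kappa> u)) = \<kappa> u" if "u \<in> U i" for u
    by (rule uniform_eq[OF ess_embedded_E self_in_sigma uniform[OF index_less[OF i]]
          linear_comp[OF \<kappa>_linear_on[OF submodule_subset[OF Ui]] gr] \<kappa>_linear_on[OF submodule_subset[OF Ui]] yU y(2) gry that])
  have gr0: "g (r0 \<zero>\<^bsub>E\<^esub>) = \<zero>\<^bsub>E\<^esub>" by (rule EE.linear_on_zero[OF gr E.submodule_carrier])
  show ?thesis
  \<comment> \<open>Precomposing r0 with \<open>\<epsilon> i\<close> makes both sides of the
    equation vanish on the other members of the block, so it holds on all of E.\<close>
  proof (rule that[OF linear_comp[OF \<epsilon>_linear[OF i] r0(1)]])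
    fix y assume y: "y \<in> carrier E"
    have "g (r0 (\<epsilon> i y)) = \<epsilon> i y"
    proof (rule linear_eqI[OF ess_embedded_E linear_comp[OF \<epsilon>_linear[OF i] gr] \<epsilon>_linear[OF i] _ y])
      fix j u assume j: "j \<in> index_set P" "u \<in> U j"
      show "g (r0 (\<epsilon> i (\<kappa> u))) = \<epsilon> i (\<kappa> u)"
      proof (cases "i = j")
        case True
        then show ?thesis using \<epsilon>_U[OF i] id j(2) by simp
      next
        case False
        then show ?thesis using \<epsilon>_U_other[OF i j(1) False j(2)] gr0 by simp
      qed
    qed
    then show "\<epsilon> i (q (r0 (\<epsilon> i y))) = \<epsilon> i y" by (simp add: g_def)
  qed
qed

text \<open>Both members of the block have the same \<open>perp\<close>, so \<open>U l\<close> is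
  not inside \<open>perp (U i)\<close>: some map from M into \<open>U i\<close> is nonzero on
  \<open>U l\<close>. Its extension to E provides the link.\<close>

lemma \<epsilon>_linked:
  assumes i: "i \<in> index_set P" and l: "l \<in> index_set P"
  obtains q x where "linear R E E q" "x \<in> carrier E" "\<epsilon> i (q (\<epsilon> l x)) \<noteq> \<zero>\<^bsub>E\<^esub>"
proof -
  have "\<not> U l \<subseteq> perp (U i)"
    using uniform_perp_disjoint[OF uniform[OF index_less[OF l]]] i l by (simp add: index_set_def)
  then obtain x where x: "x \<in> U l" "x \<notin> perp (U i)" by blast
  obtain f where f: "linear R M M f" "f ` carrier M \<subseteq> U i" "f x \<noteq> \<zero>\<^bsub>M\<^esub>"
    using x U_carrier[OF l x(1)] unfolding perp_def by blast
  have lin: "linear_on R M N E (\<lambda>x. \<kappa> (f x))"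
    by (rule linear_on_subset[OF linear_comp[OF f(1) \<kappa>_linear] submodule_subset[OF submodule_perp]])
  obtain q where q: "linear R E E q" "\<And>x. x \<in> N \<Longrightarrow> q (\<kappa> x) = \<kappa> (f x)"
    by (rule extend_along_\<kappa>[OF injective_E submodule_perp order_refl lin]) blast
  have xc: "x \<in> carrier M" by (rule U_carrier[OF l x(1)])
  have fU: "f x \<in> U i" using f(2) xc by blast
  have "\<epsilon> i (q (\<epsilon> l (\<kappa> x))) = \<kappa> (f x)"
    using \<epsilon>_U[OF l x(1)] q(2)[of x] U_subset_perp[OF l] x(1) \<epsilon>_U[OF i fU] by auto
  moreover have "\<kappa> (f x) \<noteq> \<zero>\<^bsub>E\<^esub>" using \<kappa>_kernel_N f(3) fU U_subset_perp[OF i] by blast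
  ultimately have "\<epsilon> i (q (\<epsilon> l (\<kappa> x))) \<noteq> \<zero>\<^bsub>E\<^esub>" by simp
  then show ?thesis by (rule that[OF q(1) \<kappa>_closed[OF xc]])
qed

section \<open>The endomorphism ring of the hull\<close>

sublocale End: ring "End_ring R E"
  by (rule E.ring_End_ring)

lemma End_mult: "x \<in> carrier E \<Longrightarrow> (f \<otimes>\<^bsub>End_ring R E\<^esub> g) x = f (g x)"
  by (simp add: End_ring_simps compose_def)

lemma End_zero: "x \<in> carrier E \<Longrightarrow> \<zero>\<^bsub>End_ring R E\<^esub> x = \<zero>\<^bsub>E\<^esub>"
  by (simp add: End_ring_simps)

lemma End_eqI:
  assumes "f \<in> carrier (End_ring R E)" "g \<in> carrier (End_ring R E)" "\<And>x. x \<in> carrier E \<Longrightarrow> f x = g x"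
  shows "f = g"
  using assms unfolding End_ring_simps by (rule Hom_ext)

lemma End_linear: "f \<in> carrier (End_ring R E) \<Longrightarrow> linear R E E f"
  by (simp add: End_ring_simps linear_Hom)

lemma End_restrict: "linear R E E f \<Longrightarrow> restrict f (carrier E) \<in> carrier (End_ring R E)"
  by (simp add: End_ring_simps EE.Hom_restrict)

sublocale End: idempotent_system "End_ring R E" "index_set P" "\<lambda>i. restrict (\<epsilon> i) (carrier E)"
proof (unfold_locales, goal_cases)
  case 1
  show ?case by (rule finite_index)
next
  case (2 i)
  then show ?case by (intro End_restrict \<epsilon>_linear)
next
  case (3 q)
  note q = End_linear[OF 3(1)]
  show ?case
  proof (rule End_eqI[OF 3(1) End.zero_closed])
    fix x assume x: "x \<in> carrier E"
    have "\<epsilon> i (q y) = \<zero>\<^bsub>E\<^esub>" if "i \<in> index_set P" "y \<in> carrier E" for i y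
      using fun_cong[OF 3(2)[OF that(1)], of y] that linear_on_closed[OF q that(2)] by (simp add: End_mult End_zero)
    from faithful[OF q this x] show "q x = \<zero>\<^bsub>End_ring R E\<^esub> x" by (simp add: End_zero x)
  qed
next
  case (4 i)
  have c: "restrict (\<epsilon> i) (carrier E) \<in> carrier (End_ring R E)" by (intro End_restrict \<epsilon>_linear 4)
  show ?case
    by (rule End_eqI[OF End.m_closed[OF c c] c])
      (simp add: End_mult \<epsilon>_idem[OF 4] linear_on_closed[OF \<epsilon>_linear[OF 4]])
next
  case (5 i j)
  have c: "restrict (\<epsilon> l) (carrier E) \<in> carrier (End_ring R E)" if "l \<in> index_set P" for l
    by (intro End_restrict \<epsilon>_linear that)
  show ?case
    by (rule End_eqI[OF End.m_closed[OF c[OF 5(1)] c[OF 5(2)]] End.zero_closed])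
      (simp add: End_mult End_zero \<epsilon>_orth[OF 5] linear_on_closed[OF \<epsilon>_linear[OF 5(2)]])
next
  case (6 i q)
  have c: "restrict (\<epsilon> i) (carrier E) \<in> carrier (End_ring R E)" by (intro End_restrict \<epsilon>_linear 6)
  note q = End_linear[OF 6(2)]
  have "\<exists>x\<in>carrier E. \<epsilon> i (q x) \<noteq> \<zero>\<^bsub>E\<^esub>"
  proof (rule ccontr)
    assume "\<not> ?thesis"
    then have z: "\<epsilon> i (q x) = \<zero>\<^bsub>E\<^esub>" if "x \<in> carrier E" for x using that by blast
    have "restrict (\<epsilon> i) (carrier E) \<otimes>\<^bsub>End_ring R E\<^esub> q = \<zero>\<^bsub>End_ring R E\<^esub>"
      by (rule End_eqI[OF End.m_closed[OF c 6(2)] End.zero_closed])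
        (simp add: End_mult End_zero z linear_on_closed[OF q])
    then show False using 6(3) by blast
  qed
  then obtain x where x: "x \<in> carrier E" "\<epsilon> i (q x) \<noteq> \<zero>\<^bsub>E\<^esub>" by blast
  obtain r where r: "linear R E E r" "\<And>y. y \<in> carrier E \<Longrightarrow> \<epsilon> i (q (r y)) = \<epsilon> i y"
    by (rule \<epsilon>_simple[OF 6(1) q x]) blast
  have rc: "restrict r (carrier E) \<in> carrier (End_ring R E)" by (rule End_restrict[OF r(1)])
  show ?case
  proof (rule bexI[OF _ rc])
    show "restrict (\<epsilon> i) (carrier E) \<otimes>\<^bsub>End_ring R E\<^esub> q \<otimes>\<^bsub>End_ring R E\<^esub> restrict r (carrier E) = restrict (\<epsilon> i) (carrier E)"
      by (rule End_eqI[OF End.m_closed[OF End.m_closed[OF c 6(2)] rc] c])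
        (simp add: End_mult r(2) linear_on_closed[OF q] linear_on_closed[OF r(1)])
  qed
qed

lemma index_nonempty: obtains i where "i \<in> index_set P"
  using minimal_prime_eq_perp[OF P] that by (auto simp: index_set_def)

theorem End_simple: "simple_ring (End_ring R E)"
proof (rule End.simple_ring)
  obtain i where i: "i \<in> index_set P" by (rule index_nonempty)
  have "U i \<noteq> {\<zero>\<^bsub>M\<^esub>}" using uniform[OF index_less[OF i]] by (simp add: uniform_submodule_def)
  then obtain u where u: "u \<in> U i" "u \<noteq> \<zero>\<^bsub>M\<^esub>" using nonzero_submodule[OF submodule_U[OF index_less[OF i]]] by blast
  have "\<kappa> u \<noteq> \<zero>\<^bsub>E\<^esub>" using \<kappa>_kernel_N u U_subset_perp[OF i] by blast
  then show "\<one>\<^bsub>End_ring R E\<^esub> \<noteq> \<zero>\<^bsub>End_ring R E\<^esub>"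
    using \<kappa>_closed[OF U_carrier[OF i u(1)]] unfolding End_ring_simps by (metis restrict_apply')
next
  fix i j assume i: "i \<in> index_set P" and j: "j \<in> index_set P"
  obtain q x where q: "linear R E E q" "x \<in> carrier E" "\<epsilon> i (q (\<epsilon> j x)) \<noteq> \<zero>\<^bsub>E\<^esub>" by (rule \<epsilon>_linked[OF i j])
  show "\<exists>q\<in>carrier (End_ring R E). restrict (\<epsilon> i) (carrier E) \<otimes>\<^bsub>End_ring R E\<^esub> q \<otimes>\<^bsub>End_ring R E\<^esub> restrict (\<epsilon> j) (carrier E) \<noteq> \<zero>\<^bsub>End_ring R E\<^esub>"
  proof (rule bexI[OF _ End_restrict[OF q(1)]])
    have jx: "\<epsilon> j x \<in> carrier E" by (rule linear_on_closed[OF \<epsilon>_linear[OF j] q(2)])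
    have "(restrict (\<epsilon> i) (carrier E) \<otimes>\<^bsub>End_ring R E\<^esub> restrict q (carrier E) \<otimes>\<^bsub>End_ring R E\<^esub> restrict (\<epsilon> j) (carrier E)) x = \<epsilon> i (q (\<epsilon> j x))"
      by (simp add: End_mult q(2) jx linear_on_closed[OF q(1) jx])
    then show "restrict (\<epsilon> i) (carrier E) \<otimes>\<^bsub>End_ring R E\<^esub> restrict q (carrier E) \<otimes>\<^bsub>End_ring R E\<^esub> restrict (\<epsilon> j) (carrier E) \<noteq> \<zero>\<^bsub>End_ring R E\<^esub>"
      using q(3) End_zero[OF q(2)] by metis
  qed
qed

theorem End_right_artinian: "right_artinian (End_ring R E)"
  by (rule End.right_artinian)

end

section \<open>Fractions\<close>

context prime_hull
begin

sublocale QQ: two_modules R "quotient_module M P" "quotient_module M P" by unfold_locales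
sublocale MQ: two_modules R M "quotient_module M P" by unfold_locales
sublocale EndQ: ring "End_ring R (quotient_module M P)" by (rule Q.ring_End_ring)

lemma exists_extension:
  assumes s: "linear R (quotient_module M P) (quotient_module M P) s"
  shows "\<exists>q. linear R E E q \<and> (\<forall>X\<in>carrier (quotient_module M P). q (k X) = k (s X))"
proof -
  let ?C = "carrier (quotient_module M P)"
  note kl = linear_Hom[OF k_Hom]
  have l: "linear_on R E (k ` ?C) E (\<lambda>z. k (s (inv_into ?C k z)))"
    by (rule linear_comp[OF linear_comp[OF QE.linear_on_inv_into[OF kl Q.submodule_carrier k_inj] s] kl])
  obtain q where q: "linear R E E q" "\<And>z. z \<in> k ` ?C \<Longrightarrow> q z = k (s (inv_into ?C k z))"
    using injective_extend[OF injective_E sigma_E QE.submodule_image[OF kl Q.submodule_carrier] l] by blast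
  have "q (k X) = k (s X)" if "X \<in> ?C" for X
    using q(2)[OF imageI[OF that]] inv_into_f_f[OF k_inj that] by simp
  then show ?thesis using q(1) by blast
qed

text \<open>The embedding of End(M/P) into End(E) along which fractions are formed. Extensions to E
  are unique by \<open>End_eq_on_k\<close>, which is why choosing one for each s gives a ring
  homomorphism.\<close>

definition \<phi> where
  "\<phi> s = restrict (SOME q. linear R E E q \<and> (\<forall>X\<in>carrier (quotient_module M P). q (k X) = k (s X))) (carrier E)"

lemma \<phi>_closed: "s \<in> carrier (End_ring R (quotient_module M P)) \<Longrightarrow> \<phi> s \<in> carrier (End_ring R E)"
  and \<phi>_k: "s \<in> carrier (End_ring R (quotient_module M P)) \<Longrightarrow> X \<in> carrier (quotient_module M P) \<Longrightarrow> \<phi> s (k X) = k (s X)"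
proof -
  assume "s \<in> carrier (End_ring R (quotient_module M P))"
  then have "linear R (quotient_module M P) (quotient_module M P) s" by (simp add: End_ring_simps linear_Hom)
  note * = someI_ex[OF exists_extension[OF this]]
  show "\<phi> s \<in> carrier (End_ring R E)" unfolding \<phi>_def by (rule End_restrict[OF *[THEN conjunct1]])
  assume X: "X \<in> carrier (quotient_module M P)"
  show "\<phi> s (k X) = k (s X)"
    unfolding \<phi>_def using *[THEN conjunct2, rule_format, OF X] Hom_closed[OF k_Hom X] by simp
qed

lemma End_eq_on_k:
  assumes f: "f \<in> carrier (End_ring R E)" and g: "g \<in> carrier (End_ring R E)"
    and eq: "\<And>X. X \<in> carrier (quotient_module M P) \<Longrightarrow> f (k X) = g (k X)"
  shows "f = g"
proof (rule End_eqI[OF f g], rule linear_eqI[OF ess_embedded_E End_linear[OF f] End_linear[OF g]])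
  fix i u assume "i \<in> index_set P" "u \<in> U i"
  then have "u \<in> carrier M" by (rule U_carrier)
  then show "f (\<kappa> u) = g (\<kappa> u)" unfolding \<kappa>_def by (intro eq coset_closed[OF submodule_P])
qed

lemma EndQ_closed: "s \<in> carrier (End_ring R (quotient_module M P)) \<Longrightarrow> X \<in> carrier (quotient_module M P) \<Longrightarrow> s X \<in> carrier (quotient_module M P)"
  unfolding End_ring_simps by (rule Hom_closed)

lemma EndQ_mult: "X \<in> carrier (quotient_module M P) \<Longrightarrow> (f \<otimes>\<^bsub>End_ring R (quotient_module M P)\<^esub> g) X = f (g X)"
  by (simp add: End_ring_simps compose_def)

lemma k_closed: "X \<in> carrier (quotient_module M P) \<Longrightarrow> k X \<in> carrier E"
  by (rule Hom_closed[OF k_Hom])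

lemma \<phi>_hom: "\<phi> \<in> ring_hom (End_ring R (quotient_module M P)) (End_ring R E)"
proof (rule ring_hom_memI)
  let ?S = "End_ring R (quotient_module M P)" and ?E = "End_ring R E"
  fix s t assume s: "s \<in> carrier ?S" and t: "t \<in> carrier ?S"
  note cs = \<phi>_closed[OF s] and ct = \<phi>_closed[OF t]
  show "\<phi> (s \<otimes>\<^bsub>?S\<^esub> t) = \<phi> s \<otimes>\<^bsub>?E\<^esub> \<phi> t"
  proof (rule End_eq_on_k[OF \<phi>_closed[OF EndQ.m_closed[OF s t]] End.m_closed[OF cs ct]])
    fix X assume X: "X \<in> carrier (quotient_module M P)"
    show "\<phi> (s \<otimes>\<^bsub>?S\<^esub> t) (k X) = (\<phi> s \<otimes>\<^bsub>?E\<^esub> \<phi> t) (k X)"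
      using \<phi>_k[OF EndQ.m_closed[OF s t] X] EndQ_mult[OF X] End_mult[OF k_closed[OF X]] \<phi>_k[OF t X]
        \<phi>_k[OF s EndQ_closed[OF t X]] by simp
  qed
  show "\<phi> (s \<oplus>\<^bsub>?S\<^esub> t) = \<phi> s \<oplus>\<^bsub>?E\<^esub> \<phi> t"
  proof (rule End_eq_on_k[OF \<phi>_closed[OF EndQ.a_closed[OF s t]] End.a_closed[OF cs ct]])
    fix X assume X: "X \<in> carrier (quotient_module M P)"
    have "\<phi> (s \<oplus>\<^bsub>?S\<^esub> t) (k X) = k (s X \<oplus>\<^bsub>quotient_module M P\<^esub> t X)"
      using \<phi>_k[OF EndQ.a_closed[OF s t] X] X by (simp add: End_ring_simps)
    also have "\<dots> = k (s X) \<oplus>\<^bsub>E\<^esub> k (t X)"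
      by (rule linear_on_add[OF linear_Hom[OF k_Hom] EndQ_closed[OF s X] EndQ_closed[OF t X]])
    also have "\<dots> = (\<phi> s \<oplus>\<^bsub>?E\<^esub> \<phi> t) (k X)"
      using k_closed[OF X] \<phi>_k[OF s X] \<phi>_k[OF t X] by (simp add: End_ring_simps)
    finally show "\<phi> (s \<oplus>\<^bsub>?S\<^esub> t) (k X) = (\<phi> s \<oplus>\<^bsub>?E\<^esub> \<phi> t) (k X)" .
  qed
next
  show "\<phi> \<one>\<^bsub>End_ring R (quotient_module M P)\<^esub> = \<one>\<^bsub>End_ring R E\<^esub>"
  proof (rule End_eq_on_k[OF \<phi>_closed[OF EndQ.one_closed] End.one_closed])
    fix X assume X: "X \<in> carrier (quotient_module M P)"
    show "\<phi> \<one>\<^bsub>End_ring R (quotient_module M P)\<^esub> (k X) = \<one>\<^bsub>End_ring R E\<^esub> (k X)"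
      using \<phi>_k[OF EndQ.one_closed X] X k_closed[OF X] by (simp add: End_ring_simps)
  qed
qed (rule \<phi>_closed)

lemma \<phi>_inj: "inj_on \<phi> (carrier (End_ring R (quotient_module M P)))"
proof (rule inj_onI)
  fix s t assume s: "s \<in> carrier (End_ring R (quotient_module M P))" and t: "t \<in> carrier (End_ring R (quotient_module M P))"
    and e: "\<phi> s = \<phi> t"
  have "s X = t X" if X: "X \<in> carrier (quotient_module M P)" for X
    using \<phi>_k[OF s X] \<phi>_k[OF t X] e by (intro inj_onD[OF k_inj _ EndQ_closed[OF s X] EndQ_closed[OF t X]]) simp
  then show "s = t" using s t unfolding End_ring_simps by (intro Hom_ext)
qed

text \<open>A nonzero q with \<open>\<phi> s\<close> q = 0 has an image containing some nonzero
  \<open>\<kappa> y\<close>, so s kills the coset of y and y lies in P, the kernel of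
  \<open>\<kappa>\<close>. Hence \<open>\<phi> s\<close> is left cancellable, and thus a unit in the
  artinian ring.\<close>

lemma injective_unit:
  assumes s: "s \<in> carrier (End_ring R (quotient_module M P))"
    and inj: "\<And>x. x \<in> carrier M \<Longrightarrow> s (P +>\<^bsub>M\<^esub> x) = \<zero>\<^bsub>quotient_module M P\<^esub> \<Longrightarrow> x \<in> P"
  shows "\<phi> s \<in> Units (End_ring R E)"
proof (rule End.left_cancellable_unit[OF End_right_artinian \<phi>_closed[OF s]])
  fix q assume q: "q \<in> carrier (End_ring R E)" and z: "\<phi> s \<otimes>\<^bsub>End_ring R E\<^esub> q = \<zero>\<^bsub>End_ring R E\<^esub>"
  have im: "submodule (q ` carrier E) R E" by (rule EE.submodule_image[OF End_linear[OF q] E.submodule_carrier])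
  have "q ` carrier E = {\<zero>\<^bsub>E\<^esub>}"
  proof (rule ccontr)
    assume "q ` carrier E \<noteq> {\<zero>\<^bsub>E\<^esub>}"
    then obtain y where y: "y \<in> carrier M" "\<kappa> y \<in> q ` carrier E" "\<kappa> y \<noteq> \<zero>\<^bsub>E\<^esub>" using meets_image[OF im] by blast
    obtain x where x: "x \<in> carrier E" "\<kappa> y = q x" using y(2) by blast
    have Y: "P +>\<^bsub>M\<^esub> y \<in> carrier (quotient_module M P)" by (rule coset_closed[OF submodule_P y(1)])
    have "\<phi> s (\<kappa> y) = \<zero>\<^bsub>E\<^esub>" using fun_cong[OF z, of x] x by (simp add: End_mult End_zero)
    then have "k (s (P +>\<^bsub>M\<^esub> y)) = \<zero>\<^bsub>E\<^esub>" using \<phi>_k[OF s Y] unfolding \<kappa>_def by simp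
    then have "s (P +>\<^bsub>M\<^esub> y) = \<zero>\<^bsub>quotient_module M P\<^esub>"
      using QE.inj_on_iff_kernel[OF linear_Hom[OF k_Hom] Q.submodule_carrier] k_inj EndQ_closed[OF s Y] by blast
    then show False using inj[OF y(1)] \<kappa>_kernel[OF y(1)] y(3) by blast
  qed
  then have "q x = \<zero>\<^bsub>E\<^esub>" if "x \<in> carrier E" for x using that by blast
  then show "q = \<zero>\<^bsub>End_ring R E\<^esub>" by (intro End_eqI[OF q End.zero_closed]) (simp add: End_zero)
qed

text \<open>The endomorphism of M/P induced by an endomorphism of M; it exists because P is fully
  invariant.\<close>

definition bar where
  "bar s = restrict (SOME g. linear R (quotient_module M P) (quotient_module M P) g \<and>
     (\<forall>x\<in>carrier M. g (P +>\<^bsub>M\<^esub> x) = P +>\<^bsub>M\<^esub> s x)) (carrier (quotient_module M P))"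

lemma bar_closed: "linear R M M s \<Longrightarrow> bar s \<in> carrier (End_ring R (quotient_module M P))"
  and bar_coset: "linear R M M s \<Longrightarrow> x \<in> carrier M \<Longrightarrow> bar s (P +>\<^bsub>M\<^esub> x) = P +>\<^bsub>M\<^esub> s x"
proof -
  assume s: "linear R M M s"
  have l: "linear R M (quotient_module M P) (\<lambda>x. P +>\<^bsub>M\<^esub> s x)"
    by (rule linear_comp[OF s linear_coset[OF submodule_P]])
  have "P +>\<^bsub>M\<^esub> s x = \<zero>\<^bsub>quotient_module M P\<^esub>" if "x \<in> P" for x
  proof -
    have "s x \<in> P" by (rule fully_invariant_closed[OF minimal_prime_fully_invariant[OF P] s that])
    then show ?thesis using coset_eq_zero_iff[OF submodule_P submodule_mem[OF submodule_P]] by blast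
  qed
  then have "\<exists>g. linear R (quotient_module M P) (quotient_module M P) g \<and> (\<forall>x\<in>carrier M. g (P +>\<^bsub>M\<^esub> x) = P +>\<^bsub>M\<^esub> s x)"
    using linear_from_quotient[OF Q.left_module_axioms submodule_P l] by metis
  note * = someI_ex[OF this]
  show "bar s \<in> carrier (End_ring R (quotient_module M P))"
    unfolding bar_def End_ring_simps by (rule QQ.Hom_restrict[OF *[THEN conjunct1]])
  assume x: "x \<in> carrier M"
  show "bar s (P +>\<^bsub>M\<^esub> x) = P +>\<^bsub>M\<^esub> s x"
    unfolding bar_def using *[THEN conjunct2, rule_format, OF x] coset_closed[OF submodule_P x] by simp
qed

lemma \<phi>_bar: "linear R M M s \<Longrightarrow> x \<in> carrier M \<Longrightarrow> \<phi> (bar s) (\<kappa> x) = \<kappa> (s x)"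
  unfolding \<kappa>_def using \<phi>_k[OF bar_closed coset_closed[OF submodule_P]] bar_coset by simp

lemma End_eq_on_\<kappa>:
  assumes f: "f \<in> carrier (End_ring R E)" and g: "g \<in> carrier (End_ring R E)"
    and eq: "\<And>x. x \<in> carrier M \<Longrightarrow> f (\<kappa> x) = g (\<kappa> x)"
  shows "f = g"
proof (rule End_eq_on_k[OF f g])
  fix X assume "X \<in> carrier (quotient_module M P)"
  then obtain x where "x \<in> carrier M" "X = P +>\<^bsub>M\<^esub> x" unfolding coset_mem_quotient[OF submodule_P] by (elim bexE)
  then show "f (k X) = g (k X)" using eq unfolding \<kappa>_def by simp
qed

text \<open>If the preimage in M of the kernel of s were not inside P, it would meet N, and there
  would be a nonzero v from M into their intersection. Then s times \<open>bar v\<close> is zero, so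
  \<open>bar v\<close> is zero by regularity, and v takes values in both P and N.\<close>

lemma regular_injective:
  assumes s: "s \<in> regular_elements (End_ring R (quotient_module M P))"
    and x: "x \<in> carrier M" "s (P +>\<^bsub>M\<^esub> x) = \<zero>\<^bsub>quotient_module M P\<^esub>"
  shows "x \<in> P"
proof (rule ccontr)
  assume "x \<notin> P"
  have sc: "s \<in> carrier (End_ring R (quotient_module M P))" using s by (simp add: regular_elements_def)
  have sl: "linear R M (quotient_module M P) (\<lambda>x. s (P +>\<^bsub>M\<^esub> x))"
    using sc by (intro linear_comp[OF linear_coset[OF submodule_P]] linear_Hom) (simp add: End_ring_simps)
  define L where "L = {x\<in>carrier M. s (P +>\<^bsub>M\<^esub> x) = \<zero>\<^bsub>quotient_module M P\<^esub>}"
  have L: "submodule L R M" unfolding L_def by (rule MQ.submodule_kernel[OF sl submodule_carrier])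
  have "\<not> L \<subseteq> P" using x \<open>x \<notin> P\<close> unfolding L_def by blast
  then obtain y where y: "y \<in> L" "y \<in> N" "y \<noteq> \<zero>\<^bsub>M\<^esub>" by (rule meets_perp_minimal_prime[OF P L])
  obtain v m where v: "linear R M M v" "\<And>y. y \<in> carrier M \<Longrightarrow> v y \<in> L \<inter> N" "m \<in> carrier M" "v m \<noteq> \<zero>\<^bsub>M\<^esub>"
    by (rule detect_nonzero[OF submodule_Int[OF L submodule_perp] IntI[OF y(1,2)] y(3)]) blast
  have "s \<otimes>\<^bsub>End_ring R (quotient_module M P)\<^esub> bar v = \<zero>\<^bsub>End_ring R (quotient_module M P)\<^esub>"
  proof (rule Hom_ext)
    show "s \<otimes>\<^bsub>End_ring R (quotient_module M P)\<^esub> bar v \<in> Hom R (quotient_module M P) (quotient_module M P)"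
      using EndQ.m_closed[OF sc bar_closed[OF v(1)]] by (simp add: End_ring_simps)
    show "\<zero>\<^bsub>End_ring R (quotient_module M P)\<^esub> \<in> Hom R (quotient_module M P) (quotient_module M P)"
      using EndQ.zero_closed by (simp add: End_ring_simps)
    fix X assume X: "X \<in> carrier (quotient_module M P)"
    then obtain z where z: "z \<in> carrier M" "X = P +>\<^bsub>M\<^esub> z" unfolding coset_mem_quotient[OF submodule_P] by (elim bexE)
    have "v z \<in> L" using v(2)[OF z(1)] by blast
    then have "(s \<otimes>\<^bsub>End_ring R (quotient_module M P)\<^esub> bar v) X = \<zero>\<^bsub>quotient_module M P\<^esub>"
      using EndQ_mult[OF X] bar_coset[OF v(1) z(1)] unfolding z(2) L_def by simp
    then show "(s \<otimes>\<^bsub>End_ring R (quotient_module M P)\<^esub> bar v) X = \<zero>\<^bsub>End_ring R (quotient_module M P)\<^esub> X"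
      using X by (simp add: End_ring_simps)
  qed
  then have "bar v = \<zero>\<^bsub>End_ring R (quotient_module M P)\<^esub>"
    using s bar_closed[OF v(1)] unfolding regular_elements_def by blast
  then have "P +>\<^bsub>M\<^esub> v m = \<zero>\<^bsub>quotient_module M P\<^esub>"
    using bar_coset[OF v(1,3)] coset_closed[OF submodule_P v(3)] by (simp add: End_ring_simps)
  then have "v m \<in> P" using coset_eq_zero_iff[OF submodule_P linear_on_closed[OF v(1,3)]] by simp
  then show False using Int_perp[OF submodule_P] v(2)[OF v(3)] v(4) by blast
qed

text \<open>A submodule not contained in P meets N.\<close>

lemma kernel_N_subset:
  assumes s: "linear R M M s" and inj: "\<And>x. x \<in> N \<Longrightarrow> s x = \<zero>\<^bsub>M\<^esub> \<Longrightarrow> x = \<zero>\<^bsub>M\<^esub>"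
    and x: "x \<in> carrier M" "s x = \<zero>\<^bsub>M\<^esub>"
  shows "x \<in> P"
proof (rule ccontr)
  assume "x \<notin> P"
  have L: "submodule {x\<in>carrier M. s x = \<zero>\<^bsub>M\<^esub>} R M" by (rule MM.submodule_kernel[OF s submodule_carrier])
  have "\<not> {x\<in>carrier M. s x = \<zero>\<^bsub>M\<^esub>} \<subseteq> P" using x \<open>x \<notin> P\<close> by blast
  then obtain y where "y \<in> {x\<in>carrier M. s x = \<zero>\<^bsub>M\<^esub>}" "y \<in> N" "y \<noteq> \<zero>\<^bsub>M\<^esub>" by (rule meets_perp_minimal_prime[OF P L])
  then show False using inj by blast
qed

text \<open>Goldie's argument: among the endomorphisms with image in \<open>D\<close> that meet their kernel trivially,
  one whose extension has minimal right annihilator is injective on \<open>N\<close>; otherwise a map into a uniform submodule of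
  the kernel could be added to it.\<close>

lemma essential_contains_injective_image:
  assumes D: "submodule D R M" and DN: "D \<subseteq> N"
    and ess: "\<And>L x. submodule L R M \<Longrightarrow> L \<subseteq> N \<Longrightarrow> x \<in> L \<Longrightarrow> x \<noteq> \<zero>\<^bsub>M\<^esub> \<Longrightarrow> \<exists>y\<in>L. y \<in> D \<and> y \<noteq> \<zero>\<^bsub>M\<^esub>"
  obtains s where "linear R M M s" "\<And>x. x \<in> carrier M \<Longrightarrow> s x \<in> D" "\<And>x. x \<in> N \<Longrightarrow> s x = \<zero>\<^bsub>M\<^esub> \<Longrightarrow> x = \<zero>\<^bsub>M\<^esub>"
proof -
  define C where "C = {s. linear R M M s \<and> (\<forall>x\<in>carrier M. s x \<in> D) \<and> (\<forall>x\<in>carrier M. s (s x) = \<zero>\<^bsub>M\<^esub> \<longrightarrow> s x = \<zero>\<^bsub>M\<^esub>)}"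
  define F where "F s = {q \<in> carrier (End_ring R E). \<phi> (bar s) \<otimes>\<^bsub>End_ring R E\<^esub> q = \<zero>\<^bsub>End_ring R E\<^esub>}" for s
  have Clin: "linear R M M s" if "s \<in> C" for s using that by (simp add: C_def)
  have \<phi>c: "\<phi> (bar s) \<in> carrier (End_ring R E)" if "linear R M M s" for s by (rule \<phi>_closed[OF bar_closed[OF that]])
  have FI: "right_ideal (F s) (End_ring R E)" if "s \<in> C" for s
  proof (rule End.right_idealI)
    note c = \<phi>c[OF Clin[OF that]]
    show "\<zero>\<^bsub>End_ring R E\<^esub> \<in> F s" using c by (simp add: F_def)
    show "x \<oplus>\<^bsub>End_ring R E\<^esub> y \<in> F s" if "x \<in> F s" "y \<in> F s" for x y
      using that c by (simp add: F_def End.r_distr)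
    show "x \<otimes>\<^bsub>End_ring R E\<^esub> y \<in> F s" if "x \<in> F s" "y \<in> carrier (End_ring R E)" for x y
      using that c End.m_assoc[OF c, of x y] by (simp add: F_def)
  qed (auto simp: F_def)
  have "(\<lambda>x. \<zero>\<^bsub>M\<^esub>) \<in> C" using MM.linear_zero submodule_zero[OF D] by (simp add: C_def)
  then obtain s where s: "s \<in> C" and min: "\<And>t. t \<in> C \<Longrightarrow> \<not> F t \<subset> F s"
    using End.minimal_right_ideal[OF End_right_artinian _ FI] by metis
  have sl: "linear R M M s" and sD: "\<And>x. x \<in> carrier M \<Longrightarrow> s x \<in> D"
    and ss: "\<And>x. x \<in> carrier M \<Longrightarrow> s (s x) = \<zero>\<^bsub>M\<^esub> \<Longrightarrow> s x = \<zero>\<^bsub>M\<^esub>" using s by (auto simp: C_def)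
  have "x = \<zero>\<^bsub>M\<^esub>" if x: "x \<in> N" "s x = \<zero>\<^bsub>M\<^esub>" for x
  proof (rule ccontr)
    assume "x \<noteq> \<zero>\<^bsub>M\<^esub>"
    define L where "L = {x\<in>N. s x = \<zero>\<^bsub>M\<^esub>}"
    have L: "submodule L R M" unfolding L_def
      by (rule MM.submodule_kernel[OF linear_on_subset[OF sl submodule_subset[OF submodule_perp]] submodule_perp])
    have "L \<subseteq> N" "x \<in> L" using x by (auto simp: L_def)
    then obtain y where "y \<in> L" "y \<in> D" "y \<noteq> \<zero>\<^bsub>M\<^esub>" using ess[OF L _ _ \<open>x \<noteq> \<zero>\<^bsub>M\<^esub>\<close>] by blast
    then obtain V where V: "uniform_submodule R M V" "V \<subseteq> L \<inter> D"
      using exists_uniform[OF submodule_Int[OF L D]] by blast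
    have Vs: "submodule V R M" using V(1) by (simp add: uniform_submodule_def)
    \<comment> \<open>V is not inside \<open>perp V\<close>, so some t maps M into V and is nonzero
      on V; as V is uniform, t is injective on V.\<close>
    obtain x0 where x0: "x0 \<in> V" "x0 \<notin> perp V" using uniform_perp_disjoint[OF V(1)] by blast
    have x0c: "x0 \<in> carrier M" by (rule submodule_mem[OF Vs x0(1)])
    obtain t where t: "linear R M M t" "t ` carrier M \<subseteq> V" "t x0 \<noteq> \<zero>\<^bsub>M\<^esub>"
      using x0(2) x0c unfolding perp_def by blast
    have tV: "t x \<in> V" if "x \<in> carrier M" for x using t(2) that by blast
    have tinj: "x = \<zero>\<^bsub>M\<^esub>" if "x \<in> V" "t x = \<zero>\<^bsub>M\<^esub>" for x
      by (rule uniform_injective[OF ess_embedded_self self_in_sigma V(1)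
            linear_on_subset[OF t(1) submodule_subset[OF Vs]] x0(1) t(3) that])
    have sV: "s x = \<zero>\<^bsub>M\<^esub>" if "x \<in> V" for x using V(2) that unfolding L_def by blast
    define s' where "s' x = s x \<oplus>\<^bsub>M\<^esub> t x" for x
    have s'l: "linear R M M s'" unfolding s'_def by (rule MM.linear_on_sum[OF sl t(1)])
    have s'D: "s' x \<in> D" if "x \<in> carrier M" for x
      unfolding s'_def using tV[OF that] V(2) by (intro submodule_add[OF D sD[OF that]]) blast
    \<comment> \<open>V lies in the kernel of s, so s (s' z) = s (s z). The condition that s is
      injective on its image then gives s z = 0, and t z = 0 remains.\<close>
    have split: "s z = \<zero>\<^bsub>M\<^esub> \<and> t z = \<zero>\<^bsub>M\<^esub>" if z: "z \<in> carrier M" "s' z = \<zero>\<^bsub>M\<^esub>" for z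
    proof -
      have sz: "s z \<in> carrier M" and tz: "t z \<in> carrier M" using linear_on_closed[OF sl z(1)] linear_on_closed[OF t(1) z(1)] .
      have "s (s' z) = s (s z) \<oplus>\<^bsub>M\<^esub> s (t z)" unfolding s'_def by (rule linear_on_add[OF sl sz tz])
      then have "s (s z) = \<zero>\<^bsub>M\<^esub>"
        using z(2) MM.linear_on_zero[OF sl submodule_carrier] sV[OF tV[OF z(1)]] linear_on_closed[OF sl sz] by simp
      then have "s z = \<zero>\<^bsub>M\<^esub>" by (rule ss[OF z(1)])
      then show ?thesis using z(2) tz unfolding s'_def by simp
    qed
    have "s' x = \<zero>\<^bsub>M\<^esub>" if x: "x \<in> carrier M" "s' (s' x) = \<zero>\<^bsub>M\<^esub>" for x
    proof -
      have sx: "s x \<in> carrier M" and tx: "t x \<in> carrier M" using linear_on_closed[OF sl x(1)] linear_on_closed[OF t(1) x(1)] .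
      have y: "s (s' x) = \<zero>\<^bsub>M\<^esub>" "t (s' x) = \<zero>\<^bsub>M\<^esub>" using split[OF linear_on_closed[OF s'l x(1)] x(2)] by blast+
      have "s (s' x) = s (s x) \<oplus>\<^bsub>M\<^esub> s (t x)" unfolding s'_def by (rule linear_on_add[OF sl sx tx])
      then have "s (s x) = \<zero>\<^bsub>M\<^esub>" using y(1) sV[OF tV[OF x(1)]] linear_on_closed[OF sl sx] by simp
      then have "s x = \<zero>\<^bsub>M\<^esub>" by (rule ss[OF x(1)])
      then have "s' x = t x" using tx by (simp add: s'_def)
      then show ?thesis using tinj[OF tV[OF x(1)]] y(2) by simp
    qed
    then have s'C: "s' \<in> C" using s'l s'D by (simp add: C_def)
    have nonzero: "\<kappa> w \<noteq> \<zero>\<^bsub>E\<^esub>" if "w \<in> N" "w \<noteq> \<zero>\<^bsub>M\<^esub>" for w using \<kappa>_kernel_N that by blast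
    \<comment> \<open>By essentiality it suffices to test where q takes values in the image of N;
      there \<open>split\<close> turns vanishing of s' into vanishing of s.\<close>
    have "F s' \<subseteq> F s"
    proof
      fix q assume "q \<in> F s'"
      then have qc: "q \<in> carrier (End_ring R E)" and z: "\<phi> (bar s') \<otimes>\<^bsub>End_ring R E\<^esub> q = \<zero>\<^bsub>End_ring R E\<^esub>" by (simp_all add: F_def)
      note ql = End_linear[OF qc]
      have sq: "linear R E E (\<lambda>z. \<phi> (bar s) (q z))" by (rule linear_comp[OF ql End_linear[OF \<phi>c[OF sl]]])
      have "\<phi> (bar s) (q z) = \<zero>\<^bsub>E\<^esub>" if zc: "z \<in> carrier E" for z
      proof (rule ess_embedded_eq[OF ess_embedded_E sigma_E E.submodule_carrier sq EE.linear_zero _ zc])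
        fix K assume K: "submodule K R E" "K \<subseteq> carrier E" "K \<noteq> {\<zero>\<^bsub>E\<^esub>}"
        have qK: "submodule (q ` K) R E" by (rule EE.submodule_image[OF linear_on_subset[OF ql K(2)] K(1)])
        show "\<exists>x\<in>K. x \<noteq> \<zero>\<^bsub>E\<^esub> \<and> \<phi> (bar s) (q x) = \<zero>\<^bsub>E\<^esub>"
        proof (cases "q ` K = {\<zero>\<^bsub>E\<^esub>}")
          case True
          obtain x where x: "x \<in> K" "x \<noteq> \<zero>\<^bsub>E\<^esub>" using E.nonzero_submodule[OF K(1,3)] by blast
          then have "q x = \<zero>\<^bsub>E\<^esub>" using True by blast
          then show ?thesis using x EE.linear_on_zero[OF End_linear[OF \<phi>c[OF sl]] E.submodule_carrier] by auto
        next
          case False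
          obtain w where w: "w \<in> N" "w \<noteq> \<zero>\<^bsub>M\<^esub>" "\<kappa> w \<in> q ` K" using meets_perp_image[OF qK False] by blast
          obtain x where x: "x \<in> K" "\<kappa> w = q x" using w(3) by blast
          have wc: "w \<in> carrier M" by (rule N_carrier[OF w(1)])
          have xc: "x \<in> carrier E" using K(2) x(1) by blast
          have "\<kappa> (s' w) = \<zero>\<^bsub>E\<^esub>"
            using fun_cong[OF z, of x] \<phi>_bar[OF s'l wc] x(2) by (simp add: End_mult[OF xc] End_zero[OF xc])
          moreover have "s' w \<in> N" using s'D[OF wc] DN by blast
          ultimately have "s' w = \<zero>\<^bsub>M\<^esub>" using nonzero by blast
          then have "\<phi> (bar s) (q x) = \<zero>\<^bsub>E\<^esub>" using split[OF wc] \<phi>_bar[OF sl wc] x(2) \<kappa>_zero by simp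
          moreover have "x \<noteq> \<zero>\<^bsub>E\<^esub>" using nonzero[OF w(1,2)] x(2) EE.linear_on_zero[OF ql E.submodule_carrier] by auto
          ultimately show ?thesis using x(1) by blast
        qed
      qed
      then have "\<phi> (bar s) \<otimes>\<^bsub>End_ring R E\<^esub> q = \<zero>\<^bsub>End_ring R E\<^esub>"
        by (intro End_eqI[OF End.m_closed[OF \<phi>c[OF sl] qc] End.zero_closed]) (simp add: End_mult End_zero)
      then show "q \<in> F s" using qc by (simp add: F_def)
    qed
    \<comment> \<open>The inclusion is strict because of t: the product s t vanishes, since t maps
      into V, while s' t = t t does not vanish at x0.\<close>
    moreover have "\<phi> (bar t) \<in> F s"
    proof -
      have "\<phi> (bar s) \<otimes>\<^bsub>End_ring R E\<^esub> \<phi> (bar t) = \<zero>\<^bsub>End_ring R E\<^esub>"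
      proof (rule End_eq_on_\<kappa>[OF End.m_closed[OF \<phi>c[OF sl] \<phi>c[OF t(1)]] End.zero_closed])
        fix x assume x: "x \<in> carrier M"
        show "(\<phi> (bar s) \<otimes>\<^bsub>End_ring R E\<^esub> \<phi> (bar t)) (\<kappa> x) = \<zero>\<^bsub>End_ring R E\<^esub> (\<kappa> x)"
          using \<phi>_bar[OF t(1) x] \<phi>_bar[OF sl linear_on_closed[OF t(1) x]] sV[OF tV[OF x]] \<kappa>_zero
          by (simp add: End_mult[OF \<kappa>_closed[OF x]] End_zero[OF \<kappa>_closed[OF x]])
      qed
      then show ?thesis using \<phi>c[OF t(1)] by (simp add: F_def)
    qed
    moreover have "\<phi> (bar t) \<notin> F s'"
    proof
      assume "\<phi> (bar t) \<in> F s'"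
      then have z: "\<phi> (bar s') \<otimes>\<^bsub>End_ring R E\<^esub> \<phi> (bar t) = \<zero>\<^bsub>End_ring R E\<^esub>" by (simp add: F_def)
      have tc: "t x0 \<in> carrier M" by (rule linear_on_closed[OF t(1) x0c])
      have "\<kappa> (s' (t x0)) = \<zero>\<^bsub>E\<^esub>"
        using fun_cong[OF z, of "\<kappa> x0"] \<phi>_bar[OF t(1) x0c] \<phi>_bar[OF s'l tc]
        by (simp add: End_mult[OF \<kappa>_closed[OF x0c]] End_zero[OF \<kappa>_closed[OF x0c]])
      moreover have "s' (t x0) \<in> N" using s'D[OF tc] DN by blast
      ultimately have "s' (t x0) = \<zero>\<^bsub>M\<^esub>" using nonzero by blast
      then have "t (t x0) = \<zero>\<^bsub>M\<^esub>" using split[OF tc] by blast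
      then show False using tinj[OF tV[OF x0c]] t(3) by blast
    qed
    ultimately show False using min[OF s'C] by blast
  qed
  then show ?thesis using that sl sD by blast
qed

text \<open>Given an endomorphism q of E, let D be the submodule of N that q sends back into N. An s
  with image in D that is injective on N serves as denominator, and q s, read as a map into N, as
  numerator.\<close>

theorem End_classical_quotient:
  "classical_right_quotient_ring (End_ring R E) (End_ring R (quotient_module M P))"
  unfolding classical_right_quotient_ring_def
proof (intro conjI End.ring_axioms EndQ.ring_axioms bexI[OF _ \<phi>_hom] \<phi>_inj ballI)
  fix s assume s: "s \<in> regular_elements (End_ring R (quotient_module M P))"
  show "\<phi> s \<in> Units (End_ring R E)"
    by (rule injective_unit[OF _ regular_injective[OF s]]) (use s in \<open>simp add: regular_elements_def\<close>)
next
  let ?S = "End_ring R (quotient_module M P)" and ?E = "End_ring R E"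
  fix q assume q: "q \<in> carrier ?E"
  note ql = End_linear[OF q]
  have \<kappa>N: "linear_on R M N E \<kappa>" by (rule \<kappa>_linear_on[OF submodule_subset[OF submodule_perp]])
  have q\<kappa>: "linear_on R M N E (\<lambda>x. q (\<kappa> x))" by (rule linear_comp[OF \<kappa>N ql])
  define D where "D = {x\<in>N. q (\<kappa> x) \<in> \<kappa> ` N}"
  have D: "submodule D R M" unfolding D_def
    by (rule ME.submodule_preimage[OF q\<kappa> submodule_perp ME.submodule_image[OF \<kappa>N submodule_perp]])
  have DN: "D \<subseteq> N" by (auto simp: D_def)
  \<comment> \<open>If q kills L, then L lies in D; otherwise q L contains a nonzero element of the
    image of N.\<close>
  have ess: "\<exists>y\<in>L. y \<in> D \<and> y \<noteq> \<zero>\<^bsub>M\<^esub>" if L: "submodule L R M" "L \<subseteq> N" and x: "x \<in> L" "x \<noteq> \<zero>\<^bsub>M\<^esub>" for L x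
  proof (cases "(\<lambda>x. q (\<kappa> x)) ` L = {\<zero>\<^bsub>E\<^esub>}")
    case True
    then have "q (\<kappa> x) = \<zero>\<^bsub>E\<^esub>" using x by blast
    moreover have "\<zero>\<^bsub>E\<^esub> \<in> \<kappa> ` N" using \<kappa>_zero submodule_zero[OF submodule_perp] by (metis imageI)
    ultimately show ?thesis using x L(2) unfolding D_def by auto
  next
    case False
    have im: "submodule ((\<lambda>x. q (\<kappa> x)) ` L) R E" by (rule ME.submodule_image[OF linear_on_subset[OF q\<kappa> L(2)] L(1)])
    obtain w where w: "w \<in> N" "w \<noteq> \<zero>\<^bsub>M\<^esub>" "\<kappa> w \<in> (\<lambda>x. q (\<kappa> x)) ` L" using meets_perp_image[OF im False] by blast
    obtain y where y: "y \<in> L" "\<kappa> w = q (\<kappa> y)" using w(3) by blast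
    have "q (\<kappa> y) \<in> \<kappa> ` N" unfolding y(2)[symmetric] using w(1) by (rule imageI)
    then have "y \<in> D" using y(1) L(2) unfolding D_def by blast
    moreover have "y \<noteq> \<zero>\<^bsub>M\<^esub>"
      using y(2) \<kappa>_kernel_N[OF w(1)] w(2) ME.linear_on_zero[OF q\<kappa> submodule_perp] by auto
    ultimately show ?thesis using y(1) by blast
  qed
  obtain s where s: "linear R M M s" "\<And>x. x \<in> carrier M \<Longrightarrow> s x \<in> D" "\<And>x. x \<in> N \<Longrightarrow> s x = \<zero>\<^bsub>M\<^esub> \<Longrightarrow> x = \<zero>\<^bsub>M\<^esub>"
    by (rule essential_contains_injective_image[OF D DN ess]) blast+
  define a where "a x = inv_into N \<kappa> (q (\<kappa> (s x)))" for x
  have in\<kappa>: "q (\<kappa> (s x)) \<in> \<kappa> ` N" if "x \<in> carrier M" for x using s(2)[OF that] unfolding D_def by blast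
  have sN: "s ` carrier M \<subseteq> N" using s(2) DN by blast
  have a: "linear R M M a" unfolding a_def
    by (rule linear_on_comp[OF linear_on_comp[OF s(1) q\<kappa> sN] ME.linear_on_inv_into[OF \<kappa>N submodule_perp \<kappa>_inj]])
      (use in\<kappa> in blast)
  have \<kappa>a: "\<kappa> (a x) = q (\<kappa> (s x))" if "x \<in> carrier M" for x
    unfolding a_def by (rule f_inv_into_f[OF in\<kappa>[OF that]])
  have inj: "x \<in> P" if x: "x \<in> carrier M" "bar s (P +>\<^bsub>M\<^esub> x) = \<zero>\<^bsub>quotient_module M P\<^esub>" for x
  proof -
    have "s x \<in> P" using x(2) bar_coset[OF s(1) x(1)] coset_eq_zero_iff[OF submodule_P linear_on_closed[OF s(1) x(1)]] by simp
    moreover have "s x \<in> N" using s(2)[OF x(1)] DN by blast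
    ultimately have "s x = \<zero>\<^bsub>M\<^esub>" by (rule Int_perp[OF submodule_P])
    from kernel_N_subset[OF s(1) s(3) x(1) this] show ?thesis .
  qed
  note bs = bar_closed[OF s(1)] and ba = bar_closed[OF a]
  have unit: "\<phi> (bar s) \<in> Units ?E" by (rule injective_unit[OF bs inj])
  have zero_imp: "x = \<zero>\<^bsub>?S\<^esub>" if x: "x \<in> carrier ?S" "\<phi> x = \<zero>\<^bsub>?E\<^esub>" for x
  proof -
    have "\<phi> x = \<phi> \<zero>\<^bsub>?S\<^esub>" using x(2) ring_hom_zero[OF \<phi>_hom EndQ.ring_axioms End.ring_axioms] by simp
    then show ?thesis by (rule inj_onD[OF \<phi>_inj _ x(1) EndQ.zero_closed])
  qed
  \<comment> \<open>Regularity is pulled back along the injective \<open>\<phi>\<close>, since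
    \<open>\<phi> (bar s)\<close> is invertible.\<close>
  have reg: "bar s \<in> regular_elements ?S"
    unfolding regular_elements_def
  proof (intro CollectI conjI bs ballI impI)
    fix x assume x: "x \<in> carrier ?S"
    note xc = \<phi>_closed[OF x] and uc = End.Units_closed[OF unit]
    show "x = \<zero>\<^bsub>?S\<^esub>" if "bar s \<otimes>\<^bsub>?S\<^esub> x = \<zero>\<^bsub>?S\<^esub>"
    proof (rule zero_imp[OF x])
      have "\<phi> (bar s) \<otimes>\<^bsub>?E\<^esub> \<phi> x = \<zero>\<^bsub>?E\<^esub>"
        using ring_hom_mult[OF \<phi>_hom bs x] that ring_hom_zero[OF \<phi>_hom EndQ.ring_axioms End.ring_axioms] by simp
      then have "\<phi> (bar s) \<otimes>\<^bsub>?E\<^esub> \<phi> x = \<phi> (bar s) \<otimes>\<^bsub>?E\<^esub> \<zero>\<^bsub>?E\<^esub>" using uc by simp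
      then show "\<phi> x = \<zero>\<^bsub>?E\<^esub>" using End.Units_l_cancel[OF unit xc End.zero_closed] by simp
    qed
    show "x = \<zero>\<^bsub>?S\<^esub>" if "x \<otimes>\<^bsub>?S\<^esub> bar s = \<zero>\<^bsub>?S\<^esub>"
    proof (rule zero_imp[OF x])
      have z: "\<phi> x \<otimes>\<^bsub>?E\<^esub> \<phi> (bar s) = \<zero>\<^bsub>?E\<^esub>"
        using ring_hom_mult[OF \<phi>_hom x bs] that ring_hom_zero[OF \<phi>_hom EndQ.ring_axioms End.ring_axioms] by simp
      have "\<phi> x = \<phi> x \<otimes>\<^bsub>?E\<^esub> \<phi> (bar s) \<otimes>\<^bsub>?E\<^esub> inv\<^bsub>?E\<^esub> (\<phi> (bar s))"
        using xc uc unit by (simp add: End.m_assoc)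
      then show "\<phi> x = \<zero>\<^bsub>?E\<^esub>" using z unit by simp
    qed
  qed
  have "\<phi> (bar a) = q \<otimes>\<^bsub>?E\<^esub> \<phi> (bar s)"
  proof (rule End_eq_on_\<kappa>[OF \<phi>_closed[OF ba] End.m_closed[OF q \<phi>_closed[OF bs]]])
    fix x assume x: "x \<in> carrier M"
    show "\<phi> (bar a) (\<kappa> x) = (q \<otimes>\<^bsub>?E\<^esub> \<phi> (bar s)) (\<kappa> x)"
      using \<phi>_bar[OF a x] \<kappa>a[OF x] \<phi>_bar[OF s(1) x] by (simp add: End_mult[OF \<kappa>_closed[OF x]])
  qed
  then have "q = \<phi> (bar a) \<otimes>\<^bsub>?E\<^esub> inv\<^bsub>?E\<^esub> (\<phi> (bar s))"
    using q unit End.Units_closed[OF unit] by (simp add: End.m_assoc)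
  then show "\<exists>a\<in>carrier ?S. \<exists>s\<in>regular_elements ?S. q = \<phi> a \<otimes>\<^bsub>?E\<^esub> inv\<^bsub>?E\<^esub> (\<phi> s)"
    using ba reg by blast
qed

end

section \<open>The product decomposition\<close>

text \<open>Iterated products of lists of rings are built from binary ones, and
  \<open>RDirProd_list_hom1\<close> turns a pair of head and tail into a list.\<close>

lemma RDirProd_list_hom:
  assumes "\<And>i. i \<in> set is \<Longrightarrow> h i \<in> ring_hom Q (S i)"
  shows "(\<lambda>x. map (\<lambda>i. h i x) is) \<in> ring_hom Q (RDirProd_list (map S is))"
  using assms
proof (induction "is")
  case Nil
  then show ?case by (auto simp: ring_hom_def monoid.defs)
next
  case (Cons i "is")
  have "(\<lambda>x. (h i x, map (\<lambda>i. h i x) is)) \<in> ring_hom Q (RDirProd (S i) (RDirProd_list (map S is)))"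
    using Cons by (auto simp: ring_hom_def RDirProd_def DirProd_def monoid.defs)
  from ring_hom_trans[OF this RDirProd_list_hom1] show ?case by (simp add: comp_def)
qed

locale hull_family = uniform_decomposition R M d U
  for R :: "('a, 'r) ring_scheme" and M :: "('a, 'm) module" and d U +
  fixes Mhat :: "('a, 'h) module" and j :: "'m \<Rightarrow> 'h"
    and n :: nat and P :: "nat \<Rightarrow> 'm set"
    and E :: "nat \<Rightarrow> ('a, 'e) module" and k :: "nat \<Rightarrow> 'm set \<Rightarrow> 'e"
  assumes minimal_primes: "bij_betw P {1..n} (minimal_primes_in R M)"
    and hull_M: "injective_hull_in_sigma R M M Mhat j"
    and hulls: "\<And>i. i \<in> {1..n} \<Longrightarrow> injective_hull_in_sigma R M (quotient_module M (P i)) (E i) (k i)"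
begin

lemma prime_hull: "i \<in> {1..n} \<Longrightarrow> prime_hull R M d U (P i) (E i) (k i)"
  using hulls minimal_primes uniform_decomposition_axioms
  by (auto simp: prime_hull_def prime_hull_axioms_def bij_betw_def)

lemma injective_Mhat: "injective_in_sigma R M Mhat"
  using hull_M by (simp add: injective_hull_in_sigma_def)

lemma sigma_Mhat: "in_sigma R M Mhat"
  using injective_Mhat by (simp add: injective_in_sigma_def)

sublocale H: left_module R Mhat
  using sigma_Mhat by (simp add: in_sigma_def)

sublocale MH: two_modules R M Mhat by unfold_locales
sublocale HH: two_modules R Mhat Mhat by unfold_locales
sublocale EndH: ring "End_ring R Mhat" by (rule H.ring_End_ring)

section \<open>The hull of M and the submodules \<open>perp P\<close>\<close>

lemma j_linear: "linear R M Mhat j"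
  and j_inj: "inj_on j (carrier M)"
  using hull_M by (simp_all add: injective_hull_in_sigma_def linear_Hom)

lemma j_kernel: "x \<in> carrier M \<Longrightarrow> j x = \<zero>\<^bsub>Mhat\<^esub> \<Longrightarrow> x = \<zero>\<^bsub>M\<^esub>"
  using MH.inj_on_iff_kernel[OF j_linear submodule_carrier] j_inj by blast

lemma meets_j:
  assumes L: "submodule L R Mhat" "L \<noteq> {\<zero>\<^bsub>Mhat\<^esub>}"
  shows "\<exists>x\<in>carrier M. x \<noteq> \<zero>\<^bsub>M\<^esub> \<and> j x \<in> L"
proof -
  have "j ` carrier M \<inter> L \<noteq> {\<zero>\<^bsub>Mhat\<^esub>}"
    using hull_M L unfolding injective_hull_in_sigma_def essential_submodule_def by blast
  moreover have "submodule (j ` carrier M \<inter> L) R Mhat"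
    by (rule H.submodule_Int[OF MH.submodule_image[OF j_linear submodule_carrier] L(1)])
  ultimately obtain z where z: "z \<in> j ` carrier M" "z \<in> L" "z \<noteq> \<zero>\<^bsub>Mhat\<^esub>" using H.nonzero_submodule by blast
  then obtain x where x: "x \<in> carrier M" "z = j x" by blast
  have "x \<noteq> \<zero>\<^bsub>M\<^esub>" using z(3) x(2) MH.linear_on_zero[OF j_linear submodule_carrier] by auto
  then show ?thesis using x z(2) by blast
qed

lemma ess_embedded_Mhat: "ess_embedded (carrier M) Mhat j"
  unfolding ess_embedded_def
  using H.left_module_axioms submodule_carrier j_linear j_inj meets_j by blast

definition N where "N i = perp (P i)"
definition K where "K i x = k i (P i +>\<^bsub>M\<^esub> x)"

lemma N_submodule: "submodule (N i) R M"
  unfolding N_def by (rule submodule_perp)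

lemma N_carrier: "x \<in> N i \<Longrightarrow> x \<in> carrier M"
  by (rule submodule_mem[OF N_submodule])

lemma meets_N_image:
  assumes L: "submodule L R Mhat" "L \<noteq> {\<zero>\<^bsub>Mhat\<^esub>}"
  obtains i x where "i \<in> {1..n}" "x \<in> N i" "x \<noteq> \<zero>\<^bsub>M\<^esub>" "j x \<in> L"
proof -
  define L0 where "L0 = {x\<in>carrier M. j x \<in> L}"
  have L0: "submodule L0 R M" unfolding L0_def by (rule MH.submodule_preimage[OF j_linear submodule_carrier L(1)])
  obtain x where "x \<in> L0" "x \<noteq> \<zero>\<^bsub>M\<^esub>" using meets_j[OF L] unfolding L0_def by blast
  then obtain Q y where y: "Q \<in> minimal_primes_in R M" "y \<in> L0" "y \<in> perp Q" "y \<noteq> \<zero>\<^bsub>M\<^esub>" by (rule meets_perp[OF L0])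
  obtain i where "i \<in> {1..n}" "Q = P i" using y(1) minimal_primes unfolding bij_betw_def by blast
  then show ?thesis using that y unfolding L0_def N_def by blast
qed

text \<open>From a nonzero h one gets g from M into \<open>N i\<close> and u from M into
  \<open>N l\<close> with h g equal to u, up to the embedding of \<open>N l\<close>. Some u v u is
  nonzero. But g v u takes values in \<open>N i\<close> through g and in \<open>N l\<close> by full
  invariance, hence is zero, and u v u, which is h g v u, vanishes.\<close>

lemma Hom_zero_on:
  assumes i: "i \<in> {1..n}" and l: "l \<in> {1..n}" and ne: "i \<noteq> l"
    and h: "linear_on R M (N i) (E l) h" and x: "x \<in> N i"
  shows "h x = \<zero>\<^bsub>E l\<^esub>"
proof (rule ccontr)
  assume hx: "h x \<noteq> \<zero>\<^bsub>E l\<^esub>"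
  interpret l: prime_hull R M d U "P l" "E l" "k l" by (rule prime_hull[OF l])
  interpret i: prime_hull R M d U "P i" "E i" "k i" by (rule prime_hull[OF i])
  have "P i \<noteq> P l" using minimal_primes i l ne unfolding bij_betw_def inj_on_def by blast
  then have disj: "w = \<zero>\<^bsub>M\<^esub>" if "w \<in> N i" "w \<in> N l" for w
    using perp_Int_perp[OF i.P l.P] that unfolding N_def by blast
  have img: "submodule (h ` N i) R (E l)" by (rule l.ME.submodule_image[OF h N_submodule])
  have "h ` N i \<noteq> {\<zero>\<^bsub>E l\<^esub>}" using x hx by blast
  then obtain w where w: "w \<in> l.N" "w \<noteq> \<zero>\<^bsub>M\<^esub>" "l.\<kappa> w \<in> h ` N i" using l.meets_perp_image[OF img] by blast
  then obtain x' where x': "x' \<in> N i" "l.\<kappa> w = h x'" by blast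
  have hx': "h x' \<noteq> \<zero>\<^bsub>E l\<^esub>" using l.\<kappa>_kernel_N[OF w(1)] w(2) x'(2) by auto
  have \<kappa>N: "linear_on R M l.N (E l) l.\<kappa>" by (rule l.\<kappa>_linear_on[OF submodule_subset[OF submodule_perp]])
  define L1 where "L1 = {z\<in>N i. h z \<in> l.\<kappa> ` l.N}"
  have L1: "submodule L1 R M" unfolding L1_def
    by (rule l.ME.submodule_preimage[OF h N_submodule l.ME.submodule_image[OF \<kappa>N submodule_perp]])
  have L1N: "L1 \<subseteq> N i" by (auto simp: L1_def)
  have "h x' \<in> l.\<kappa> ` l.N" unfolding x'(2)[symmetric] using w(1) by (rule imageI)
  then have "x' \<in> L1" using x'(1) by (simp add: L1_def)
  then obtain g m where g: "linear R M M g" "\<And>y. y \<in> carrier M \<Longrightarrow> g y \<in> L1" "m \<in> carrier M" "h (g m) \<noteq> \<zero>\<^bsub>E l\<^esub>"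
    by (rule detect[OF self_in_sigma L1 l.E.left_module_axioms linear_on_subset[OF h L1N] _ hx']) blast
  define u where "u y = inv_into l.N l.\<kappa> (h (g y))" for y
  have in\<kappa>: "h (g y) \<in> l.\<kappa> ` l.N" if "y \<in> carrier M" for y using g(2)[OF that] by (simp add: L1_def)
  have gN: "g ` carrier M \<subseteq> N i" using g(2) L1N by blast
  have u: "linear R M M u" unfolding u_def
    by (rule linear_on_comp[OF linear_on_comp[OF g(1) h gN] l.ME.linear_on_inv_into[OF \<kappa>N submodule_perp l.\<kappa>_inj]])
      (use in\<kappa> in blast)
  have \<kappa>u: "l.\<kappa> (u y) = h (g y)" if "y \<in> carrier M" for y
    unfolding u_def by (rule f_inv_into_f[OF in\<kappa>[OF that]])
  have uN: "u y \<in> N l" if "y \<in> carrier M" for y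
    unfolding u_def N_def by (rule inv_into_into[OF in\<kappa>[OF that]])
  have "u m \<noteq> \<zero>\<^bsub>M\<^esub>" using \<kappa>u[OF g(3)] g(4) l.\<kappa>_zero by auto
  then obtain v m' where v: "linear R M M v" "m' \<in> carrier M" "u (v (u m')) \<noteq> \<zero>\<^bsub>M\<^esub>"
    by (rule endo_square[OF u g(3)])
  have vc: "v (u m') \<in> carrier M" by (rule linear_on_closed[OF v(1) linear_on_closed[OF u v(2)]])
  have "g (v (u m')) \<in> N l"
    using fully_invariant_closed[OF perp_fully_invariant linear_comp[OF v(1) g(1)] uN[OF v(2), unfolded N_def]]
    unfolding N_def .
  moreover have "g (v (u m')) \<in> N i" using gN vc by blast
  ultimately have "g (v (u m')) = \<zero>\<^bsub>M\<^esub>" using disj by blast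
  then have "l.\<kappa> (u (v (u m'))) = \<zero>\<^bsub>E l\<^esub>"
    using \<kappa>u[OF vc] l.ME.linear_on_zero[OF h N_submodule] by simp
  then show False using l.\<kappa>_kernel_N uN[OF vc] v(3) unfolding N_def by blast
qed

lemma Hom_zero:
  assumes i: "i \<in> {1..n}" and l: "l \<in> {1..n}" and ne: "i \<noteq> l"
    and f: "linear R (E i) (E l) f" and x: "x \<in> carrier (E i)"
  shows "f x = \<zero>\<^bsub>E l\<^esub>"
proof -
  interpret l: prime_hull R M d U "P l" "E l" "k l" by (rule prime_hull[OF l])
  interpret i: prime_hull R M d U "P i" "E i" "k i" by (rule prime_hull[OF i])
  interpret il: two_modules R "E i" "E l" by unfold_locales
  have h: "linear_on R M (N i) (E l) (\<lambda>x. f (i.\<kappa> x))"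
    by (rule linear_comp[OF i.\<kappa>_linear_on[OF submodule_subset[OF N_submodule]] f])
  show ?thesis
  proof (rule i.linear_eqI[OF l.ess_embedded_E f il.linear_zero _ x])
    fix t u assume "t \<in> index_set (P i)" "u \<in> U t"
    then have "u \<in> N i" using U_subset_perp unfolding N_def by blast
    then show "f (i.\<kappa> u) = \<zero>\<^bsub>E l\<^esub>" by (rule Hom_zero_on[OF i l ne h])
  qed
qed

text \<open>\<open>N i\<close> sits in the hull of M through j and in \<open>E i\<close> through
  \<open>K i\<close>. The maps \<open>is_proj\<close> and \<open>is_incl\<close> extend the identity
  of \<open>N i\<close> in the two directions.\<close>

definition is_proj where
  "is_proj i a \<longleftrightarrow> linear R Mhat (E i) a \<and> (\<forall>x\<in>N i. a (j x) = K i x)"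

definition is_incl where
  "is_incl i b \<longleftrightarrow> linear R (E i) Mhat b \<and> (\<forall>x\<in>N i. b (K i x) = j x)"

lemma exists_proj: assumes i: "i \<in> {1..n}" shows "\<exists>a. is_proj i a"
proof -
  interpret i: prime_hull R M d U "P i" "E i" "k i" by (rule prime_hull[OF i])
  have jN: "linear_on R M (N i) Mhat j" by (rule linear_on_subset[OF j_linear submodule_subset[OF N_submodule]])
  have inj: "inj_on j (N i)" by (rule inj_on_subset[OF j_inj submodule_subset[OF N_submodule]])
  have im: "inv_into (N i) j ` j ` N i \<subseteq> carrier M" using inj N_carrier by (auto simp: inv_into_f_f)
  have l: "linear_on R Mhat (j ` N i) (E i) (\<lambda>z. i.\<kappa> (inv_into (N i) j z))"
    by (rule linear_on_comp[OF MH.linear_on_inv_into[OF jN N_submodule inj] i.\<kappa>_linear im])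
  obtain a where a: "linear R Mhat (E i) a" "\<And>z. z \<in> j ` N i \<Longrightarrow> a z = i.\<kappa> (inv_into (N i) j z)"
    by (rule injective_extend[OF i.injective_E sigma_Mhat MH.submodule_image[OF jN N_submodule] l]) blast
  have "a (j x) = K i x" if "x \<in> N i" for x
    using a(2)[OF imageI[OF that]] inv_into_f_f[OF inj that] unfolding K_def i.\<kappa>_def by simp
  then show ?thesis using a(1) unfolding is_proj_def by blast
qed

lemma exists_incl: assumes i: "i \<in> {1..n}" shows "\<exists>b. is_incl i b"
proof -
  interpret i: prime_hull R M d U "P i" "E i" "k i" by (rule prime_hull[OF i])
  have jN: "linear_on R M i.N Mhat j" by (rule linear_on_subset[OF j_linear submodule_subset[OF submodule_perp]])
  obtain b where "linear R (E i) Mhat b" "\<And>x. x \<in> i.N \<Longrightarrow> b (i.\<kappa> x) = j x"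
    by (rule i.extend_along_\<kappa>[OF injective_Mhat submodule_perp order_refl jN]) blast
  then show ?thesis unfolding is_incl_def N_def K_def i.\<kappa>_def by blast
qed

definition \<alpha> where "\<alpha> i = (SOME a. is_proj i a)"
definition \<beta> where "\<beta> i = (SOME b. is_incl i b)"

lemma \<alpha>_linear: "i \<in> {1..n} \<Longrightarrow> linear R Mhat (E i) (\<alpha> i)"
  and \<alpha>_j: "i \<in> {1..n} \<Longrightarrow> x \<in> N i \<Longrightarrow> \<alpha> i (j x) = K i x"
  using someI_ex[OF exists_proj] unfolding \<alpha>_def is_proj_def by blast+

lemma \<beta>_linear: "i \<in> {1..n} \<Longrightarrow> linear R (E i) Mhat (\<beta> i)"
  and \<beta>_K: "i \<in> {1..n} \<Longrightarrow> x \<in> N i \<Longrightarrow> \<beta> i (K i x) = j x"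
  using someI_ex[OF exists_incl] unfolding \<beta>_def is_incl_def by blast+

lemma K_closed: "i \<in> {1..n} \<Longrightarrow> x \<in> N i \<Longrightarrow> K i x \<in> carrier (E i)"
  using prime_hull.\<kappa>_closed[OF prime_hull N_carrier] prime_hull.\<kappa>_def[OF prime_hull] unfolding K_def by metis

lemma \<alpha>_closed: "i \<in> {1..n} \<Longrightarrow> y \<in> carrier Mhat \<Longrightarrow> \<alpha> i y \<in> carrier (E i)"
  by (rule linear_on_closed[OF \<alpha>_linear])

lemma \<beta>_closed: "i \<in> {1..n} \<Longrightarrow> x \<in> carrier (E i) \<Longrightarrow> \<beta> i x \<in> carrier Mhat"
  by (rule linear_on_closed[OF \<beta>_linear])

text \<open>Both maps are the identity on the common copy of \<open>N i\<close>, which contains the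
  uniform submodules of its block.\<close>

lemma \<alpha>_\<beta>:
  assumes i: "i \<in> {1..n}" and x: "x \<in> carrier (E i)" shows "\<alpha> i (\<beta> i x) = x"
proof -
  interpret i: prime_hull R M d U "P i" "E i" "k i" by (rule prime_hull[OF i])
  have id: "linear R (E i) (E i) (\<lambda>x. x)" by (simp add: linear_on_def)
  show ?thesis
  proof (rule i.linear_eqI[OF i.ess_embedded_E linear_comp[OF \<beta>_linear[OF i] \<alpha>_linear[OF i]] id _ x])
    fix t u assume "t \<in> index_set (P i)" "u \<in> U t"
    then have u: "u \<in> N i" using U_subset_perp unfolding N_def by blast
    have "\<alpha> i (\<beta> i (K i u)) = K i u" by (simp only: \<beta>_K[OF i u] \<alpha>_j[OF i u])
    then show "\<alpha> i (\<beta> i (i.\<kappa> u)) = i.\<kappa> u" unfolding K_def i.\<kappa>_def .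
  qed
qed

lemma \<alpha>_f_\<beta>_other:
  assumes "i \<in> {1..n}" "l \<in> {1..n}" "i \<noteq> l" "linear R Mhat Mhat f" "x \<in> carrier (E i)"
  shows "\<alpha> l (f (\<beta> i x)) = \<zero>\<^bsub>E l\<^esub>"
  by (rule Hom_zero[OF assms(1-3) linear_comp[OF linear_comp[OF \<beta>_linear[OF assms(1)] assms(4)] \<alpha>_linear[OF assms(2)]] assms(5)])

lemma \<alpha>_\<beta>_other:
  assumes "i \<in> {1..n}" "l \<in> {1..n}" "i \<noteq> l" "x \<in> carrier (E i)"
  shows "\<alpha> l (\<beta> i x) = \<zero>\<^bsub>E l\<^esub>"
  by (rule Hom_zero[OF assms(1-3) linear_comp[OF \<beta>_linear[OF assms(1)] \<alpha>_linear[OF assms(2)]] assms(4)])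

text \<open>If y is nonzero, the cyclic module of y contains j x for some nonzero x in some
  \<open>N i\<close>, and \<open>\<alpha> i\<close> is injective on the copy of
  \<open>N i\<close>.\<close>

lemma \<alpha>_faithful:
  assumes y: "y \<in> carrier Mhat" and z: "\<And>i. i \<in> {1..n} \<Longrightarrow> \<alpha> i y = \<zero>\<^bsub>E i\<^esub>"
  shows "y = \<zero>\<^bsub>Mhat\<^esub>"
proof (rule ccontr)
  assume ne: "y \<noteq> \<zero>\<^bsub>Mhat\<^esub>"
  have yc: "submodule (H.cyclic y) R Mhat" "H.cyclic y \<noteq> {\<zero>\<^bsub>Mhat\<^esub>}"
    using H.submodule_cyclic[OF y] H.cyclic_self[OF y] ne by blast+
  obtain i x where x: "i \<in> {1..n}" "x \<in> N i" "x \<noteq> \<zero>\<^bsub>M\<^esub>" "j x \<in> H.cyclic y" by (rule meets_N_image[OF yc])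
  interpret i: prime_hull R M d U "P i" "E i" "k i" by (rule prime_hull[OF x(1)])
  obtain r where r: "r \<in> carrier R" "j x = r \<odot>\<^bsub>Mhat\<^esub> y" using x(4) unfolding H.cyclic_def by blast
  have "\<alpha> i (j x) = \<zero>\<^bsub>E i\<^esub>"
    unfolding r(2) linear_on_smult[OF \<alpha>_linear[OF x(1)] r(1) y] z[OF x(1)] by (rule i.E.smult_r_null[OF r(1)])
  then have "i.\<kappa> x = \<zero>\<^bsub>E i\<^esub>" using \<alpha>_j[OF x(1,2)] unfolding K_def i.\<kappa>_def by simp
  then show False using i.\<kappa>_kernel_N x(2,3) unfolding N_def by blast
qed

lemma \<alpha>_eqI:
  assumes y: "y \<in> carrier Mhat" "y' \<in> carrier Mhat" and e: "\<And>i. i \<in> {1..n} \<Longrightarrow> \<alpha> i y = \<alpha> i y'"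
  shows "y = y'"
proof -
  have "y \<ominus>\<^bsub>Mhat\<^esub> y' = \<zero>\<^bsub>Mhat\<^esub>"
  proof (rule \<alpha>_faithful)
    show "y \<ominus>\<^bsub>Mhat\<^esub> y' \<in> carrier Mhat" using y by simp
    fix i assume i: "i \<in> {1..n}"
    interpret i: prime_hull R M d U "P i" "E i" "k i" by (rule prime_hull[OF i])
    interpret Hi: two_modules R Mhat "E i" by unfold_locales
    show "\<alpha> i (y \<ominus>\<^bsub>Mhat\<^esub> y') = \<zero>\<^bsub>E i\<^esub>"
      using Hi.linear_on_minus[OF \<alpha>_linear[OF i] H.submodule_carrier y] e[OF i] \<alpha>_closed[OF i y(2)]
      by (simp add: i.E.minus_zero_eq)
  qed
  then show ?thesis using H.minus_zero_eq[OF y] by simp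
qed

text \<open>The image of \<open>E i\<close> in the hull of M is stable under every endomorphism,
  because the components in the other blocks are maps between different hulls and vanish. This makes
  \<open>component\<close> multiplicative.\<close>

lemma f_\<beta>:
  assumes i: "i \<in> {1..n}" and f: "linear R Mhat Mhat f" and x: "x \<in> carrier (E i)"
  shows "f (\<beta> i x) = \<beta> i (\<alpha> i (f (\<beta> i x)))"
proof (rule \<alpha>_eqI)
  have c: "f (\<beta> i x) \<in> carrier Mhat" by (rule linear_on_closed[OF f \<beta>_closed[OF i x]])
  show "f (\<beta> i x) \<in> carrier Mhat" by (rule c)
  show "\<beta> i (\<alpha> i (f (\<beta> i x))) \<in> carrier Mhat" by (intro \<beta>_closed[OF i] \<alpha>_closed[OF i] c)
  fix l assume l: "l \<in> {1..n}"
  show "\<alpha> l (f (\<beta> i x)) = \<alpha> l (\<beta> i (\<alpha> i (f (\<beta> i x))))"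
  proof (cases "i = l")
    case True
    then show ?thesis using \<alpha>_\<beta>[OF i \<alpha>_closed[OF i c]] by simp
  next
    case False
    then show ?thesis using \<alpha>_f_\<beta>_other[OF i l False f x] \<alpha>_\<beta>_other[OF i l False \<alpha>_closed[OF i c]] by simp
  qed
qed

text \<open>The images of the \<open>E i\<close> contain the copies of the \<open>N i\<close>, and
  every nonzero submodule of the hull meets one of these copies.\<close>

lemma Mhat_eqI:
  assumes f: "linear R Mhat Mhat f" and g: "linear R Mhat Mhat g"
    and e: "\<And>i x. i \<in> {1..n} \<Longrightarrow> x \<in> carrier (E i) \<Longrightarrow> f (\<beta> i x) = g (\<beta> i x)" and y: "y \<in> carrier Mhat"
  shows "f y = g y"
proof (rule ess_embedded_eq[OF ess_embedded_Mhat sigma_Mhat H.submodule_carrier f g _ y])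
  fix L assume L: "submodule L R Mhat" "L \<noteq> {\<zero>\<^bsub>Mhat\<^esub>}"
  obtain i x where x: "i \<in> {1..n}" "x \<in> N i" "x \<noteq> \<zero>\<^bsub>M\<^esub>" "j x \<in> L" by (rule meets_N_image[OF L])
  have "j x \<noteq> \<zero>\<^bsub>Mhat\<^esub>" using j_kernel[OF N_carrier[OF x(2)]] x(3) by blast
  moreover have "f (j x) = g (j x)" using e[OF x(1) K_closed[OF x(1,2)]] \<beta>_K[OF x(1,2)] by simp
  ultimately show "\<exists>x\<in>L. x \<noteq> \<zero>\<^bsub>Mhat\<^esub> \<and> f x = g x" using x(4) by blast
qed

text \<open>The i-th diagonal entry of f with respect to the blocks \<open>E i\<close>; the
  off-diagonal entries vanish by \<open>\<alpha>_f_\<beta>_other\<close>.\<close>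

definition component where "component i f = restrict (\<lambda>x. \<alpha> i (f (\<beta> i x))) (carrier (E i))"

lemma component_hom:
  assumes i: "i \<in> {1..n}"
  shows "component i \<in> ring_hom (End_ring R Mhat) (End_ring R (E i))"
proof -
  interpret i: prime_hull R M d U "P i" "E i" "k i" by (rule prime_hull[OF i])
  show ?thesis
  proof (rule ring_hom_memI)
    fix f assume "f \<in> carrier (End_ring R Mhat)"
    then have f: "linear R Mhat Mhat f" by (simp add: End_ring_simps linear_Hom)
    show "component i f \<in> carrier (End_ring R (E i))"
      unfolding component_def
      by (rule i.End_restrict[OF linear_comp[OF linear_comp[OF \<beta>_linear[OF i] f] \<alpha>_linear[OF i]]])
    fix g assume "g \<in> carrier (End_ring R Mhat)"
    then have g: "linear R Mhat Mhat g" by (simp add: End_ring_simps linear_Hom)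
    have fc: "f (\<beta> i x) \<in> carrier Mhat" and gc: "g (\<beta> i x) \<in> carrier Mhat" if "x \<in> carrier (E i)" for x
      using linear_on_closed[OF f \<beta>_closed[OF i that]] linear_on_closed[OF g \<beta>_closed[OF i that]] .
    show "component i (f \<otimes>\<^bsub>End_ring R Mhat\<^esub> g) = component i f \<otimes>\<^bsub>End_ring R (E i)\<^esub> component i g"
      unfolding End_ring_simps component_def compose_def
    proof (rule restrict_ext)
      fix x assume x: "x \<in> carrier (E i)"
      show "\<alpha> i ((\<lambda>x\<in>carrier Mhat. f (g x)) (\<beta> i x)) =
        (\<lambda>x\<in>carrier (E i). \<alpha> i (f (\<beta> i x))) ((\<lambda>x\<in>carrier (E i). \<alpha> i (g (\<beta> i x))) x)"
        using x \<beta>_closed[OF i x] \<alpha>_closed[OF i gc[OF x]] f_\<beta>[OF i g x, symmetric] by simp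
    qed
    show "component i (f \<oplus>\<^bsub>End_ring R Mhat\<^esub> g) = component i f \<oplus>\<^bsub>End_ring R (E i)\<^esub> component i g"
      unfolding End_ring_simps component_def
    proof (rule restrict_ext)
      fix x assume x: "x \<in> carrier (E i)"
      show "\<alpha> i ((\<lambda>x\<in>carrier Mhat. f x \<oplus>\<^bsub>Mhat\<^esub> g x) (\<beta> i x)) =
        (\<lambda>x\<in>carrier (E i). \<alpha> i (f (\<beta> i x))) x \<oplus>\<^bsub>E i\<^esub> (\<lambda>x\<in>carrier (E i). \<alpha> i (g (\<beta> i x))) x"
        using x \<beta>_closed[OF i x] linear_on_add[OF \<alpha>_linear[OF i] fc[OF x] gc[OF x]] by simp
    qed
  next
    show "component i \<one>\<^bsub>End_ring R Mhat\<^esub> = \<one>\<^bsub>End_ring R (E i)\<^esub>"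
      unfolding End_ring_simps component_def
      by (rule restrict_ext) (simp add: \<alpha>_\<beta>[OF i] \<beta>_closed[OF i])
  qed
qed

text \<open>The map sought is the sum over t of \<open>q t\<close> conjugated by
  \<open>\<alpha> t\<close> and \<open>\<beta> t\<close>. It is formed one index at a time, with
  zero on the blocks not yet treated.\<close>

lemma exists_gluing:
  assumes q: "\<And>i. i \<in> {1..n} \<Longrightarrow> linear R (E i) (E i) (q i)"
  obtains f where "linear R Mhat Mhat f" "\<And>i x. i \<in> {1..n} \<Longrightarrow> x \<in> carrier (E i) \<Longrightarrow> f (\<beta> i x) = \<beta> i (q i x)"
proof -
  have "\<exists>f. linear R Mhat Mhat f \<and> (\<forall>i\<in>{1..n}. \<forall>x\<in>carrier (E i). f (\<beta> i x) = (if i \<in> T then \<beta> i (q i x) else \<zero>\<^bsub>Mhat\<^esub>))"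
    if "finite T" "T \<subseteq> {1..n}" for T
    using that
  proof (induction T)
    case empty
    show ?case by (rule exI[of _ "\<lambda>x. \<zero>\<^bsub>Mhat\<^esub>"]) (simp add: HH.linear_zero)
  next
    case (insert t T)
    then have t: "t \<in> {1..n}" by blast
    interpret t: prime_hull R M d U "P t" "E t" "k t" by (rule prime_hull[OF t])
    interpret tH: two_modules R "E t" Mhat by unfold_locales
    obtain f where f: "linear R Mhat Mhat f"
      "\<And>i x. i \<in> {1..n} \<Longrightarrow> x \<in> carrier (E i) \<Longrightarrow> f (\<beta> i x) = (if i \<in> T then \<beta> i (q i x) else \<zero>\<^bsub>Mhat\<^esub>)"
      using insert by blast
    have g: "linear R Mhat Mhat (\<lambda>y. \<beta> t (q t (\<alpha> t y)))"
      by (rule linear_comp[OF linear_comp[OF \<alpha>_linear[OF t] q[OF t]] \<beta>_linear[OF t]])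
    have z: "\<beta> t (q t \<zero>\<^bsub>E t\<^esub>) = \<zero>\<^bsub>Mhat\<^esub>"
      by (rule tH.linear_on_zero[OF linear_comp[OF q[OF t] \<beta>_linear[OF t]] t.E.submodule_carrier])
    show ?case
    proof (intro exI conjI ballI)
      show "linear R Mhat Mhat (\<lambda>y. f y \<oplus>\<^bsub>Mhat\<^esub> \<beta> t (q t (\<alpha> t y)))" by (rule HH.linear_on_sum[OF f(1) g])
      fix i x assume i: "i \<in> {1..n}" and x: "x \<in> carrier (E i)"
      have c: "\<beta> i (q i x) \<in> carrier Mhat" by (rule \<beta>_closed[OF i linear_on_closed[OF q[OF i] x]])
      show "f (\<beta> i x) \<oplus>\<^bsub>Mhat\<^esub> \<beta> t (q t (\<alpha> t (\<beta> i x))) = (if i \<in> insert t T then \<beta> i (q i x) else \<zero>\<^bsub>Mhat\<^esub>)"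
      proof (cases "i = t")
        case True
        then show ?thesis using f(2)[OF i x] insert.hyps(2) \<alpha>_\<beta>[OF i x] c by simp
      next
        case False
        then show ?thesis using f(2)[OF i x] \<alpha>_\<beta>_other[OF i t False x] z c by simp
      qed
    qed
  qed
  from this[OF finite_atLeastAtMost order_refl] show ?thesis using that by auto
qed

text \<open>Endomorphisms of the hull of M preserve the blocks and are determined on them, so the
  list of diagonal components loses nothing; \<open>exists_gluing\<close> realises every
  list.\<close>

theorem End_iso: "End_ring R Mhat \<simeq> RDirProd_list (map (\<lambda>i. End_ring R (E i)) [1..<n + 1])"
proof -
  let ?\<Psi> = "\<lambda>f. map (\<lambda>i. component i f) [1..<n + 1]"
  have mem: "i \<in> set [1..<n + 1] \<longleftrightarrow> i \<in> {1..n}" for i by auto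
  have hom: "?\<Psi> \<in> ring_hom (End_ring R Mhat) (RDirProd_list (map (\<lambda>i. End_ring R (E i)) [1..<n + 1]))"
    by (rule RDirProd_list_hom) (simp only: mem component_hom)
  have comp: "component i f x = \<alpha> i (f (\<beta> i x))" if "x \<in> carrier (E i)" for i f x
    using that by (simp add: component_def)
  have "inj_on ?\<Psi> (carrier (End_ring R Mhat))"
  proof (rule inj_onI)
    fix f g assume "f \<in> carrier (End_ring R Mhat)" "g \<in> carrier (End_ring R Mhat)" and e: "?\<Psi> f = ?\<Psi> g"
    then have fg: "f \<in> Hom R Mhat Mhat" "g \<in> Hom R Mhat Mhat" by (simp_all add: End_ring_simps)
    note f = linear_Hom[OF fg(1)] and g = linear_Hom[OF fg(2)]
    have "\<forall>i\<in>set [1..<n + 1]. component i f = component i g" using e by (simp only: map_eq_conv)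
    then have c: "component i f = component i g" if "i \<in> {1..n}" for i
      using that by (simp only: mem)
    show "f = g"
    proof (rule Hom_ext[OF fg], rule Mhat_eqI[OF f g])
      fix i x assume i: "i \<in> {1..n}" and x: "x \<in> carrier (E i)"
      have "\<alpha> i (f (\<beta> i x)) = \<alpha> i (g (\<beta> i x))"
        using comp[OF x, of f] comp[OF x, of g] c[OF i] by simp
      then show "f (\<beta> i x) = g (\<beta> i x)" using f_\<beta>[OF i f x] f_\<beta>[OF i g x] by simp
    qed
  qed
  moreover have "carrier (RDirProd_list (map (\<lambda>i. End_ring R (E i)) [1..<n + 1])) \<subseteq> ?\<Psi> ` carrier (End_ring R Mhat)"
  proof
    fix qs assume qs: "qs \<in> carrier (RDirProd_list (map (\<lambda>i. End_ring R (E i)) [1..<n + 1]))"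
    have len: "length qs = n" using RDirProd_list_carrier_mem(1)[OF qs] by simp
    \<comment> \<open>The indices run from 1 to n, whereas list positions start at 0.\<close>
    define q where "q i = qs ! (i - 1)" for i
    have qH: "q i \<in> Hom R (E i) (E i)" if i: "i \<in> {1..n}" for i
    proof -
      have l: "i - 1 < length (map (\<lambda>i. End_ring R (E i)) [1..<n + 1])" using i by auto
      have "map (\<lambda>i. End_ring R (E i)) [1..<n + 1] ! (i - 1) = End_ring R (E i)"
        using i by (cases i) (auto simp del: upt_Suc)
      from RDirProd_list_carrier_mem(2)[OF qs l, unfolded this] show ?thesis
        unfolding q_def by (simp add: End_ring_simps)
    qed
    obtain f where f: "linear R Mhat Mhat f"
      "\<And>i x. i \<in> {1..n} \<Longrightarrow> x \<in> carrier (E i) \<Longrightarrow> f (\<beta> i x) = \<beta> i (q i x)"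
      using exists_gluing[OF linear_Hom[OF qH]] by blast
    have ci: "component i (restrict f (carrier Mhat)) = q i" if i: "i \<in> {1..n}" for i
    proof (rule extensionalityI)
      show "component i (restrict f (carrier Mhat)) \<in> extensional (carrier (E i))" by (simp add: component_def)
      show "q i \<in> extensional (carrier (E i))" using qH[OF i] by (simp add: Hom_iff)
      fix x assume x: "x \<in> carrier (E i)"
      show "component i (restrict f (carrier Mhat)) x = q i x"
        using x f(2)[OF i x] \<beta>_closed[OF i x] \<alpha>_\<beta>[OF i Hom_closed[OF qH[OF i] x]] by (simp add: comp)
    qed
    have "?\<Psi> (restrict f (carrier Mhat)) = qs"
    proof (rule nth_equalityI)
      fix m assume "m < length (?\<Psi> (restrict f (carrier Mhat)))"
      then have m: "m < n" by (simp del: upt_Suc)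
      have "?\<Psi> (restrict f (carrier Mhat)) ! m = component (m + 1) (restrict f (carrier Mhat))"
        using m by (simp del: upt_Suc)
      also have "\<dots> = qs ! m" using ci[of "m + 1"] m by (simp add: q_def)
      finally show "?\<Psi> (restrict f (carrier Mhat)) ! m = qs ! m" .
    qed (simp add: len del: upt_Suc)
    moreover have "restrict f (carrier Mhat) \<in> carrier (End_ring R Mhat)"
      unfolding End_ring_simps by (rule HH.Hom_restrict[OF f(1)])
    ultimately show "qs \<in> ?\<Psi> ` carrier (End_ring R Mhat)" by blast
  qed
  moreover have "?\<Psi> ` carrier (End_ring R Mhat) \<subseteq> carrier (RDirProd_list (map (\<lambda>i. End_ring R (E i)) [1..<n + 1]))"
    using ring_hom_closed[OF hom] by blast
  ultimately have "bij_betw ?\<Psi> (carrier (End_ring R Mhat)) (carrier (RDirProd_list (map (\<lambda>i. End_ring R (E i)) [1..<n + 1])))"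
    unfolding bij_betw_def by blast
  then show ?thesis using hom unfolding is_ring_iso_def ring_iso_def by blast
qed

end

theorem theorem2p19:
  fixes R :: "('a, 'r) ring_scheme"
    and M :: "('a, 'm) module"
    and Mhat :: "('a, 'h) module" and j :: "'m \<Rightarrow> 'h"
    and n :: nat and P :: "nat \<Rightarrow> 'm set"
    and E :: "nat \<Rightarrow> ('a, 'e) module" and k :: "nat \<Rightarrow> 'm set \<Rightarrow> 'e"
  assumes "ring R" and "left_module R M"
    and "progenerator_in_sigma R M"
    and "semiprime_module R M"
    and "Goldie_module R M"
    and "bij_betw P {1..n} (minimal_primes_in R M)"
    and "injective_hull_in_sigma R M M Mhat j"
    and "\<forall>i\<in>{1..n}. injective_hull_in_sigma R M (quotient_module M (P i)) (E i) (k i)"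
  shows "End_ring R Mhat \<simeq> RDirProd_list (map (\<lambda>i. End_ring R (E i)) [1..<n + 1])
    \<and> (\<forall>i\<in>{1..n}.
         simple_ring (End_ring R (E i)) \<and> right_artinian (End_ring R (E i)) \<and>
         classical_right_quotient_ring (End_ring R (E i)) (End_ring R (quotient_module M (P i))))"
proof -
  \<comment> \<open>Membership of M in sigma[M] is one of the conditions in the definition of its
    hull.\<close>
  have "in_sigma R M M" using assms(7) by (simp add: injective_hull_in_sigma_def)
  then have sg: "semiprime_goldie R M"
    using assms(2-5) by (simp add: semiprime_goldie_def semiprime_goldie_axioms_def)
  obtain d where "has_uniform_dimension R M d" using assms(5) unfolding Goldie_module_def by (elim conjE exE)
  then obtain U where "(\<forall>i<d. uniform_submodule R M (U i)) \<and> independent_submodules R M {..<d} U \<and>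
    essential_submodule R M (submodule_generated R M (\<Union>i<d. U i))"
    unfolding has_uniform_dimension_def by (elim exE)
  then interpret uniform_decomposition R M d U
    using sg by (simp add: uniform_decomposition_def uniform_decomposition_axioms_def)
  interpret hull_family R M d U Mhat j n P E k
    using assms(6-8) by unfold_locales auto
  show ?thesis
    using End_iso prime_hull.End_simple[OF prime_hull] prime_hull.End_right_artinian[OF prime_hull]
      prime_hull.End_classical_quotient[OF prime_hull] by blast
qed

end
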